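(* Let $D_+$ be a link diagram with a chosen crossing, and let $D_0$ (resp. $D_\infty$) be the diagram obtained from $D_+$ by smoothing that crossing according to the positive (resp. negative) marker. If $D_\infty$ is $H$-$(k_1(D_\infty),k_2(D_\infty))$-thick and $D_0$ is $H$-$(k_1(D_0),k_2(D_0))$-thick, then $D_+$ is $H$-$(k_1(D_+),k_2(D_+))$-thick, where $$k_1(D_+)=\max\Bigl(k_1(D_\infty)+\tfrac12\bigl(|s_+(D_\infty)|-|s_+(D_+)|+1\bigr),\ k_1(D_0)\Bigr),$$ $$k_2(D_+)=\max\Bigl(k_2(D_\infty),\ k_2(D_0)+\tfrac12\bigl(|s_-(D_0)|-|s_-(D_+)|+1\bigr)\Bigr).$$ In particular: (i) if $|s_+(D_+)|-|s_+(D_\infty)|=1$, as is always the case when $D_+$ is $+$-adequate, then $k_1(D_+)=\max(k_1(D_\infty),k_1(D_0))$; (ii) if $|s_-(D_+)|-|s_-(D_0)|=1$, as is always the case when $D_+$ is $-$-adequate, then $k_2(D_+)=\max(k_2(D_\infty),k_2(D_0))$.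
   Context: Khovanov homology (framed unoriented version). A link diagram $D$ is a diagram on the disc of an unoriented framed link in the 3-ball. A Kauffman state $s$ of $D$ assigns to each crossing a marker $+1$ or $-1$. The smoothing of a crossing given by a positive marker joins the two regions swept out when the over-strand is rotated counterclockwise towards the under-strand (Kauffman's $A$-smoothing); a negative marker gives the other smoothing. $D_s$ is the system of circles obtained by smoothing all crossings according to $s$, $|s|$ is the number of circles of $D_s$, and $\sigma(s)$ is the number of positive markers minus the number of negative markers. $s_+=s_+(D)$ (resp. $s_-=s_-(D)$) is the state with all markers positive (resp. negative). An enhanced state $S$ is a Kauffman state $s$ with a sign $+$ or $-$ assigned to each circle of $D_s$; $D_S=D_s$, $\sigma(S)=\sigma(s)$, and $\tau(S)$ is the number of positive circles minus the number of negative circles. $\mathcal{C}_{i,j}(D)$ is the free abelian group on the enhanced states $S$ with $\sigma(S)=i$ and $\sigma(S)+2\tau(S)=j$. After ordering the crossings, $d_{i,j}:\mathcal{C}_{i,j}(D)\to\mathcal{C}_{i-2,j}(D)$ is $d(S)=\sum_{S'}(-1)^{t(S:S')}[S:S']S'$, summed over enhanced states $S'$ generating $\mathcal{C}_{i-2,j}(D)$, where $[S:S']=1$ if the markers of $S$ and $S'$ differ at exactly one crossing $c$ and all circles of $D_S$ and $D_{S'}$ not touching $c$ have the same signs in $S$ and $S'$, and $[S:S']=0$ otherwise; $t(S:S')$ is the number of negative markers of $S$ at crossings bigger than $c$. $H_{i,j}(D)=\ker(d_{i,j})/d_{i+2,j}(\mathcal{C}_{i+2,j}(D))$. Thickness.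 A link diagram $D$ with $N$ crossings is $H$-$(k_1,k_2)$-thick if $H_{i,j}(D)=0$ with a possible exception of $i,j$ satisfying $N-2|s_-(D)|-4k_2\le j-2i\le 2|s_+(D)|-N+4k_1$. Adequacy. $D$ is $+$-adequate (resp. $-$-adequate) if in $D_{s_+}$ (resp. $D_{s_-}$) every crossing connects two different circles. *)

theory Defs
  imports Complex_Main "HOL-Library.Disjoint_Sets" "HOL-Algebra.Free_Abelian_Groups"
begin

text \<open>
  A diagram is recorded by the 4-valent plane graph underlying it, as a combinatorial map.
  The elements of \<open>darts D\<close> are half-edges; every arc is the set of its two half-edges. The
  vertices are the crossings and additional marked points of valency two. At a crossing \<open>c\<close>,
  the half-edges \<open>ends D c 0\<close>, \<dots>, \<open>ends D c 3\<close> are listed in counterclockwise order, the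
  under-strand being \<open>{ends D c 0, ends D c 2}\<close> and the over-strand
  \<open>{ends D c 1, ends D c 3}\<close>. A marked point is the set of the two half-edges meeting there;
  marked points have no geometric meaning, but allow a component without crossings
  to be recorded (as a cycle through at least one marked point), and allow smoothing without
  renaming arcs.
\<close>

record ('c, 'd) diagram =
  crossings :: "'c set"
  ends :: "'c \<Rightarrow> nat \<Rightarrow> 'd"
  arcs :: "'d set set"
  points :: "'d set set"

definition darts :: "('c, 'd) diagram \<Rightarrow> 'd set" where
  "darts D = \<Union> (arcs D)"

definition ends_at :: "('c, 'd) diagram \<Rightarrow> 'c \<Rightarrow> 'd set" where
  "ends_at D c = ends D c ` {..<4}"

definition link_graph :: "('c, 'd) diagram \<Rightarrow> bool" where
  "link_graph D \<longleftrightarrow>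
     finite (darts D) \<and>
     partition_on (darts D) (arcs D) \<and> (\<forall>a\<in>arcs D. card a = 2) \<and>
     finite (crossings D) \<and>
     (\<forall>c\<in>crossings D. inj_on (ends D c) {..<4}) \<and> inj_on (ends_at D) (crossings D) \<and>
     partition_on (darts D) (points D \<union> ends_at D ` crossings D) \<and>
     (\<forall>p\<in>points D. card p = 2)"

definition eqv_classes :: "'d set \<Rightarrow> ('d \<times> 'd) set \<Rightarrow> 'd set set" where
  "eqv_classes A r = A // (r \<union> r\<inverse>)\<^sup>*"

definition together :: "'d set set \<Rightarrow> ('d \<times> 'd) set" where
  "together F = {(x, y). \<exists>A\<in>F. x \<in> A \<and> y \<in> A}"

definition components :: "('c, 'd) diagram \<Rightarrow> 'd set set" where
  "components D = eqv_classes (darts D) (together (arcs D \<union> points D \<union> ends_at D ` crossings D))"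

definition rotation :: "('c, 'd) diagram \<Rightarrow> ('d \<times> 'd) set" where
  "rotation D = {(ends D c k, ends D c (Suc k mod 4)) | c k. c \<in> crossings D \<and> k < 4} \<union>
                {(x, y). x \<noteq> y \<and> {x, y} \<in> points D}"

text \<open>
  A face is traced out by running along an arc to its other half-edge and turning to the
  next half-edge of the vertex reached.
\<close>

definition faces :: "('c, 'd) diagram \<Rightarrow> 'd set set" where
  "faces D = eqv_classes (darts D) ({(x, y). x \<noteq> y \<and> {x, y} \<in> arcs D} O rotation D)"

text \<open>
  Planarity is Euler's formula: every component has \<open>V - E + F \<le> 2\<close>, with
  equality exactly when it has genus 0. Here \<open>F\<close> counts the faces of each
  component separately, hence the summand 2 for each component.
\<close>

definition planar :: "('c, 'd) diagram \<Rightarrow> bool" where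
  "planar D \<longleftrightarrow>
     int (card (crossings D) + card (points D)) - int (card (arcs D)) + int (card (faces D))
       = 2 * int (card (components D))"

definition link_diagram :: "('c, 'd) diagram \<Rightarrow> bool" where
  "link_diagram D \<longleftrightarrow> link_graph D \<and> planar D"


text \<open>
  Rotating the over-strand counterclockwise sweeps out the regions between the ends 1, 2
  and between the ends 3, 0. Joining these two regions leaves the ends 0, 1
  connected to each other, and likewise the ends 2, 3.
\<close>

datatype sign = Pos | Neg

fun smoothed_ends :: "sign \<Rightarrow> (nat \<Rightarrow> 'd) \<Rightarrow> 'd set set" where
  "smoothed_ends Pos e = {{e 0, e 1}, {e 2, e 3}}"
| "smoothed_ends Neg e = {{e 1, e 2}, {e 3, e 0}}"

definition smoothing :: "('c, 'd) diagram \<Rightarrow> 'c \<Rightarrow> sign \<Rightarrow> ('c, 'd) diagram" where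
  "smoothing D c m =
     D\<lparr>crossings := crossings D - {c}, points := points D \<union> smoothed_ends m (ends D c)\<rparr>"

definition states :: "('c, 'd) diagram \<Rightarrow> ('c \<Rightarrow> sign) set" where
  "states D = crossings D \<rightarrow>\<^sub>E UNIV"

definition s_plus :: "('c, 'd) diagram \<Rightarrow> 'c \<Rightarrow> sign" where
  "s_plus D = (\<lambda>c\<in>crossings D. Pos)"

definition s_minus :: "('c, 'd) diagram \<Rightarrow> 'c \<Rightarrow> sign" where
  "s_minus D = (\<lambda>c\<in>crossings D. Neg)"

text \<open>A circle of \<open>D\<^sub>s\<close> is represented by the set of half-edges on it.\<close>

definition circles :: "('c, 'd) diagram \<Rightarrow> ('c \<Rightarrow> sign) \<Rightarrow> 'd set set" where
  "circles D s = eqv_classes (darts D)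
     (together (arcs D \<union> points D \<union> (\<Union>c\<in>crossings D. smoothed_ends (s c) (ends D c))))"

definition num_circles :: "('c, 'd) diagram \<Rightarrow> ('c \<Rightarrow> sign) \<Rightarrow> nat" where
  "num_circles D s = card (circles D s)"

text \<open>
  For either marker, the ends 0 and 2 lie on the two different strands of the smoothed
  crossing, so the circles connected by \<open>c\<close> are those through \<open>ends D c 0\<close> and \<open>ends D c 2\<close>.
\<close>

definition adequate_state :: "('c, 'd) diagram \<Rightarrow> ('c \<Rightarrow> sign) \<Rightarrow> bool" where
  "adequate_state D s \<longleftrightarrow>
     (\<forall>c\<in>crossings D. \<exists>C\<in>circles D s. \<exists>C'\<in>circles D s.
        ends D c 0 \<in> C \<and> ends D c 2 \<in> C' \<and> C \<noteq> C')"

definition plus_adequate :: "('c, 'd) diagram \<Rightarrow> bool" where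
  "plus_adequate D \<longleftrightarrow> adequate_state D (s_plus D)"

definition minus_adequate :: "('c, 'd) diagram \<Rightarrow> bool" where
  "minus_adequate D \<longleftrightarrow> adequate_state D (s_minus D)"


type_synonym ('c, 'd) enhanced_state = "('c \<Rightarrow> sign) \<times> ('d set \<Rightarrow> sign)"

definition enhanced_states :: "('c, 'd) diagram \<Rightarrow> ('c, 'd) enhanced_state set" where
  "enhanced_states D = (SIGMA s : states D. circles D s \<rightarrow>\<^sub>E UNIV)"

definition signature :: "('c, 'd) diagram \<Rightarrow> ('c, 'd) enhanced_state \<Rightarrow> int" where
  "signature D S = int (card {c \<in> crossings D. fst S c = Pos}) -
                   int (card {c \<in> crossings D. fst S c = Neg})"

definition tau :: "('c, 'd) diagram \<Rightarrow> ('c, 'd) enhanced_state \<Rightarrow> int" where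
  "tau D S = int (card {C \<in> circles D (fst S). snd S C = Pos}) -
             int (card {C \<in> circles D (fst S). snd S C = Neg})"

definition generators :: "('c, 'd) diagram \<Rightarrow> int \<Rightarrow> int \<Rightarrow> ('c, 'd) enhanced_state set" where
  "generators D i j =
     {S \<in> enhanced_states D. signature D S = i \<and> signature D S + 2 * tau D S = j}"

definition chain_group ::
    "('c, 'd) diagram \<Rightarrow> int \<Rightarrow> int \<Rightarrow> (('c, 'd) enhanced_state \<Rightarrow>\<^sub>0 int) monoid" where
  "chain_group D i j = free_Abelian_group (generators D i j)"

definition changed ::
    "('c, 'd) diagram \<Rightarrow> ('c, 'd) enhanced_state \<Rightarrow> ('c, 'd) enhanced_state \<Rightarrow> 'c set" where
  "changed D S S' = {c \<in> crossings D. fst S c \<noteq> fst S' c}"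

definition incidence ::
    "('c, 'd) diagram \<Rightarrow> ('c, 'd) enhanced_state \<Rightarrow> ('c, 'd) enhanced_state \<Rightarrow> int" where
  "incidence D S S' =
     (if \<exists>c. changed D S S' = {c} \<and>
             (\<forall>C \<in> circles D (fst S) \<union> circles D (fst S').
                C \<inter> ends_at D c = {} \<longrightarrow> snd S C = snd S' C)
      then 1 else 0)"

text \<open>
  The crossings are ordered by the order of the type \<open>'c\<close>, which is arbitrary. The value below is only used
  for states differing at exactly one crossing.
\<close>

definition neg_above ::
    "('c::linorder, 'd) diagram \<Rightarrow> ('c, 'd) enhanced_state \<Rightarrow> ('c, 'd) enhanced_state \<Rightarrow> nat" where
  "neg_above D S S' =
     card {c \<in> crossings D. the_elem (changed D S S') < c \<and> fst S c = Neg}"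

definition boundary ::
    "('c::linorder, 'd) diagram \<Rightarrow> int \<Rightarrow> int \<Rightarrow>
       (('c, 'd) enhanced_state \<Rightarrow>\<^sub>0 int) \<Rightarrow> (('c, 'd) enhanced_state \<Rightarrow>\<^sub>0 int)" where
  "boundary D i j =
     frag_extend (\<lambda>S. \<Sum>S'\<in>generators D (i - 2) j.
       frag_cmul ((- 1) ^ neg_above D S S' * incidence D S S') (frag_of S'))"

definition cycle_group ::
    "('c::linorder, 'd) diagram \<Rightarrow> int \<Rightarrow> int \<Rightarrow> (('c, 'd) enhanced_state \<Rightarrow>\<^sub>0 int) monoid" where
  "cycle_group D i j = subgroup_generated (chain_group D i j)
     (kernel (chain_group D i j) (chain_group D (i - 2) j) (boundary D i j))"

definition khovanov_homology ::
    "('c::linorder, 'd) diagram \<Rightarrow> int \<Rightarrow> int \<Rightarrow> (('c, 'd) enhanced_state \<Rightarrow>\<^sub>0 int) set monoid" where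
  "khovanov_homology D i j =
     cycle_group D i j Mod (boundary D (i + 2) j ` carrier (chain_group D (i + 2) j))"

definition H_thick :: "('c::linorder, 'd) diagram \<Rightarrow> real \<Rightarrow> real \<Rightarrow> bool" where
  "H_thick D k1 k2 \<longleftrightarrow>
     (\<forall>i j. \<not> (real (card (crossings D)) - 2 * real (num_circles D (s_minus D)) - 4 * k2
                \<le> real_of_int (j - 2 * i) \<and>
              real_of_int (j - 2 * i)
                \<le> 2 * real (num_circles D (s_plus D)) - real (card (crossings D)) + 4 * k1)
        \<longrightarrow> trivial_group (khovanov_homology D i j))"

end

theory Submission
  imports Defs
begin

text \<open>
  A generator of the complex of a diagram \<open>D\<close> has either marker at the chosen crossing \<open>c\<close>. The
  boundary map only turns positive markers into negative ones, so the generators with the negative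
  marker span a subcomplex, a copy of the complex of \<open>D\<^sub>\<infinity>\<close>, and those with the positive marker span
  the quotient, a copy of the complex of \<open>D\<^sub>0\<close>. Dropping a marker shifts the grading:
  \<open>H i j\<close> of \<open>D\<close> sits between \<open>H (i + 1) (j + 1)\<close> of \<open>D\<^sub>\<infinity>\<close> and \<open>H (i - 1) (j - 1)\<close> of \<open>D\<^sub>0\<close> in an exact
  sequence (\<open>exact_from_smoothings\<close>), hence vanishes if both of these do. The bounds on thickness are what
  these shifts make of the bounds for \<open>D\<^sub>\<infinity>\<close> and \<open>D\<^sub>0\<close>; their states \<open>s\<^sub>-\<close> and \<open>s\<^sub>+\<close> respectively have
  the same circles as those of \<open>D\<close>. Adequacy says that the crossing joins two
  different circles, and the other smoothing merges them into one.

  The substance is that the boundary map squares to zero, because exactness in the middle rests on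
  it. This is where planarity enters. Euler's formula makes the mod 2 cycles of the
  underlying graph coincide with the boundaries of sets of faces. All vertices have even
  valency, so the set of all arcs is such a boundary, and this colours the half-edges with two
  colours alternating along arcs and around vertices (\<open>colouring\<close>). Therefore no strand
  leaving a crossing returns to the opposite end, so changing a marker always either merges two circles
  or splits one, never turns one circle into one circle (\<open>saddle_at_crossing\<close>).

  What remains concerns partitions of the half-edges only. Two crossings give a square of four partitions
  in which each side merges or splits blocks, and the boundary map composed
  with itself counts, with opposite signs for the two ways around, the signings of the
  intermediate partition that are compatible with given signings at the ends. These
  two counts agree (\<open>saddle_square\<close>). With a positive sign counted as 1 and a negative one as 0,
  merging blocks adds their values and splitting is the same after exchanging signs; so the counts
  are determined by a few linear equations.
\<close>

section \<open>Fusing two blocks of a partition\<close>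

definition joined :: "'a set set \<Rightarrow> 'a \<Rightarrow> 'a \<Rightarrow> bool" where
  "joined P u v \<longleftrightarrow> (\<exists>X\<in>P. u \<in> X \<and> v \<in> X)"

text \<open>
  If \<open>u\<close> and \<open>v\<close> already lie in one block of a partition \<open>P\<close>, this is \<open>P\<close> itself.
\<close>

definition fuse :: "'a set set \<Rightarrow> 'a \<Rightarrow> 'a \<Rightarrow> 'a set set" where
  "fuse P u v = insert (\<Union>{X\<in>P. u \<in> X \<or> v \<in> X}) {X\<in>P. u \<notin> X \<and> v \<notin> X}"

text \<open>
  The effect of a band attached to the circles at two points: either two blocks are merged, or
  one is split and merging the two points would undo this. For a split the resulting
  partition is not determined by the points, hence a relation.
\<close>

definition saddle :: "'a \<Rightarrow> 'a \<Rightarrow> 'a set set \<Rightarrow> 'a set set \<Rightarrow> bool" where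
  "saddle u v P P' \<longleftrightarrow> \<not> joined P u v \<and> P' = fuse P u v \<or> \<not> joined P' u v \<and> P = fuse P' u v"

lemma partition_block_unique:
  "partition_on A P \<Longrightarrow> X \<in> P \<Longrightarrow> Y \<in> P \<Longrightarrow> z \<in> X \<Longrightarrow> z \<in> Y \<Longrightarrow> X = Y"
  by (metis disjointD disjoint_iff partition_onD2)

lemma fuse_blocks:
  assumes P: "partition_on A P" and "u \<in> A" "v \<in> A" and nj: "\<not> joined P u v"
  obtains X Y where "X \<in> P" "Y \<in> P" "X \<noteq> Y" "u \<in> X" "v \<in> Y"
    "fuse P u v = insert (X \<union> Y) (P - {X, Y})"
proof -
  obtain X Y where XY: "X \<in> P" "u \<in> X" "Y \<in> P" "v \<in> Y"
    using assms by (metis UnionE partition_onD1)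
  have "{Z\<in>P. u \<in> Z \<or> v \<in> Z} = {X, Y}"
    using XY partition_block_unique[OF P] by blast
  moreover have "{Z\<in>P. u \<notin> Z \<and> v \<notin> Z} = P - {X, Y}"
    using XY partition_block_unique[OF P] by blast
  moreover have "X \<noteq> Y" using XY nj by (auto simp: joined_def)
  ultimately show thesis using that XY by (auto simp: fuse_def)
qed

lemma Un_notin_partition:
  assumes P: "partition_on A P" and "X \<in> P" "Y \<in> P" "X \<noteq> Y"
  shows "X \<union> Y \<notin> P"
proof
  assume "X \<union> Y \<in> P"
  moreover obtain x y where "x \<in> X" "y \<in> Y" using assms by (metis ex_in_conv partition_onD3)
  ultimately show False using partition_block_unique[OF P] assms by (metis UnI1 UnI2)
qed

lemma partition_on_fuse:
  assumes P: "partition_on A P" and "u \<in> A" "v \<in> A"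
  shows "partition_on A (fuse P u v)"
proof -
  have eq: "X = Y" if "X \<in> P" "Y \<in> P" "z \<in> X" "z \<in> Y" for X Y z
    using partition_block_unique[OF P] that by metis
  obtain U V where U: "U \<in> P" "u \<in> U" and V: "V \<in> P" "v \<in> V"
    using assms by (metis UnionE partition_onD1)
  have sets: "\<Union>{X\<in>P. u \<in> X \<or> v \<in> X} = U \<union> V" "{X\<in>P. u \<notin> X \<and> v \<notin> X} = P - {U, V}"
    using U V eq by blast+
  have "disjnt X (U \<union> V)" if "X \<in> P - {U, V}" for X
    using that U V eq unfolding disjnt_iff by blast
  moreover have "disjnt X Y" if "X \<in> P" "Y \<in> P" "X \<noteq> Y" for X Y
    using that eq unfolding disjnt_iff by blast
  ultimately show ?thesis
    unfolding fuse_def sets using U V partition_onD1[OF P] partition_onD3[OF P]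
    by (auto simp: partition_on_def pairwise_def disjoint_def disjnt_def)
qed

lemma joined_fuse:
  assumes P: "partition_on A P" and "u \<in> A" "v \<in> A" 
  shows "joined (fuse P u v) x y \<longleftrightarrow> joined P x y \<or>
     joined P x u \<and> joined P v y \<or> joined P x v \<and> joined P u y"
proof -
  have eq: "X = Y" if "X \<in> P" "Y \<in> P" "z \<in> X" "z \<in> Y" for X Y z
    using partition_block_unique[OF P] that by metis
  obtain U V where U: "U \<in> P" "u \<in> U" and V: "V \<in> P" "v \<in> V"
    using assms by (metis UnionE partition_onD1)
  have P_u: "joined P x u \<longleftrightarrow> x \<in> U" "joined P u x \<longleftrightarrow> x \<in> U"
     "joined P x v \<longleftrightarrow> x \<in> V" "joined P v x \<longleftrightarrow> x \<in> V" for x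
    using U V eq unfolding joined_def by metis+
  have "\<Union>{X\<in>P. u \<in> X \<or> v \<in> X} = U \<union> V" "{X\<in>P. u \<notin> X \<and> v \<notin> X} = P - {U, V}"
    using U V eq by blast+
  then have "joined (fuse P u v) x y \<longleftrightarrow>
      x \<in> U \<union> V \<and> y \<in> U \<union> V \<or> (\<exists>X\<in>P - {U, V}. x \<in> X \<and> y \<in> X)"
    by (auto simp: joined_def fuse_def)
  also have "\<dots> \<longleftrightarrow> joined P x y \<or> x \<in> U \<and> y \<in> V \<or> x \<in> V \<and> y \<in> U"
    using U V unfolding joined_def by blast
  finally show ?thesis by (simp add: P_u)
qed

lemma card_fuse:
  assumes "partition_on A P" "finite P" "u \<in> A" "v \<in> A" "\<not> joined P u v"
  shows "Suc (card (fuse P u v)) = card P"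
proof -
  obtain X Y where XY: "X \<in> P" "Y \<in> P" "X \<noteq> Y" and Q: "fuse P u v = insert (X \<union> Y) (P - {X, Y})"
    using fuse_blocks[OF assms(1,3-5)] by metis
  have "card (P - {X, Y}) = card P - card {X, Y}" "card {X, Y} \<le> card P" "card {X, Y} = 2"
    using XY assms(2) card_mono[of P "{X, Y}"] by (simp_all add: card_Diff_subset)
  then show ?thesis using Q XY Un_notin_partition[OF assms(1) XY] assms(2) by (auto simp: card_insert_if)
qed

lemma fuse_commute: "fuse P u v = fuse P v u"
  unfolding fuse_def by (simp only: disj_commute conj_commute)

lemma fuse_cong:
  assumes P: "partition_on A P" and "joined P u u'"
  shows "fuse P u v = fuse P u' v"
proof -
  obtain Z where Z: "Z \<in> P" "u \<in> Z" "u' \<in> Z" using assms(2) by (auto simp: joined_def)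
  have "u \<in> X \<longleftrightarrow> u' \<in> X" if "X \<in> P" for X
    using partition_block_unique[OF P that Z(1)] Z by metis
  then show ?thesis unfolding fuse_def by (simp cong: conj_cong)
qed

lemma fuse_joined:
  assumes P: "partition_on A P" and "joined P u v"
  shows "fuse P u v = P"
proof -
  obtain Z where Z: "Z \<in> P" "u \<in> Z" "v \<in> Z" using assms(2) by (auto simp: joined_def)
  have "(u \<in> X \<or> v \<in> X) \<longleftrightarrow> X = Z" if "X \<in> P" for X
    using partition_block_unique[OF P that Z(1)] Z by metis
  then have "{X\<in>P. u \<in> X \<or> v \<in> X} = {Z}" "{X\<in>P. u \<notin> X \<and> v \<notin> X} = P - {Z}"
    using Z(1) by auto
  then show ?thesis using Z(1) by (auto simp: fuse_def)
qed

lemma fuse_eq_fuse: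
  assumes P: "partition_on A P" and A: "u \<in> A" "v \<in> A" "x \<in> A" "y \<in> A"
    and "\<not> joined P u v" "\<not> joined P x y" "joined (fuse P u v) x y"
  shows "fuse P x y = fuse P u v"
proof -
  have eq: "S = T" if "S \<in> P" "T \<in> P" "z \<in> S" "z \<in> T" for S T z
    using partition_block_unique[OF P(1)] that by metis
  have "joined P x u \<and> joined P v y \<or> joined P x v \<and> joined P u y"
    using joined_fuse[OF P A(1,2)] assms by metis
  then have "x \<in> X \<or> y \<in> X \<longleftrightarrow> u \<in> X \<or> v \<in> X" if "X \<in> P" for X
    using that eq unfolding joined_def by metis
  then have "{X\<in>P. x \<in> X \<or> y \<in> X} = {X\<in>P. u \<in> X \<or> v \<in> X}" by blast
  moreover from this have "{X\<in>P. x \<notin> X \<and> y \<notin> X} = {X\<in>P. u \<notin> X \<and> v \<notin> X}" by blast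
  ultimately show ?thesis unfolding fuse_def by simp
qed

lemma fuse_coarser: "X \<in> P \<Longrightarrow> \<exists>Y\<in>fuse P u v. X \<subseteq> Y"
  unfolding fuse_def by (cases "u \<in> X \<or> v \<in> X") auto

lemma partition_eqI:
  assumes P: "partition_on A P" and Q: "partition_on A Q"
    and eq: "\<And>x y. x \<in> A \<Longrightarrow> y \<in> A \<Longrightarrow> joined P x y \<longleftrightarrow> joined Q x y"
  shows "P = Q"
proof -
  have sub: "S \<subseteq> T" if P: "partition_on A S" and Q: "partition_on A T"
    and eq: "\<And>x y. x \<in> A \<Longrightarrow> y \<in> A \<Longrightarrow> joined S x y \<longleftrightarrow> joined T x y" for S T
  proof
    fix X assume X: "X \<in> S"
    then obtain x where x: "x \<in> X" using partition_onD3[OF P] by (metis ex_in_conv)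
    then have xA: "x \<in> A" using X partition_onD1[OF P] by blast
    then obtain Y where Y: "Y \<in> T" "x \<in> Y" using partition_onD1[OF Q] by blast
    have "y \<in> X \<longleftrightarrow> joined S x y" for y
      using X x partition_block_unique[OF P] unfolding joined_def by metis
    moreover have "y \<in> Y \<longleftrightarrow> joined T x y" for y
      using Y partition_block_unique[OF Q] unfolding joined_def by metis
    moreover have "X \<subseteq> A" "Y \<subseteq> A" using X Y partition_onD1[OF P] partition_onD1[OF Q] by blast+
    ultimately have "X = Y" using eq xA by blast
    then show "X \<in> T" using Y by simp
  qed
  show ?thesis using sub[OF P Q] sub[OF Q P] eq by blast
qed

lemma joined_sym: "joined P u v \<Longrightarrow> joined P v u"
  by (auto simp: joined_def)

lemma unchanged_by_fuse:
  assumes P: "partition_on A P" and A: "u \<in> A" "v \<in> A" and nj: "\<not> joined P u v"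
    and E: "u \<in> E" "v \<in> E" "\<And>e. e \<in> E \<Longrightarrow> joined P u e \<or> joined P v e"
    and C: "C \<in> P \<union> fuse P u v"
  shows "C \<inter> E = {} \<longleftrightarrow> C \<in> P \<inter> fuse P u v"
proof
  assume CE: "C \<inter> E = {}"
  then have "u \<notin> C" "v \<notin> C" using E by auto
  moreover have "C \<in> P"
  proof (rule ccontr)
    assume "C \<notin> P"
    then have "C = \<Union>{X\<in>P. u \<in> X \<or> v \<in> X}" using C by (simp add: fuse_def)
    moreover obtain X where "X \<in> P" "u \<in> X" using A(1) partition_onD1[OF P] by blast
    ultimately show False using \<open>u \<notin> C\<close> by blast
  qed
  ultimately show "C \<in> P \<inter> fuse P u v" by (simp add: fuse_def)
next
  assume C: "C \<in> P \<inter> fuse P u v"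
  have sep: "u \<notin> C \<and> v \<notin> C"
  proof (rule ccontr)
    assume *: "\<not> (u \<notin> C \<and> v \<notin> C)"
    then have "C \<noteq> X" if "X \<in> {X\<in>P. u \<notin> X \<and> v \<notin> X}" for X using that by blast
    then have "C = \<Union>{X\<in>P. u \<in> X \<or> v \<in> X}" using C by (auto simp: fuse_def)
    moreover obtain X Y where "X \<in> P" "u \<in> X" "Y \<in> P" "v \<in> Y"
      using A partition_onD1[OF P] by blast
    ultimately have "u \<in> C" "v \<in> C" by blast+
    then show False using nj C by (auto simp: joined_def)
  qed
  have "e \<notin> C" if e: "e \<in> E" for e
  proof
    assume "e \<in> C"
    from E(3)[OF e] obtain X where X: "X \<in> P" "e \<in> X" "u \<in> X \<or> v \<in> X" by (auto simp: joined_def)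
    then have "X = C" using \<open>e \<in> C\<close> C partition_block_unique[OF P, of X C e] by blast
    then show False using X(3) sep by blast
  qed
  then show "C \<inter> E = {}" by blast
qed

text \<open>
  The set \<open>E\<close> stands for the ends at a crossing. They lie on the one or two blocks that take part in the
  saddle, so the blocks that avoid them are those which survive it.
\<close>

lemma unchanged_by_saddle:
  assumes P: "partition_on A P" "partition_on A P'" and A: "u \<in> A" "v \<in> A" and s: "saddle u v P P'"
    and E: "u \<in> E" "v \<in> E" "\<And>e. e \<in> E \<Longrightarrow> joined P u e \<or> joined P v e"
      "\<And>e. e \<in> E \<Longrightarrow> joined P' u e \<or> joined P' v e"
    and C: "C \<in> P \<union> P'"
  shows "C \<inter> E = {} \<longleftrightarrow> C \<in> P \<inter> P'"
  using s unfolding saddle_def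
proof
  assume "\<not> joined P u v \<and> P' = fuse P u v"
  then show ?thesis using unchanged_by_fuse[OF P(1) A _ E(1,2,3), of C] C by simp
next
  assume "\<not> joined P' u v \<and> P = fuse P' u v"
  then show ?thesis using unchanged_by_fuse[OF P(2) A _ E(1,2,4), of C] C by (simp add: Un_commute Int_commute)
qed

lemma card_saddle:
  assumes P: "partition_on A P" "partition_on A P'" "finite P" "finite P'" and A: "u \<in> A" "v \<in> A"
    and s: "saddle u v P P'"
  shows "\<not> joined P u v \<Longrightarrow> card P = Suc (card P')" "\<not> joined P' u v \<Longrightarrow> card P' = Suc (card P)"
proof -
  have j: "joined (fuse Q u v) u v" if Q: "partition_on A Q" for Q
  proof -
    have "joined Q u u" "joined Q v v"
      using A partition_onD1[OF Q] by (auto simp: joined_def)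
    then show ?thesis by (simp add: joined_fuse[OF Q A])
  qed
  show "\<not> joined P u v \<Longrightarrow> card P = Suc (card P')" "\<not> joined P' u v \<Longrightarrow> card P' = Suc (card P)"
    using s j[OF P(1)] j[OF P(2)] card_fuse[OF P(1,3) A] card_fuse[OF P(2,4) A]
    unfolding saddle_def by auto
qed

text \<open>
  Up to renaming there are only two configurations: the two fusings concern different pairs of
  blocks, or the pairs share one block.
\<close>

lemma two_fusings:
  assumes P: "partition_on A Q" and A: "u \<in> A" "v \<in> A" "x \<in> A" "y \<in> A"
    and "\<not> joined Q u v" "\<not> joined (fuse Q u v) x y"
  obtains (disjoint) X Y Z W where "X \<in> Q" "Y \<in> Q" "Z \<in> Q" "W \<in> Q" "distinct [X, Y, Z, W]"
      "fuse Q u v = insert (X \<union> Y) (Q - {X, Y})" "fuse Q x y = insert (Z \<union> W) (Q - {Z, W})"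
      "fuse (fuse Q u v) x y = insert (Z \<union> W) (insert (X \<union> Y) (Q - {X, Y}) - {Z, W})"
  | (chain) X Y Z where "X \<in> Q" "Y \<in> Q" "Z \<in> Q" "distinct [X, Y, Z]"
      "fuse Q u v = insert (X \<union> Y) (Q - {X, Y})" "fuse Q x y = insert (Y \<union> Z) (Q - {Y, Z})"
      "fuse (fuse Q u v) x y = insert (X \<union> Y \<union> Z) (insert (X \<union> Y) (Q - {X, Y}) - {X \<union> Y, Z})"
proof -
  have eq: "S = T" if "S \<in> Q" "T \<in> Q" "z \<in> S" "z \<in> T" for S T z
    using partition_block_unique[OF P] that by metis
  obtain X Y where XY: "X \<in> Q" "Y \<in> Q" "X \<noteq> Y" "u \<in> X" "v \<in> Y"
      and Qb: "fuse Q u v = insert (X \<union> Y) (Q - {X, Y})"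
    using fuse_blocks[OF P] assms by metis
  have "\<not> joined Q x y" using joined_fuse[OF P] assms by metis
  then obtain Z W where ZW: "Z \<in> Q" "W \<in> Q" "Z \<noteq> W" "x \<in> Z" "y \<in> W"
      and Qa: "fuse Q x y = insert (Z \<union> W) (Q - {Z, W})"
    using fuse_blocks[OF P] assms by metis
  have "joined Q s t \<longleftrightarrow> S = T" if "s \<in> S" "t \<in> T" "S \<in> Q" "T \<in> Q" for s t S T
    using that eq unfolding joined_def by metis
  then have ne: "\<not> (Z = X \<and> W = Y)" "\<not> (Z = Y \<and> W = X)"
    using assms(7) joined_fuse[OF P A(1,2)] XY ZW by metis+
  obtain S T where ST: "S \<in> fuse Q u v" "T \<in> fuse Q u v" "x \<in> S" "y \<in> T"
      and Qba: "fuse (fuse Q u v) x y = insert (S \<union> T) (fuse Q u v - {S, T})"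
    using fuse_blocks[OF partition_on_fuse[OF P A(1,2)] A(3,4) assms(7)] by metis
  have S: "S = (if Z = X \<or> Z = Y then X \<union> Y else Z)"
    using ST(1,3) XY ZW eq unfolding Qb by (auto; metis)
  have T: "T = (if W = X \<or> W = Y then X \<union> Y else W)"
    using ST(2,4) XY ZW eq unfolding Qb by (auto; metis)
  show thesis
  proof (cases "{Z, W} \<inter> {X, Y} = {}")
    case True
    then have "S = Z" "T = W" using S T by auto
    then show thesis using disjoint[of X Y Z W] True XY ZW Qb Qa Qba by auto
  next
    case False
    then consider "Z = X" | "Z = Y" | "W = X" | "W = Y" by auto
    then show thesis
    proof cases
      case 1
      then have "S = Y \<union> X" "T = W" "W \<noteq> Y" "W \<noteq> X" using S T ne ZW by auto
      then show thesis using 1 chain[of Y X W] XY ZW Qb Qa Qba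
        by (auto simp: insert_commute Un_commute)
    next
      case 2
      then have "S = X \<union> Y" "T = W" "W \<noteq> Y" "W \<noteq> X" using S T ne ZW by auto
      then show thesis using 2 chain[of X Y W] XY ZW Qb Qa Qba
        by (auto simp: insert_commute Un_commute)
    next
      case 3
      then have "S = Z" "T = Y \<union> X" "Z \<noteq> Y" "Z \<noteq> X" using S T ne ZW by auto
      then show thesis using 3 chain[of Y X Z] XY ZW Qb Qa Qba
        by (auto simp: insert_commute Un_commute)
    next
      case 4
      then have "S = Z" "T = X \<union> Y" "Z \<noteq> Y" "Z \<noteq> X" using S T ne ZW by auto
      then show thesis using 4 chain[of X Y Z] XY ZW Qb Qa Qba
        by (auto simp: insert_commute Un_commute)
    qed
  qed
qed

section \<open>Signed partitions: merging and splitting\<close>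

fun weight :: "sign \<Rightarrow> int" where
  "weight Pos = 1"
| "weight Neg = 0"

lemma weight_cases: "weight s = 0 \<or> weight s = 1" by (cases s) auto
lemma weight_inject [simp]: "weight s = weight t \<longleftrightarrow> s = t" by (cases s; cases t) auto

lemma weight_signs:
  "2 * weight s - 1 = (if s = Pos then 1 else 0) - (if s = Neg then 1 else 0)"
  by (cases s) auto

text \<open>
  For the circles of a state this is \<open>tau\<close>.
\<close>

definition excess :: "'b set \<Rightarrow> ('b \<Rightarrow> sign) \<Rightarrow> int" where
  "excess P f = int (card {C\<in>P. f C = Pos}) - int (card {C\<in>P. f C = Neg})"

text \<open>
  The incidence relation of the boundary map, with the quantum grading expressed as a condition on the
  excess: lowering the signature by 2 has to be compensated by raising \<open>tau\<close> by 1.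
\<close>

definition linked :: "'b set \<Rightarrow> ('b \<Rightarrow> sign) \<Rightarrow> 'b set \<Rightarrow> ('b \<Rightarrow> sign) \<Rightarrow> bool" where
  "linked P f Q h \<longleftrightarrow> (\<forall>C\<in>P \<inter> Q. f C = h C) \<and> excess Q h = excess P f + 1"

lemma excess_eq_sum:
  assumes "finite P" shows "excess P f = (\<Sum>C\<in>P. 2 * weight (f C) - 1)"
proof -
  have "(\<Sum>C\<in>P. 2 * weight (f C) - 1) = (\<Sum>C\<in>P. (if f C = Pos then 1 else 0) - (if f C = Neg then 1 else 0))"
    by (rule sum.cong[OF refl]) (simp only: weight_signs)
  also have "\<dots> = excess P f"
    using assms by (simp add: excess_def sum_subtractf sum.If_cases Int_def conj_commute)
  finally show ?thesis ..
qed

text \<open>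
  With values 1 and 0 for the signs, this is the multiplication \<open>1 \<cdot> x = x\<close>, \<open>x \<cdot> x = 0\<close> on merging, where a
  positive sign stands for \<open>x\<close>, and the dual comultiplication on splitting.
\<close>

lemma linked_fuse:
  assumes "finite P" "X \<in> P" "Y \<in> P" "X \<noteq> Y" "Z \<notin> P"
    and Q: "Q = insert Z (P - {X, Y})"
  shows "linked P f Q h \<longleftrightarrow>
      (\<forall>C\<in>P - {X, Y}. f C = h C) \<and> weight (h Z) = weight (f X) + weight (f Y)"
    and "linked Q h P f \<longleftrightarrow>
      (\<forall>C\<in>P - {X, Y}. f C = h C) \<and> weight (f X) + weight (f Y) = 1 + weight (h Z)"
proof -
  have PQ: "P \<inter> Q = P - {X, Y}" "Q \<inter> P = P - {X, Y}" using assms by auto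
  let ?w = "\<lambda>g. (\<Sum>C\<in>P - {X, Y}. 2 * weight (g C) - 1)"
  have "P = insert X (insert Y (P - {X, Y}))" using assms by auto
  then have "excess P f = (\<Sum>C\<in>insert X (insert Y (P - {X, Y})). 2 * weight (f C) - 1)"
    using assms excess_eq_sum by metis
  also have "\<dots> = 2 * weight (f X) - 1 + (2 * weight (f Y) - 1 + ?w f)"
    using assms by (subst sum.insert; simp)+
  finally have 1: "excess P f = 2 * weight (f X) - 1 + (2 * weight (f Y) - 1 + ?w f)" .
  have 2: "excess Q h = 2 * weight (h Z) - 1 + ?w h"
    using assms by (simp add: excess_eq_sum Q)
  have 3: "?w f = ?w h" if "\<forall>C\<in>P - {X, Y}. f C = h C"
    using that by (intro sum.cong) auto
  show "linked P f Q h \<longleftrightarrow>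
      (\<forall>C\<in>P - {X, Y}. f C = h C) \<and> weight (h Z) = weight (f X) + weight (f Y)"
    unfolding linked_def PQ by (intro conj_cong refl) (use 1 2 3 in presburger)
  show "linked Q h P f \<longleftrightarrow>
      (\<forall>C\<in>P - {X, Y}. f C = h C) \<and> weight (f X) + weight (f Y) = 1 + weight (h Z)"
    unfolding linked_def PQ eq_commute[of "h _" "f _"]
    by (intro conj_cong refl) (use 1 2 3 in presburger)
qed

fun flip :: "sign \<Rightarrow> sign" where "flip Pos = Neg" | "flip Neg = Pos"
lemma flip_flip [simp]: "flip (flip s) = s" by (cases s) auto
lemma flip_inject [simp]: "flip s = flip t \<longleftrightarrow> s = t" by (cases s; cases t) auto
lemma flip_eq [simp]: "flip s = Pos \<longleftrightarrow> s = Neg" "flip s = Neg \<longleftrightarrow> s = Pos" by (cases s; auto)+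

lemma linked_cong:
  assumes "\<And>C. C \<in> P \<Longrightarrow> f C = f' C" and"\<And>C. C \<in> Q \<Longrightarrow> h C = h' C"
  shows "linked P f Q h \<longleftrightarrow> linked P f' Q h'"
proof -
  have "excess P f = excess P f'" "excess Q h = excess Q h'"
    unfolding excess_def using assms by (auto cong: conj_cong)
  then show ?thesis unfolding linked_def using assms by auto
qed

text \<open>
  Read backwards, with all signs exchanged, a split is a merge.
\<close>

lemma linked_flip: "linked P (flip \<circ> f) Q (flip \<circ> h) \<longleftrightarrow> linked Q h P f"
  by (auto simp: linked_def excess_def)

text \<open>
  The number of ways to get from one signed partition to another in two steps, through a given
  partition in between.
\<close>

definition routes :: "'b set \<Rightarrow> 'b set \<Rightarrow> 'b set \<Rightarrow> ('b \<Rightarrow> sign) \<Rightarrow> ('b \<Rightarrow> sign) \<Rightarrow> nat" where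
  "routes P Q R f g = card {h \<in> Q \<rightarrow>\<^sub>E UNIV. linked P f Q h \<and> linked Q h R g}"

lemma routes_flip: "routes R Q P (flip \<circ> g) (flip \<circ> f) = routes P Q R f g"
proof -
  let ?k = "\<lambda>h. restrict (flip \<circ> h) Q"
  have k: "linked R (flip \<circ> g) Q (?k h) \<longleftrightarrow> linked Q h R g"
    "linked Q (?k h) P (flip \<circ> f) \<longleftrightarrow> linked P f Q h" for h
    using linked_cong[of R "flip \<circ> g" "flip \<circ> g" Q "?k h" "flip \<circ> h"]
     linked_cong[of Q "?k h" "flip \<circ> h" P "flip \<circ> f" "flip \<circ> f"] linked_flip[of R g Q h]
     linked_flip[of Q h P f] by auto
  have kk: "?k (?k h) = h" if "h \<in> Q \<rightarrow>\<^sub>E UNIV" for h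
    using that by (auto simp: fun_eq_iff PiE_def extensional_def)
  have "bij_betw ?k {h \<in> Q \<rightarrow>\<^sub>E UNIV. linked P f Q h \<and> linked Q h R g}
     {h \<in> Q \<rightarrow>\<^sub>E UNIV. linked R (flip \<circ> g) Q h \<and> linked Q h P (flip \<circ> f)}"
    (is "bij_betw _ ?A ?B")
  proof (rule bij_betw_byWitness[where f' = ?k])
    show "?k ` ?A \<subseteq> ?B"
      using k by auto
    show "?k ` ?B \<subseteq> ?A"
    proof
      fix h' assume "h' \<in> ?k ` ?B"
      then obtain h where h: "h \<in> ?B" "h' = ?k h" by blast
      then have "?k h' = h" using kk by blast
      then show "h' \<in> ?A" using k[of h'] h by auto
    qed
    show "\<forall>h\<in>?A. ?k (?k h) = h" "\<forall>h\<in>?B. ?k (?k h) = h"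
      using kk by blast+
  qed
  from bij_betw_same_card[OF this] show ?thesis unfolding routes_def by (rule sym)
qed

text \<open>
  To count the solutions of a system which determines its solution.
\<close>

lemma card_determined:
  assumes "\<And>h. h \<in> H \<Longrightarrow> C \<and> h = h0" and "C \<Longrightarrow> h0 \<in> H"
  shows "card H = (if C then 1 else 0)"
proof -
  have "H = (if C then {h0} else {})" using assms by auto
  then show ?thesis by auto
qed

definition sign_of :: "int \<Rightarrow> sign" where "sign_of n = (if n = 1 then Pos else Neg)"

lemma weight_sign_of [simp]: "n = 0 \<or> n = 1 \<Longrightarrow> weight (sign_of n) = n"
  by (auto simp: sign_of_def)

lemma sign_eqI: "weight s = n \<Longrightarrow> s = sign_of n"
  by (cases s) (auto simp: sign_of_def)

text \<open>
  The number of positive blocks of \<open>P\<close> that are contained in \<open>B\<close>.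
\<close>

definition mass :: "'a set set \<Rightarrow> ('a set \<Rightarrow> sign) \<Rightarrow> 'a set \<Rightarrow> int" where
  "mass P f B = (\<Sum>X | X \<in> P \<and> X \<subseteq> B. weight (f X))"

lemma mass_nonneg: "0 \<le> mass P f B"
  unfolding mass_def by (rule sum_nonneg) (use weight_cases in \<open>metis order.refl zero_le_one\<close>)

lemma mass_mono: "finite P \<Longrightarrow> B \<subseteq> B' \<Longrightarrow> mass P f B \<le> mass P f B'"
  unfolding mass_def
  by (rule sum_mono2) (auto intro: order_trans, metis order.refl zero_le_one weight_cases)

lemma mass_mass:
  assumes P: "partition_on A P" "finite P" and Q: "partition_on A Q" "finite Q"
    and ref: "\<And>X. X \<in> P \<Longrightarrow> \<exists>Y\<in>Q. X \<subseteq> Y" and R: "B = \<Union>R" "R \<subseteq> Q"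
    and h: "\<And>Y. Y \<in> Q \<Longrightarrow> weight (h Y) = mass P f Y"
  shows "mass Q h B = mass P f B"
proof -
  have eq: "S = T" if "S \<in> Q" "T \<in> Q" "z \<in> S" "z \<in> T" for S T z
    using partition_block_unique[OF Q(1)] that by metis
  have ne: "X \<noteq> {}" if "X \<in> P" for X using P that by (auto simp: partition_on_def)
  have "mass Q h B = (\<Sum>Y | Y \<in> Q \<and> Y \<subseteq> B. \<Sum>X | X \<in> P \<and> X \<subseteq> Y. weight (f X))"
    unfolding mass_def[of Q] by (rule sum.cong) (simp_all add: h[unfolded mass_def])
  also have "\<dots> = (\<Sum>X\<in>(\<Union>Y\<in>{Y. Y \<in> Q \<and> Y \<subseteq> B}. {X. X \<in> P \<and> X \<subseteq> Y}). weight (f X))"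
  proof (rule sum.UNION_disjoint[symmetric])
    show "\<forall>Y\<in>{Y \<in> Q. Y \<subseteq> B}. \<forall>Z\<in>{Y \<in> Q. Y \<subseteq> B}. Y \<noteq> Z \<longrightarrow>
      {X \<in> P. X \<subseteq> Y} \<inter> {X \<in> P. X \<subseteq> Z} = {}"
    proof (intro ballI impI, rule ccontr)
      fix Y Z
      assume YZ: "Y \<in> {Y \<in> Q. Y \<subseteq> B}" "Z \<in> {Y \<in> Q. Y \<subseteq> B}" "Y \<noteq> Z"
        and "{X \<in> P. X \<subseteq> Y} \<inter> {X \<in> P. X \<subseteq> Z} \<noteq> {}"
      then obtain X where X: "X \<in> P" "X \<subseteq> Y" "X \<subseteq> Z" by blast
      then obtain z where "z \<in> X" using ne by blast
      then show False using X YZ eq by blast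
    qed
  qed (use P Q in auto)
  also have "(\<Union>Y\<in>{Y. Y \<in> Q \<and> Y \<subseteq> B}. {X. X \<in> P \<and> X \<subseteq> Y}) = {X. X \<in> P \<and> X \<subseteq> B}"
  proof (intro subset_antisym subsetI)
    fix X assume X: "X \<in> {X. X \<in> P \<and> X \<subseteq> B}"
    then obtain Y where Y: "Y \<in> Q" "X \<subseteq> Y" using ref[of X] by blast
    obtain z where z: "z \<in> X" using ne X by blast
    then obtain Z where Z: "z \<in> Z" "Z \<in> R" using X R by auto
    then have "Y = Z" using eq Y z R by blast
    then show "X \<in> (\<Union>Y\<in>{Y. Y \<in> Q \<and> Y \<subseteq> B}. {X. X \<in> P \<and> X \<subseteq> Y})"
      using X Y Z R by auto
  qed auto
  finally show ?thesis by (simp add: mass_def)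
qed

lemma linked_fuse_iff_mass:
  assumes P: "partition_on A P" "finite P" and A: "u \<in> A" "v \<in> A" and nj: "\<not> joined P u v"
  shows "linked P f (fuse P u v) h \<longleftrightarrow> (\<forall>B\<in>fuse P u v. weight (h B) = mass P f B)"
proof -
  obtain X Y where XY: "X \<in> P" "Y \<in> P" "X \<noteq> Y" and Q: "fuse P u v = insert (X \<union> Y) (P - {X, Y})"
    using fuse_blocks[OF P(1) A nj] by metis
  have eq: "S = T" if "S \<in> P" "T \<in> P" "z \<in> S" "z \<in> T" for S T z
    using partition_block_unique[OF P(1)] that by metis
  have ne: "X \<noteq> {}" if "X \<in> P" for X using P that by (auto simp: partition_on_def)
  have "S = C" if "S \<in> P" "C \<in> P" "S \<subseteq> C" for S C
    using that eq ne by (metis ex_in_conv subsetD)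
  then have "{S. S \<in> P \<and> S \<subseteq> C} = {C}" if "C \<in> P" for C
    using that by blast
  moreover have "S = X \<or> S = Y" if "S \<in> P" "S \<subseteq> X \<union> Y" for S
    using that XY eq ne by (metis UnE ex_in_conv subsetD)
  then have "{S. S \<in> P \<and> S \<subseteq> X \<union> Y} = {X, Y}"
    using XY by blast
  ultimately have "\<And>C. C \<in> P \<Longrightarrow> mass P f C = weight (f C)"
    "mass P f (X \<union> Y) = weight (f X) + weight (f Y)"
    using XY by (auto simp: mass_def)
  note m = this
  have "(\<forall>B\<in>P - {X, Y}. weight (h B) = mass P f B) \<longleftrightarrow> (\<forall>C\<in>P - {X, Y}. f C = h C)"
    by (rule ball_cong) (auto simp: m(1))
  then show ?thesis
    using linked_fuse(1)[OF P(2) XY Un_notin_partition[OF P(1) XY] Q]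
    by (simp only: Q ball_simps m(2) conj_commute)
qed

text \<open>
  Each merge adds the values of blocks, so the signing in between is forced, and it exists exactly
  if the sums over the blocks of \<open>R\<close> are right: sums over smaller blocks are then at most 1
  by monotonicity. The criterion does not mention the partition in between.
\<close>

lemma routes_fuse_fuse:
  assumes P: "partition_on A P" "finite P" and A: "u \<in> A" "v \<in> A" "x \<in> A" "y \<in> A"
    and nj: "\<not> joined P u v" "\<not> joined (fuse P u v) x y"
    and Q: "Q = fuse P u v" and R: "R = fuse Q x y"
  shows "routes P Q R f g = (if \<forall>B\<in>R. weight (g B) = mass P f B then 1 else 0)"
  unfolding routes_def
proof (rule card_determined)
  have Q': "partition_on A Q" "finite Q" using partition_on_fuse[OF P(1) A(1,2)] P(2) Q
    by (auto simp: fuse_def)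
  have R': "partition_on A R" "finite R" using partition_on_fuse[OF Q'(1) A(3,4)] Q'(2) R
    by (auto simp: fuse_def)
  have tt: "mass Q h B = mass P f B" if "\<forall>B\<in>Q. weight (h B) = mass P f B" "B \<in> R" for h B
  proof (rule mass_mass[OF P Q'])
    show "B = \<Union>{X \<in> Q. X \<subseteq> B}"
      using that(2) unfolding R fuse_def by auto
  qed (use that Q fuse_coarser in auto)
  let ?h = "\<lambda>B\<in>Q. sign_of (mass P f B)"
  have l1: "linked P f Q h \<longleftrightarrow> (\<forall>B\<in>Q. weight (h B) = mass P f B)" for h
    using linked_fuse_iff_mass[OF P A(1,2) nj(1)] Q by auto
  have l2: "linked Q h R g \<longleftrightarrow> (\<forall>B\<in>R. weight (g B) = mass Q h B)" for h
    using linked_fuse_iff_mass[OF Q' A(3,4)] nj(2) Q R by auto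
  show "(\<forall>B\<in>R. weight (g B) = mass P f B) \<and> h = ?h"
    if "h \<in> {h \<in> Q \<rightarrow>\<^sub>E UNIV. linked P f Q h \<and> linked Q h R g}" for h
  proof -
    have h: "\<forall>B\<in>Q. weight (h B) = mass P f B" "\<forall>B\<in>R. weight (g B) = mass Q h B" 
      "h \<in> Q \<rightarrow>\<^sub>E UNIV"
      using that l1 l2 by auto
    have "h B = ?h B" for B
      using h(1,3) by (cases "B \<in> Q") (auto intro!: sign_eqI)
    then have "h = ?h" by (rule ext)
    moreover have "\<forall>B\<in>R. weight (g B) = mass P f B" using tt[OF h(1)] h(2) by simp
    ultimately show ?thesis by blast
  qed
  assume g: "\<forall>B\<in>R. weight (g B) = mass P f B"
  have "weight (sign_of (mass P f B)) = mass P f B" if B: "B \<in> Q" for B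
  proof -
    obtain B' where "B' \<in> R" "B \<subseteq> B'" using fuse_coarser B R by metis
    then have "mass P f B \<le> weight (g B')" using mass_mono[OF P(2)] g by metis
    then show ?thesis using mass_nonneg[of P f B] weight_cases[of "g B'"] by (intro weight_sign_of) linarith
  qed
  then have "\<forall>B\<in>Q. weight (?h B) = mass P f B" by auto
  then show "?h \<in> {h \<in> Q \<rightarrow>\<^sub>E UNIV. linked P f Q h \<and> linked Q h R g}"
    using l1 l2 tt g by auto
qed

text \<open>
  Splitting a block and merging the parts again is multiplication by \<open>2 x\<close>: the two parts have
  opposite signs, which can be assigned in two ways.
\<close>

lemma routes_split_fuse_same:
  assumes Q: "partition_on A Q" "finite Q" and A: "u \<in> A" "v \<in> A" and nj: "\<not> joined Q u v"
    and P: "P = fuse Q u v" and B: "B \<in> P" "u \<in> B"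
  shows "routes P Q P f g =
    (if (\<forall>C\<in>P - {B}. f C = g C) \<and> f B = Neg \<and> g B = Pos then 2 else 0)"
proof -
  obtain X Y where XY: "X \<in> Q" "Y \<in> Q" "X \<noteq> Y" "u \<in> X" and P': "P = insert (X \<union> Y) (Q - {X, Y})"
    using fuse_blocks[OF Q(1) A nj] P by metis
  have "B = X \<union> Y"
    using partition_block_unique[OF partition_on_fuse[OF Q(1) A]] B XY P P' by (metis UnI1 insertI1)
  note XYn = Un_notin_partition[OF Q(1) XY(1-3)]
  have PB: "P - {B} = Q - {X, Y}" using P' \<open>B = X \<union> Y\<close> XYn by auto
  let ?C = "(\<forall>C\<in>P - {B}. f C = g C) \<and> f B = Neg \<and> g B = Pos"
  let ?h = "\<lambda>s. \<lambda>V\<in>Q. if V = X then s else if V = Y then flip s else f V"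
  have l1: "linked P f Q h \<longleftrightarrow> (\<forall>C\<in>Q - {X, Y}. h C = f C) \<and> weight (h X) + weight (h Y) = 1 + weight (f B)" for h
    using linked_fuse(2)[OF Q(2) XY(1-3) XYn P'] \<open>B = X \<union> Y\<close> by auto
  have l2: "linked Q h P g \<longleftrightarrow> (\<forall>C\<in>Q - {X, Y}. h C = g C) \<and> weight (g B) = weight (h X) + weight (h Y)" for h
    using linked_fuse(1)[OF Q(2) XY(1-3) XYn P'] \<open>B = X \<union> Y\<close> by auto
  have "{h \<in> Q \<rightarrow>\<^sub>E UNIV. linked P f Q h \<and> linked Q h P g} = (if ?C then {?h Pos, ?h Neg} else {})"
  proof (intro subset_antisym subsetI)
    fix h assume "h \<in> {h \<in> Q \<rightarrow>\<^sub>E UNIV. linked P f Q h \<and> linked Q h P g}"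
    then have h: "h \<in> Q \<rightarrow>\<^sub>E UNIV" "\<forall>C\<in>Q - {X, Y}. h C = f C" "\<forall>C\<in>Q - {X, Y}. h C = g C"
      "weight (h X) + weight (h Y) = 1 + weight (f B)" "weight (g B) = weight (h X) + weight (h Y)"
      unfolding mem_Collect_eq l1 l2 by blast+
    have w: "f B = Neg" "g B = Pos" "h Y = flip (h X)"
      using h(4,5) by (cases "f B"; cases "g B"; cases "h X"; cases "h Y"; simp)+
    have eq: "h = ?h (h X)"
      using h(1,2) w(3) XY by (auto simp: fun_eq_iff PiE_def extensional_def)
    have "\<forall>C\<in>P - {B}. f C = g C" unfolding PB using h(2,3) by metis
    with w have C: ?C by blast
    have "h = ?h Pos \<or> h = ?h Neg"
      by (cases "h X") (use eq in metis)+
    then show "h \<in> (if ?C then {?h Pos, ?h Neg} else {})"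
      unfolding if_P[OF C] by blast
  next
    fix h assume "h \<in> (if ?C then {?h Pos, ?h Neg} else {})"
    then have C: ?C "h \<in> {?h Pos, ?h Neg}" by (meson empty_iff)+
    then have fg: "\<forall>C\<in>Q - {X, Y}. f C = g C" "f B = Neg" "g B = Pos" unfolding PB by blast+
    have "weight s + weight (flip s) = 1" for s by (cases s) auto
    then have "?h s \<in> {h \<in> Q \<rightarrow>\<^sub>E UNIV. linked P f Q h \<and> linked Q h P g}" for s
      unfolding mem_Collect_eq l1 l2 using fg XY(1-3) by simp
    then show "h \<in> {h \<in> Q \<rightarrow>\<^sub>E UNIV. linked P f Q h \<and> linked Q h P g}"
      using C(2) by blast
  qed
  moreover have "?h Pos \<noteq> ?h Neg"
  proof
    assume "?h Pos = ?h Neg"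
    then have "?h Pos X = ?h Neg X" by (rule fun_cong)
    then show False using XY by simp
  qed
  ultimately show ?thesis unfolding routes_def by simp
qed

text \<open>
  Here \<open>U\<close> and \<open>V\<close> are the blocks fused from \<open>X, Y\<close> and from \<open>Z, W\<close>. A merge and a split
  of unrelated blocks commute. Both sides count one if the same linear conditions hold
  and zero otherwise.
\<close>

lemma routes_disjoint_pairs:
  assumes fin: "finite Q" and mem: "X \<in> Q" "Y \<in> Q" "Z \<in> Q" "W \<in> Q" "distinct [X, Y, Z, W]"
    and U: "U \<notin> Q" "V \<notin> Q" "U \<noteq> V"
    and P: "P = insert U (Q - {X, Y})" and R: "R = insert V (Q - {Z, W})"
    and T: "T = insert V (insert U (Q - {X, Y}) - {Z, W})"
  shows "routes P T R f g = routes P Q R f g"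
proof -
  define S where "S = Q - {X, Y, Z, W}"
  have ne: "X \<noteq> Y" "X \<noteq> Z" "X \<noteq> W" "Y \<noteq> Z" "Y \<noteq> W" "Z \<noteq> W" using mem by auto
  have S: "X \<notin> S" "Y \<notin> S" "Z \<notin> S" "W \<notin> S" "U \<notin> S" "V \<notin> S"
    using U by (auto simp: S_def)
  have UV: "U \<notin> {X, Y, Z, W}" "V \<notin> {X, Y, Z, W}" using U mem by auto
  have Q': "Q = insert X (insert Y (insert Z (insert W S)))" using mem by (auto simp: S_def)
  have P': "P = insert U (insert Z (insert W S))" and R': "R = insert V (insert X (insert Y S))"
    and T': "T = insert U (insert V S)"
    using S ne UV U(3) unfolding P R T Q' by auto
  have "finite S" using fin by (simp add: S_def)
  note fins = fin \<open>finite S\<close>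
  have sets: "Q - {X, Y} = insert Z (insert W S)" "Q - {Z, W} = insert X (insert Y S)"
    "P - {Z, W} = insert U S" "R - {X, Y} = insert V S"
    using S ne UV unfolding Q' P' R' by auto
  have QP: "linked P f Q h \<longleftrightarrow> (\<forall>C\<in>Q - {X, Y}. h C = f C) \<and> weight (h X) + weight (h Y) = 1 + weight (f U)" for h
    by (rule linked_fuse) (use mem U P fins in auto)
  have QR: "linked Q h R g \<longleftrightarrow> (\<forall>C\<in>Q - {Z, W}. h C = g C) \<and> weight (g V) = weight (h Z) + weight (h W)" for h
    by (rule linked_fuse) (use mem U R fins in auto)
  have PT: "linked P f T h \<longleftrightarrow> (\<forall>C\<in>P - {Z, W}. f C = h C) \<and> weight (h V) = weight (f Z) + weight (f W)" for h
    by (rule linked_fuse) (use ne UV U S P' T' sets fins in auto)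
  have RT: "linked T h R g \<longleftrightarrow> (\<forall>C\<in>R - {X, Y}. g C = h C) \<and> weight (g X) + weight (g Y) = 1 + weight (h U)" for h
    by (rule linked_fuse) (use ne UV U S R' T' sets fins in auto)
  let ?C = "(\<forall>V\<in>S. f V = g V) \<and> weight (g X) + weight (g Y) = 1 + weight (f U) \<and>
    weight (g V) = weight (f Z) + weight (f W)"
  let ?h = "\<lambda>C\<in>Q. if C = X \<or> C = Y then g C else f C"
  let ?k = "\<lambda>C\<in>T. if C = V then g C else f C"
  have "routes P Q R f g = (if ?C then 1 else 0)"
    unfolding routes_def
  proof (rule card_determined)
    fix h assume "h \<in> {h \<in> Q \<rightarrow>\<^sub>E UNIV. linked P f Q h \<and> linked Q h R g}"
    then show "?C \<and> h = ?h" unfolding QP QR sets mem_Collect_eq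
      by (auto simp: fun_eq_iff PiE_def extensional_def Q' S)
  next
    assume ?C
    then show "?h \<in> {h \<in> Q \<rightarrow>\<^sub>E UNIV. linked P f Q h \<and> linked Q h R g}"
      unfolding QP QR sets mem_Collect_eq using ne S by (auto simp: Q')
  qed
  moreover have "routes P T R f g = (if ?C then 1 else 0)"
    unfolding routes_def
  proof (rule card_determined)
    fix h assume "h \<in> {h \<in> T \<rightarrow>\<^sub>E UNIV. linked P f T h \<and> linked T h R g}"
    then show "?C \<and> h = ?k" unfolding PT RT sets mem_Collect_eq
      by (auto simp: fun_eq_iff PiE_def extensional_def T' S)
  next
    assume ?C
    then show "?k \<in> {h \<in> T \<rightarrow>\<^sub>E UNIV. linked P f T h \<and> linked T h R g}"
      unfolding PT RT sets mem_Collect_eq using UV U S by (auto simp: T')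
  qed
  ultimately show ?thesis by simp
qed

text \<open>
  Here \<open>U\<close>, \<open>V\<close> and \<open>N\<close> are the blocks fused from \<open>X, Y\<close>, from \<open>Y, Z\<close> and from all
  three. This is the Frobenius relation: going from \<open>P\<close> to \<open>R\<close>, one may merge \<open>U\<close> with \<open>Z\<close> and split off
  \<open>X\<close>, or split \<open>U\<close> into \<open>X\<close> and \<open>Y\<close> and merge \<open>Y\<close> with \<open>Z\<close>. Either way the
  signing in between is determined by linear equations with the same solvability condition.
\<close>

lemma routes_overlapping_pairs:
  assumes fin: "finite Q" and mem: "X \<in> Q" "Y \<in> Q" "Z \<in> Q" "distinct [X, Y, Z]"
    and U: "U \<notin> Q" "V \<notin> Q" "N \<notin> P" "N \<notin> R"
    and P: "P = insert U (Q - {X, Y})" and R: "R = insert V (Q - {Y, Z})"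
    and T: "T = insert N (insert U (Q - {X, Y}) - {U, Z})"
  shows "routes P T R f g = routes P Q R f g"
proof -
  define S where "S = Q - {X, Y, Z}"
  have ne: "X \<noteq> Y" "X \<noteq> Z" "Y \<noteq> Z" using mem by auto
  have S: "X \<notin> S" "Y \<notin> S" "Z \<notin> S" "U \<notin> S" "V \<notin> S" "N \<notin> S"
    using U P by (auto simp: S_def)
  have UV: "U \<notin> {X, Y, Z}" "V \<notin> {X, Y, Z}" using U mem by auto
  have Q': "Q = insert X (insert Y (insert Z S))" using mem by (auto simp: S_def)
  have P': "P = insert U (insert Z S)" and R': "R = insert V (insert X S)"
    and T': "T = insert N S"
    using S ne UV unfolding P R T Q' by auto
  have "finite S" using fin by (simp add: S_def)
  note fins = fin \<open>finite S\<close>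
  have sets: "Q - {X, Y} = insert Z S" "Q - {Y, Z} = insert X S"
    "P - {U, Z} = S" "R - {X, V} = S"
    using S ne UV unfolding Q' P' R' by auto
  have QP: "linked P f Q h \<longleftrightarrow> (\<forall>C\<in>Q - {X, Y}. h C = f C) \<and> weight (h X) + weight (h Y) = 1 + weight (f U)" for h
    by (rule linked_fuse) (use mem U P fins in auto)
  have QR: "linked Q h R g \<longleftrightarrow> (\<forall>C\<in>Q - {Y, Z}. h C = g C) \<and> weight (g V) = weight (h Y) + weight (h Z)" for h
    by (rule linked_fuse) (use mem U R fins in auto)
  have PT: "linked P f T h \<longleftrightarrow> (\<forall>C\<in>P - {U, Z}. f C = h C) \<and> weight (h N) = weight (f U) + weight (f Z)" for h
    by (rule linked_fuse) (use ne UV U S P' T' sets fins in auto)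
  have RT: "linked T h R g \<longleftrightarrow> (\<forall>C\<in>R - {X, V}. g C = h C) \<and> weight (g X) + weight (g V) = 1 + weight (h N)" for h
    by (rule linked_fuse) (use ne UV U S R' T' sets fins in auto)
  let ?C = "(\<forall>C\<in>S. f C = g C) \<and> weight (f U) + weight (f Z) + 1 = weight (g X) + weight (g V)"
  let ?h = "\<lambda>C\<in>Q. if C = X then g X
     else if C = Y then sign_of (1 + weight (f U) - weight (g X)) else f C"
  let ?k = "\<lambda>C\<in>T. if C = N then sign_of (weight (f U) + weight (f Z)) else f C"
  \<comment> \<open>The condition forces the values of \<open>Y\<close> and \<open>N\<close> given in \<open>?h\<close> and \<open>?k\<close> to be 0 or 1.\<close>
  have w: "weight (sign_of (1 + weight (f U) - weight (g X))) = 1 + weight (f U) - weight (g X)"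
      "weight (sign_of (weight (f U) + weight (f Z))) = weight (f U) + weight (f Z)"
    if "weight (f U) + weight (f Z) + 1 = weight (g X) + weight (g V)"
    using that weight_cases[of "f U"] weight_cases[of "f Z"] weight_cases[of "g X"]
      weight_cases[of "g V"] by (auto intro!: weight_sign_of)
  have "routes P Q R f g = (if ?C then 1 else 0)"
    unfolding routes_def
  proof (rule card_determined)
    fix h assume "h \<in> {h \<in> Q \<rightarrow>\<^sub>E UNIV. linked P f Q h \<and> linked Q h R g}"
    then have h: "h \<in> Q \<rightarrow>\<^sub>E UNIV" "h Z = f Z" "h X = g X" "\<forall>C\<in>S. h C = f C" "\<forall>C\<in>S. h C = g C"
      "weight (h X) + weight (h Y) = 1 + weight (f U)"
      "weight (g V) = weight (h Y) + weight (h Z)"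
      unfolding QP QR sets by auto
    then have "h Y = sign_of (1 + weight (f U) - weight (g X))"
      by (intro sign_eqI) simp
    then have "h = ?h" using h(1-4)
      by (auto simp: fun_eq_iff PiE_def extensional_def Q' S)
    moreover have ?C using h by auto
    ultimately show "?C \<and> h = ?h" by blast
  next
    assume C: ?C
    then show "?h \<in> {h \<in> Q \<rightarrow>\<^sub>E UNIV. linked P f Q h \<and> linked Q h R g}"
      unfolding QP QR sets mem_Collect_eq using ne S w by (auto simp: Q')
  qed
  moreover have "routes P T R f g = (if ?C then 1 else 0)"
    unfolding routes_def
  proof (rule card_determined)
    fix h assume "h \<in> {h \<in> T \<rightarrow>\<^sub>E UNIV. linked P f T h \<and> linked T h R g}"
    then have h: "h \<in> T \<rightarrow>\<^sub>E UNIV" "\<forall>C\<in>S. h C = f C" "\<forall>C\<in>S. h C = g C"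
      "weight (h N) = weight (f U) + weight (f Z)"
      "weight (g X) + weight (g V) = 1 + weight (h N)"
      unfolding PT RT sets by auto
    then have "h N = sign_of (weight (f U) + weight (f Z))"
      by (intro sign_eqI)
    then have "h = ?k" using h(1,2)
      by (auto simp: fun_eq_iff PiE_def extensional_def T' S)
    moreover have ?C using h by auto
    ultimately show "?C \<and> h = ?k" by blast
  next
    assume C: ?C
    then show "?k \<in> {h \<in> T \<rightarrow>\<^sub>E UNIV. linked P f T h \<and> linked T h R g}"
      unfolding PT RT sets mem_Collect_eq using S w by (auto simp: T')
  qed
  ultimately show ?thesis by simp
qed

lemma routes_split_fuse_eq_fuse_split:
  assumes Q: "partition_on A Q" "finite Q" and A: "u \<in> A" "v \<in> A" "x \<in> A" "y \<in> A"
    and nj: "\<not> joined Q u v" "\<not> joined (fuse Q u v) x y"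
  shows "routes (fuse Q u v) (fuse (fuse Q u v) x y) (fuse Q x y) f g =
         routes (fuse Q u v) Q (fuse Q x y) f g"
proof -
  have P: "partition_on A (fuse Q u v)" and R: "partition_on A (fuse Q x y)"
    using partition_on_fuse[OF Q(1)] A by blast+
  show ?thesis
  proof (rule two_fusings[OF Q(1) A nj(1,2)])
    fix X Y Z W
    assume d: "X \<in> Q" "Y \<in> Q" "Z \<in> Q" "W \<in> Q" "distinct [X, Y, Z, W]"
      "fuse Q u v = insert (X \<union> Y) (Q - {X, Y})" "fuse Q x y = insert (Z \<union> W) (Q - {Z, W})"
      "fuse (fuse Q u v) x y = insert (Z \<union> W) (insert (X \<union> Y) (Q - {X, Y}) - {Z, W})"
    then have ne: "X \<noteq> Y" "Z \<noteq> W" and ZW: "Z \<in> fuse Q u v" "W \<in> fuse Q u v" by simp_all metis+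
    have "Z \<union> W \<notin> fuse Q u v" using Un_notin_partition[OF P ZW ne(2)] .
    then have "X \<union> Y \<noteq> Z \<union> W" using d(6) by (metis insertI1)
    with Un_notin_partition[OF Q(1)] d ne show ?thesis
      by (intro routes_disjoint_pairs[OF Q(2) d(1-5) _ _ _ d(6-8)]) metis+
  next
    fix X Y Z
    assume c: "X \<in> Q" "Y \<in> Q" "Z \<in> Q" "distinct [X, Y, Z]"
      "fuse Q u v = insert (X \<union> Y) (Q - {X, Y})" "fuse Q x y = insert (Y \<union> Z) (Q - {Y, Z})"
      "fuse (fuse Q u v) x y = insert (X \<union> Y \<union> Z) (insert (X \<union> Y) (Q - {X, Y}) - {X \<union> Y, Z})"
    then have ne: "X \<noteq> Y" "Y \<noteq> Z" "X \<noteq> Z" by simp_all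
    have n: "X \<union> Y \<notin> Q" "Y \<union> Z \<notin> Q" 
      using Un_notin_partition[OF Q(1) c(1,2) ne(1)] Un_notin_partition[OF Q(1) c(2,3) ne(2)] .
    have "X \<union> Y \<in> fuse Q u v" "Z \<in> fuse Q u v" "X \<union> Y \<noteq> Z"
      "X \<in> fuse Q x y" "Y \<union> Z \<in> fuse Q x y" "X \<noteq> Y \<union> Z"
      using c n ne by (simp_all, metis+)
    then have "X \<union> Y \<union> Z \<notin> fuse Q u v" "X \<union> Y \<union> Z \<notin> fuse Q x y"
      using Un_notin_partition[OF P, of "X \<union> Y" Z] Un_notin_partition[OF R, of X "Y \<union> Z"]
      by (metis Un_assoc)+
    then show ?thesis
      by (rule routes_overlapping_pairs[OF Q(2) c(1-4) n _ _ c(5-7)])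
  qed
qed

text \<open>
  Merging lowers the number of blocks by one and splitting raises it by one (\<open>F\<close> and \<open>S\<close> mark these
  alternatives). Both ways around the square have the same total change, which leaves six of the
  sixteen combinations.
\<close>

lemma opposite_sides:
  fixes p q q' r :: nat
  assumes "F1 \<or> S1" "F2 \<or> S2" "F3 \<or> S3" "F4 \<or> S4"
    and "F1 \<Longrightarrow> Suc q = p" "S1 \<Longrightarrow> Suc p = q" "F2 \<Longrightarrow> Suc r = q" "S2 \<Longrightarrow> Suc q = r"
      "F3 \<Longrightarrow> Suc q' = p" "S3 \<Longrightarrow> Suc p = q'" "F4 \<Longrightarrow> Suc r = q'" "S4 \<Longrightarrow> Suc q' = r"
  shows "F1 \<and> F2 \<and> F3 \<and> F4 \<or> S1 \<and> S2 \<and> S3 \<and> S4 \<or> F1 \<and> S2 \<and> S3 \<and> F4 \<or>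
      S1 \<and> F2 \<and> F3 \<and> S4 \<or> F1 \<and> S2 \<and> F3 \<and> S4 \<or> S1 \<and> F2 \<and> S3 \<and> F4"
proof -
  have "F1 \<and> p = Suc q \<or> S1 \<and> q = Suc p" "F2 \<and> q = Suc r \<or> S2 \<and> r = Suc q"
    "F3 \<and> p = Suc q' \<or> S3 \<and> q' = Suc p" "F4 \<and> q' = Suc r \<or> S4 \<and> r = Suc q'"
    using assms by metis+
  then show ?thesis by (elim disjE conjE) auto
qed

text \<open>
  Two merges commute by associativity, and two splits likewise after exchanging signs. A merge on one way
  around and a split followed by a merge on the other is the Frobenius relation. In the
  two remaining cases both ways merge and then split, or both split and then merge. Then
  the saddles concern the same blocks: the partitions in between agree, or the two ends of the square
  agree and both counts are given by \<open>routes_split_fuse_same\<close>.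
\<close>

lemma saddle_square:
  assumes part: "partition_on A P" "partition_on A Q" "partition_on A Q'" "partition_on A R"
    and fin: "finite P" "finite Q" "finite Q'" "finite R"
    and A: "u \<in> A" "v \<in> A" "x \<in> A" "y \<in> A"
    and s: "saddle u v P Q" "saddle x y Q R" "saddle x y P Q'" "saddle u v Q' R"
  shows "routes P Q R f g = routes P Q' R f g"
proof -
  note cf = card_fuse[OF part(1) fin(1)] card_fuse[OF part(2) fin(2)]
    card_fuse[OF part(3) fin(3)] card_fuse[OF part(4) fin(4)]
  \<comment> \<open>The alternatives on the four sides, fusing or splitting: first \<open>P\<close> to \<open>Q\<close> to \<open>R\<close>, then
    \<open>P\<close> to \<open>Q'\<close> to \<open>R\<close>.\<close>
  define F1 S1 F2 S2 F3 S3 F4 S4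
    where F1: "F1 \<longleftrightarrow> \<not> joined P u v \<and> Q = fuse P u v"
      and S1: "S1 \<longleftrightarrow> \<not> joined Q u v \<and> P = fuse Q u v"
      and F2: "F2 \<longleftrightarrow> \<not> joined Q x y \<and> R = fuse Q x y"
      and S2: "S2 \<longleftrightarrow> \<not> joined R x y \<and> Q = fuse R x y"
      and F3: "F3 \<longleftrightarrow> \<not> joined P x y \<and> Q' = fuse P x y"
      and S3: "S3 \<longleftrightarrow> \<not> joined Q' x y \<and> P = fuse Q' x y"
      and F4: "F4 \<longleftrightarrow> \<not> joined Q' u v \<and> R = fuse Q' u v"
      and S4: "S4 \<longleftrightarrow> \<not> joined R u v \<and> Q' = fuse R u v"
  have alternatives: "F1 \<or> S1" "F2 \<or> S2" "F3 \<or> S3" "F4 \<or> S4"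
    using s unfolding saddle_def F1 S1 F2 S2 F3 S3 F4 S4 by blast+
  have cards: "F1 \<Longrightarrow> Suc (card Q) = card P" "S1 \<Longrightarrow> Suc (card P) = card Q"
    "F2 \<Longrightarrow> Suc (card R) = card Q" "S2 \<Longrightarrow> Suc (card Q) = card R"
    "F3 \<Longrightarrow> Suc (card Q') = card P" "S3 \<Longrightarrow> Suc (card P) = card Q'"
    "F4 \<Longrightarrow> Suc (card R) = card Q'" "S4 \<Longrightarrow> Suc (card Q') = card R"
    unfolding F1 S1 F2 S2 F3 S3 F4 S4 using A cf by blast+
  have "F1 \<and> F2 \<and> F3 \<and> F4 \<or> S1 \<and> S2 \<and> S3 \<and> S4 \<or> F1 \<and> S2 \<and> S3 \<and> F4 \<or>
      S1 \<and> F2 \<and> F3 \<and> S4 \<or> F1 \<and> S2 \<and> F3 \<and> S4 \<or> S1 \<and> F2 \<and> S3 \<and> F4"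
    by (rule opposite_sides[OF alternatives cards])
  then consider (ff_ff) F1 F2 F3 F4 | (ss_ss) S1 S2 S3 S4 | (fs_sf) F1 S2 S3 F4
    | (sf_fs) S1 F2 F3 S4 | (fs_fs) F1 S2 F3 S4 | (sf_sf) S1 F2 S3 F4
    by blast
  then show ?thesis
  proof cases
    case ff_ff
    note ff_ff = ff_ff[unfolded F1 F2 F3 F4]
    then show ?thesis
      using routes_fuse_fuse[OF part(1) fin(1), of u v x y Q R]
        routes_fuse_fuse[OF part(1) fin(1), of x y u v Q' R] A by simp
  next
    case ss_ss
    note ss_ss = ss_ss[unfolded S1 S2 S3 S4]
    have "routes R Q P (flip \<circ> g) (flip \<circ> f) = routes R Q' P (flip \<circ> g) (flip \<circ> f)"
      using ss_ss routes_fuse_fuse[OF part(4) fin(4), of x y u v Q P]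
        routes_fuse_fuse[OF part(4) fin(4), of u v x y Q' P] A by simp
    then show ?thesis by (simp only: routes_flip)
  next
    case fs_sf
    note fs_sf = fs_sf[unfolded F1 S2 S3 F4]
    then show ?thesis
      using routes_split_fuse_eq_fuse_split[OF part(3) fin(3), of x y u v f g] A by simp
  next
    case sf_fs
    note sf_fs = sf_fs[unfolded S1 F2 F3 S4]
    then show ?thesis
      using routes_split_fuse_eq_fuse_split[OF part(2) fin(2), of u v x y f g] A by simp
  next
    case fs_fs
    note fs_fs = fs_fs[unfolded F1 S2 F3 S4]
    have "joined Q x y" using joined_fuse[OF part(4)] fs_fs A part(4)
      by (metis joined_def UnionE partition_onD1)
    then have "Q = Q'"
      using fuse_eq_fuse[OF part(1), of u v x y] fs_fs A by simp
    then show ?thesis by simp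
  next
    case sf_sf
    note sf_sf = sf_sf[unfolded S1 F2 S3 F4]
    have "joined P x y" using joined_fuse[OF part(3)] sf_sf A part(3)
      by (metis joined_def UnionE partition_onD1)
    then have "P = R"
      using fuse_eq_fuse[OF part(2), of u v x y] sf_sf A by simp
    obtain B where B: "B \<in> P" "u \<in> B" using A(1) part(1) by (metis UnionE partition_onD1)
    have "joined Q u u" using A(1) part(2) by (metis joined_def UnionE partition_onD1)
    have "joined Q x u \<or> joined Q x v"
      using \<open>joined P x y\<close> sf_sf(2) unfolding sf_sf(1)[THEN conjunct2] joined_fuse[OF part(2) A(1,2)] by blast
    then have "joined P x u"
      using \<open>joined Q u u\<close> unfolding sf_sf(1)[THEN conjunct2] joined_fuse[OF part(2) A(1,2)] by blast
    then have "x \<in> B"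
      using B partition_block_unique[OF part(1)] unfolding joined_def by metis
    have "routes P Q P f g = (if (\<forall>C\<in>P - {B}. f C = g C) \<and> f B = Neg \<and> g B = Pos then 2 else 0)"
      using routes_split_fuse_same[OF part(2) fin(2) A(1,2)] sf_sf B by blast
    moreover have "routes P Q' P f g = (if (\<forall>C\<in>P - {B}. f C = g C) \<and> f B = Neg \<and> g B = Pos then 2 else 0)"
      using routes_split_fuse_same[OF part(3) fin(3) A(3,4)] sf_sf B \<open>x \<in> B\<close> by blast
    ultimately show ?thesis using \<open>P = R\<close> by simp
  qed
qed

section \<open>Classes of a generated equivalence relation\<close>

abbreviation conn :: "('a \<times> 'a) set \<Rightarrow> ('a \<times> 'a) set" where
  "conn r \<equiv> (r \<union> r\<inverse>)\<^sup>*"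

lemma conn_sym: "(x, y) \<in> conn r \<Longrightarrow> (y, x) \<in> conn r"
  by (metis symE sym_Un_converse sym_rtrancl)

lemma conn_trans: "(x, y) \<in> conn r \<Longrightarrow> (y, z) \<in> conn r \<Longrightarrow> (x, z) \<in> conn r"
  by (rule rtrancl_trans)

lemma conn_closed:
  assumes "(x, y) \<in> conn r" and "\<And>a b. (a, b) \<in> r \<Longrightarrow> a \<in> K \<longleftrightarrow> b \<in> K"
  shows "x \<in> K \<longleftrightarrow> y \<in> K"
  using assms(1) by (induction rule: rtrancl_induct) (use assms(2) in blast)+

lemma conn_within: "(x, y) \<in> conn r \<Longrightarrow> r \<subseteq> A \<times> A \<Longrightarrow> x \<in> A \<longleftrightarrow> y \<in> A"
  by (rule conn_closed) auto

lemma partition_on_eqv_classes: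
  assumes "r \<subseteq> A \<times> A"
  shows "partition_on A (eqv_classes A r)"
proof -
  have "A // conn r = A // (conn r \<inter> A \<times> A)"
    unfolding quotient_def using conn_within[OF _ assms] by (fastforce simp: Image_def)
  moreover have "equiv A (conn r \<inter> A \<times> A)"
    by (rule equivI) (auto simp: refl_on_def intro!: symI transI intro: conn_sym conn_trans)
  ultimately show ?thesis
    unfolding eqv_classes_def using partition_on_quotient by metis
qed

lemma joined_eqv_classes:
  assumes "x \<in> A"
  shows "joined (eqv_classes A r) x y \<longleftrightarrow> (x, y) \<in> conn r"
  using assms unfolding joined_def eqv_classes_def quotient_def
  by (auto intro: conn_sym conn_trans)

lemma conn_insert:
  "(x, y) \<in> conn (insert (u, v) r) \<longleftrightarrow> (x, y) \<in> conn r \<or>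
    (x, u) \<in> conn r \<and> (v, y) \<in> conn r \<or> (x, v) \<in> conn r \<and> (u, y) \<in> conn r" (is "?L \<longleftrightarrow> ?R")
proof
  assume ?L
  then show ?R
  proof (induction rule: rtrancl_induct)
    case (step y z)
    then consider "(y, z) \<in> conn r" | "y = u" "z = v" | "y = v" "z = u" by auto
    then show ?case
      using step.IH by cases (blast intro: conn_sym conn_trans)+
  qed blast
next
  have sub: "conn r \<subseteq> conn (insert (u, v) r)" by (rule rtrancl_mono) auto
  have "(u, v) \<in> conn (insert (u, v) r)" "(v, u) \<in> conn (insert (u, v) r)" by auto
  moreover assume ?R
  ultimately show ?L using sub by (blast intro: conn_trans)
qed

lemma eqv_classes_insert:
  assumes r: "r \<subseteq> A \<times> A" and "u \<in> A" "v \<in> A"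
  shows "eqv_classes A (insert (u, v) r) = fuse (eqv_classes A r) u v"
proof (rule partition_eqI)
  show "partition_on A (eqv_classes A (insert (u, v) r))"
    by (rule partition_on_eqv_classes) (use assms in auto)
  show "partition_on A (fuse (eqv_classes A r) u v)"
    by (rule partition_on_fuse[OF partition_on_eqv_classes]) (use assms in auto)
  fix x y assume "x \<in> A" "y \<in> A"
  then show "joined (eqv_classes A (insert (u, v) r)) x y = joined (fuse (eqv_classes A r) u v) x y"
    using assms by (simp only: joined_eqv_classes joined_fuse[OF partition_on_eqv_classes[OF r]] conn_insert)
qed

lemma eqv_classes_together_insert:
  assumes F: "\<Union>F \<subseteq> A" and "u \<in> A" "v \<in> A"
  shows "eqv_classes A (together (insert {u, v} F)) = fuse (eqv_classes A (together F)) u v"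
proof -
  have 1: "together F \<subseteq> A \<times> A" using F by (auto simp: together_def)
  have "conn (together (insert {u, v} F)) = conn (insert (u, v) (together F))"
  proof (rule rtrancl_subset)
    show "insert (u, v) (together F) \<union> (insert (u, v) (together F))\<inverse>
      \<subseteq> together (insert {u, v} F) \<union> (together (insert {u, v} F))\<inverse>"
      by (auto simp: together_def)
    show "together (insert {u, v} F) \<union> (together (insert {u, v} F))\<inverse>
      \<subseteq> conn (insert (u, v) (together F))"
    proof -
      have "together (insert {u, v} F) \<subseteq> {(u, v), (v, u), (u, u), (v, v)} \<union> together F"
        by (auto simp: together_def)
      also have "\<dots> \<subseteq> conn (insert (u, v) (together F))" by auto
      finally have "together (insert {u, v} F) \<subseteq> conn (insert (u, v) (together F))" .
      moreover have "(together (insert {u, v} F))\<inverse> = together (insert {u, v} F)"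
        by (auto simp: together_def)
      ultimately show ?thesis by simp
    qed
  qed
  then have "eqv_classes A (together (insert {u, v} F)) = eqv_classes A (insert (u, v) (together F))"
    by (simp add: eqv_classes_def)
  then show ?thesis using eqv_classes_insert[OF 1] assms by simp
qed

text \<open>
  An edge reduces the number of components of a graph by at most one.
\<close>

lemma card_le_classes_plus_edges:
  assumes "finite G" "finite K" "\<And>g. g \<in> G \<Longrightarrow> g \<subseteq> K \<and> card g = 2"
  shows "card K \<le> card (eqv_classes K (together G)) + card G"
  using assms(1,3)
proof (induction G rule: finite_induct)
  case empty
  have "eqv_classes K (together {}) = (\<lambda>x. {x}) ` K"
    by (auto simp: eqv_classes_def together_def quotient_def)
  then show ?case by (simp add: card_image)
next
  case (insert g G)
  then obtain u v where g: "g = {u, v}" "u \<in> K" "v \<in> K" by (metis card_2_iff insert_iff insert_subset)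
  let ?P = "eqv_classes K (together G)"
  have G: "\<Union>G \<subseteq> K" using insert by blast
  have P: "partition_on K ?P"
    by (rule partition_on_eqv_classes) (use G in \<open>auto simp: together_def\<close>)
  then have fin: "finite ?P" using assms(2) by (metis finite_UnionD partition_onD1)
  have "card ?P \<le> Suc (card (fuse ?P u v))"
  proof (cases "joined ?P u v")
    case True
    have "fuse ?P u v = ?P"
    proof (rule partition_eqI[OF partition_on_fuse[OF P g(2,3)] P])
      have "(u, v) \<in> conn (together G)" using True g(2) by (simp only: joined_eqv_classes)
      then show "joined (fuse ?P u v) x y \<longleftrightarrow> joined ?P x y" if "x \<in> K" "y \<in> K" for x y
        using that g(2,3) unfolding joined_fuse[OF P g(2,3)]
        by (simp only: joined_eqv_classes) (metis conn_sym conn_trans)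
    qed
    then show ?thesis by simp
  next
    case False
    then show ?thesis using card_fuse[OF P fin g(2,3)] by simp
  qed
  moreover have "eqv_classes K (together (insert g G)) = fuse ?P u v"
    unfolding g(1) using eqv_classes_together_insert[OF G g(2,3)] .
  moreover have "card K \<le> card ?P + card G" using insert by blast
  ultimately show ?case using insert by simp
qed

section \<open>Two-colouring the half-edges of a planar diagram\<close>

text \<open>
  Sets with symmetric difference form a vector space over the field with two elements; counting
  elements replaces the dimension formula.
\<close>

lemma card_eq_card_kernel_times_card_image:
  fixes h :: "'a set \<Rightarrow> 'b set"
  assumes fin: "finite \<A>" and closed: "\<And>X Y. X \<in> \<A> \<Longrightarrow> Y \<in> \<A> \<Longrightarrow> sym_diff X Y \<in> \<A>"
    and add: "\<And>X Y. X \<in> \<A> \<Longrightarrow> Y \<in> \<A> \<Longrightarrow> h (sym_diff X Y) = sym_diff (h X) (h Y)"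
  shows "card \<A> = card {X\<in>\<A>. h X = {}} * card (h ` \<A>)"
proof -
  have "card {X\<in>\<A>. h X = B} = card {X\<in>\<A>. h X = {}}" if B: "B \<in> h ` \<A>" for B
  proof -
    obtain Y where Y: "Y \<in> \<A>" "h Y = B" using B by auto
    have inv: "sym_diff (sym_diff X Y) Y = X" for X :: "'a set" by auto
    have h: "h (sym_diff X Y) = sym_diff (h X) B" if "X \<in> \<A>" for X
      using add[OF that Y(1)] Y(2) by simp
    have e: "sym_diff S B = {} \<longleftrightarrow> S = B" "sym_diff S B = B \<longleftrightarrow> S = {}" for S by auto
    have "bij_betw (\<lambda>X. sym_diff X Y) {X\<in>\<A>. h X = B} {X\<in>\<A>. h X = {}}"
      by (rule bij_betw_byWitness[where f' = "\<lambda>X. sym_diff X Y"])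
        (use closed Y(1) inv in \<open>simp_all add: image_subset_iff h e\<close>)
    then show ?thesis by (rule bij_betw_same_card)
  qed
  then have "(\<Sum>B\<in>h ` \<A>. card {X\<in>\<A>. h X = B}) = card {X\<in>\<A>. h X = {}} * card (h ` \<A>)"
    by simp
  then show ?thesis using sum.image_gen[OF fin, of "\<lambda>_. 1::nat" h] by simp
qed

lemma odd_card_sym_diff:
  assumes "finite X" "finite Y"
  shows "odd (card (sym_diff X Y)) \<longleftrightarrow> odd (card X) \<noteq> odd (card Y)"
proof -
  have "card (sym_diff X Y) = card (X - Y) + card (Y - X)"
    using assms by (intro card_Un_disjoint) auto
  moreover have "card X = card (X - Y) + card (X \<inter> Y)" "card Y = card (Y - X) + card (X \<inter> Y)"
    using assms by (metis Int_Diff_Un Int_Diff_disjoint add.commute card_Un_disjoint finite_Diff finite_Int inf_commute)+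
  ultimately show ?thesis by presburger
qed

lemma odd_card_Int_sym_diff:
  assumes "finite v"
  shows "odd (card (v \<inter> sym_diff X Y)) \<longleftrightarrow> odd (card (v \<inter> X)) \<noteq> odd (card (v \<inter> Y))"
proof -
  have "v \<inter> sym_diff X Y = sym_diff (v \<inter> X) (v \<inter> Y)" by auto
  then show ?thesis using odd_card_sym_diff[of "v \<inter> X" "v \<inter> Y"] assms by simp
qed

lemma Union_sym_diff:
  assumes "partition_on A P" "X \<subseteq> P" "Y \<subseteq> P"
  shows "\<Union>(sym_diff X Y) = sym_diff (\<Union>X) (\<Union>Y)"
proof -
  have eq: "S = T" if "S \<in> X" "T \<in> Y" "z \<in> S" "z \<in> T" for S T z
    using partition_block_unique[OF assms(1)] that assms(2,3) by blast
  show ?thesis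
  proof (intro subset_antisym subsetI)
    fix z assume "z \<in> \<Union>(sym_diff X Y)"
    then obtain S where S: "z \<in> S" "S \<in> X \<and> S \<notin> Y \<or> S \<in> Y \<and> S \<notin> X" by auto
    from S(2) show "z \<in> sym_diff (\<Union>X) (\<Union>Y)"
    proof
      assume "S \<in> X \<and> S \<notin> Y"
      then have "z \<in> \<Union>X" "z \<notin> \<Union>Y" using S(1) eq[of S _ z] by blast+
      then show ?thesis by blast
    next
      assume "S \<in> Y \<and> S \<notin> X"
      then have "z \<in> \<Union>Y" "z \<notin> \<Union>X" using S(1) eq[of _ S z] by blast+
      then show ?thesis by blast
    qed
  qed auto
qed

lemma odd_card_two:
  assumes "a = {x, y}" "x \<noteq> y"
  shows "odd (card (w \<inter> a)) \<longleftrightarrow> (x \<in> w) \<noteq> (y \<in> w)"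
proof -
  have "w \<inter> a = (if x \<in> w then {x} else {}) \<union> (if y \<in> w then {y} else {})"
    using assms by auto
  then show ?thesis using assms by auto
qed

locale linkgraph =
  fixes D :: "('c, 'd) diagram"
  assumes lg: "link_graph D"
begin

abbreviation "vertices \<equiv> points D \<union> ends_at D ` crossings D"

lemma fin: "finite (darts D)" "finite (crossings D)"
  and arcs: "partition_on (darts D) (arcs D)"
  and arc2: "a \<in> arcs D \<Longrightarrow> card a = 2"
  and vert: "partition_on (darts D) vertices"
  and point2: "p \<in> points D \<Longrightarrow> card p = 2"
  and ends_inj: "c \<in> crossings D \<Longrightarrow> inj_on (ends D c) {..<4}"
  and ends_at_inj: "inj_on (ends_at D) (crossings D)"
  using lg by (auto simp: link_graph_def)

lemma fin_arcs: "finite (arcs D)"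
  using arcs fin by (metis finite_UnionD partition_onD1)

lemma fin_vert: "finite vertices"
  using vert fin by (metis finite_UnionD partition_onD1)

lemma four: "{..<4::nat} = {0, 1, 2, 3}" by auto

lemma ends_at_eq: "ends_at D c = {ends D c 0, ends D c 1, ends D c 2, ends D c 3}"
  by (simp add: ends_at_def four)

lemma ends_distinct:
  assumes "c \<in> crossings D"
  shows "distinct [ends D c 0, ends D c 1, ends D c 2, ends D c 3]"
  using ends_inj[OF assms] by (auto simp: inj_on_def four)

lemma card_ends_at: "c \<in> crossings D \<Longrightarrow> card (ends_at D c) = 4"
  using ends_inj by (simp add: ends_at_def card_image)

lemma card_vertices: "card vertices = card (crossings D) + card (points D)"
proof -
  have "points D \<inter> ends_at D ` crossings D = {}"
    using point2 card_ends_at by fastforce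
  then show ?thesis
    using fin_vert by (subst card_Un_disjoint) (auto simp: card_image[OF ends_at_inj])
qed

lemma ends_in_darts: "c \<in> crossings D \<Longrightarrow> k < 4 \<Longrightarrow> ends D c k \<in> darts D"
  using partition_onD1[OF vert] by (auto simp: ends_at_def)

lemma vertex_in_darts: "v \<in> vertices \<Longrightarrow> v \<subseteq> darts D"
  using partition_onD1[OF vert] by auto

lemma arc_in_darts: "a \<in> arcs D \<Longrightarrow> a \<subseteq> darts D"
  using partition_onD1[OF arcs] by auto

lemma fin_vertex: "v \<in> vertices \<Longrightarrow> finite v"
  by (rule finite_subset[OF vertex_in_darts fin(1)])

lemma components_partition: "partition_on (darts D) (components D)"
  unfolding components_def
  by (rule partition_on_eqv_classes)
    (use vertex_in_darts arc_in_darts in \<open>auto simp: together_def\<close>)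

lemma rotation_in_darts: "rotation D \<subseteq> darts D \<times> darts D"
  using ends_in_darts vertex_in_darts by (fastforce simp: rotation_def)

lemma faces_partition: "partition_on (darts D) (faces D)"
  unfolding faces_def
  by (rule partition_on_eqv_classes)
    (use rotation_in_darts arc_in_darts in \<open>auto simp: relcomp_unfold\<close>)

text \<open>
  Mod 2, the boundary of a path consists of its two end vertices.
\<close>

lemma path_boundary:
  assumes "(x, y) \<in> conn (together (arcs D \<union> points D \<union> ends_at D ` crossings D))" and "x \<in> darts D"
  shows "\<exists>X\<subseteq>arcs D. \<forall>w\<in>vertices. odd (card (w \<inter> \<Union>X)) \<longleftrightarrow> (x \<in> w) \<noteq> (y \<in> w)"
  using assms(1)
proof (induction rule: rtrancl_induct)
  case base
  show ?case by (rule exI[of _ "{}"]) simp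
next
  case (step y z)
  obtain X where X: "X \<subseteq> arcs D" "\<And>w. w \<in> vertices \<Longrightarrow> odd (card (w \<inter> \<Union>X)) \<longleftrightarrow> (x \<in> w) \<noteq> (y \<in> w)"
    using step.IH by metis
  obtain a where a: "a \<in> arcs D \<union> vertices" "y \<in> a" "z \<in> a"
    using step(2) unfolding together_def by blast
  show ?case
  proof (cases "a \<in> vertices \<or> y = z")
    case True
    have "y \<in> w \<longleftrightarrow> z \<in> w" if "w \<in> vertices" for w
      using True a that partition_block_unique[OF vert] by metis
    then show ?thesis using X by blast
  next
    case False
    then have a': "a \<in> arcs D" "y \<noteq> z" using a by auto
    then have ayz: "a = {y, z}" using arc2[OF a'(1)] a by (auto simp: card_2_iff)
    let ?X = "sym_diff X {a}"
    have U: "\<Union>?X = sym_diff (\<Union>X) a"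
      using Union_sym_diff[OF arcs X(1), of "{a}"] a' by simp
    have "odd (card (w \<inter> \<Union>?X)) \<longleftrightarrow> (x \<in> w) \<noteq> (z \<in> w)" if w: "w \<in> vertices" for w
      unfolding U odd_card_Int_sym_diff[OF fin_vertex[OF w]] X(2)[OF w] odd_card_two[OF ayz a'(2)]
      by blast
    moreover have "?X \<subseteq> arcs D" using X a' by auto
    ultimately show ?thesis by blast
  qed
qed

text \<open>
  The sets of arcs that meet every vertex in an even number of half-edges.
\<close>

definition cycles_mod2 :: "'d set set set" where
  "cycles_mod2 = {X. X \<subseteq> arcs D \<and> (\<forall>v\<in>vertices. even (card (v \<inter> \<Union>X)))}"

text \<open>
  Choose a root vertex in each component. Modulo the roots, every set of vertices is a boundary, since a
  vertex can be joined to its root by a path. So the boundary map has rank at least the number of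
  vertices minus the number of components, which bounds its kernel.
\<close>

lemma card_cycles_mod2:
  "card cycles_mod2 * 2 ^ card vertices \<le> 2 ^ (card (arcs D) + card (components D))"
proof -
  have "\<exists>v\<in>vertices. v \<subseteq> K" if K: "K \<in> components D" for K
  proof -
    obtain x where x: "x \<in> K" using K partition_onD3[OF components_partition] by (metis ex_in_conv)
    then have xD: "x \<in> darts D" using K partition_onD1[OF components_partition] by blast
    then obtain v where v: "v \<in> vertices" "x \<in> v" using partition_onD1[OF vert] by blast
    have "y \<in> K" if "y \<in> v" for y
    proof -
      have "(x, y) \<in> conn (together (arcs D \<union> points D \<union> ends_at D ` crossings D))"
        using v that by (intro r_into_rtrancl) (auto simp: together_def)
      then have "joined (components D) x y" unfolding components_def using joined_eqv_classes[OF xD] by blast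
      then show ?thesis using x K partition_block_unique[OF components_partition] unfolding joined_def by metis
    qed
    then show ?thesis using v by blast
  qed
  then obtain root where root: "\<And>K. K \<in> components D \<Longrightarrow> root K \<in> vertices \<and> root K \<subseteq> K" by metis
  have root_inj: "inj_on root (components D)"
  proof (rule inj_onI)
    fix K L assume KL: "K \<in> components D" "L \<in> components D" "root K = root L"
    obtain x where "x \<in> root K" using root[OF KL(1)] partition_onD3[OF vert] by (metis ex_in_conv)
    then show "K = L" using KL root partition_block_unique[OF components_partition] by (metis subsetD)
  qed
  \<comment> \<open>Parities of the degrees at the vertices which are not roots.\<close>
  let ?V = "vertices - root ` components D"
  let ?h = "\<lambda>X. {v\<in>?V. odd (card (v \<inter> \<Union>X))}"
  have h_add: "?h (sym_diff X Y) = sym_diff (?h X) (?h Y)" if XY: "X \<subseteq> arcs D" "Y \<subseteq> arcs D" for X Y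
    unfolding Union_sym_diff[OF arcs XY]
    using odd_card_Int_sym_diff[OF fin_vertex, of _ "\<Union>X" "\<Union>Y"] by blast
  have single: "\<exists>X\<subseteq>arcs D. ?h X = {v}" if v: "v \<in> ?V" for v
  proof -
    obtain x where x: "x \<in> v" using v partition_onD3[OF vert] by (metis DiffD1 ex_in_conv)
    then have xD: "x \<in> darts D" using v vertex_in_darts by blast
    then obtain K where K: "K \<in> components D" "x \<in> K" using partition_onD1[OF components_partition] by blast
    obtain y where y: "y \<in> root K" using root[OF K(1)] partition_onD3[OF vert] by (metis ex_in_conv)
    have "joined (components D) x y" using K y root[OF K(1)] by (auto simp: joined_def)
    then have "(x, y) \<in> conn (together (arcs D \<union> points D \<union> ends_at D ` crossings D))"
      unfolding components_def using joined_eqv_classes[OF xD] by blast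
    from path_boundary[OF this xD] obtain X where X: "X \<subseteq> arcs D"
      "\<And>w. w \<in> vertices \<Longrightarrow> odd (card (w \<inter> \<Union>X)) \<longleftrightarrow> (x \<in> w) \<noteq> (y \<in> w)" by metis
    have "x \<in> w \<longleftrightarrow> w = v" "y \<in> w \<longleftrightarrow> w = root K" if "w \<in> vertices" for w
      using that v x y root[OF K(1)] partition_block_unique[OF vert] by (metis DiffD1)+
    then have "odd (card (w \<inter> \<Union>X)) \<longleftrightarrow> w = v" if "w \<in> ?V" for w
      using that X(2)[of w] K(1) by (metis DiffD1 DiffD2 imageI)
    then have "?h X = {v}" using v by blast
    then show ?thesis using X(1) by blast
  qed
  define V h where V: "V = ?V" and h: "h = ?h"
  have hX: "X \<subseteq> arcs D \<Longrightarrow> h X \<subseteq> V" for X by (auto simp: V h)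
  have fin_V: "finite V" using fin_vert by (simp add: V)
  have single': "\<exists>X. X \<subseteq> arcs D \<and> h X = {v}" if "v \<in> V" for v
    unfolding h using single[OF that[unfolded V]] .
  have h_add': "h (sym_diff X Y) = sym_diff (h X) (h Y)" if "X \<subseteq> arcs D" "Y \<subseteq> arcs D" for X Y
    unfolding h using h_add[OF that] .
  have onto: "h ` Pow (arcs D) = Pow V"
  proof (intro subset_antisym subsetI)
    fix W assume "W \<in> Pow V"
    then have "W \<subseteq> V" by blast
    from finite_subset[OF this fin_V] this have "\<exists>X. X \<subseteq> arcs D \<and> h X = W"
    proof (induction W rule: finite_induct)
      case empty
      have "h {} = {}" by (simp add: h)
      then show ?case by blast
    next
      case (insert v W)
      have W: "W \<subseteq> V" and vV: "v \<in> V" using insert.prems by simp_all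
      from insert.IH[OF W] obtain X where X: "X \<subseteq> arcs D" "h X = W"
        by (elim exE conjE)
      obtain Y where Y: "Y \<subseteq> arcs D" "h Y = {v}"
        using single'[OF vV] by (elim exE conjE)
      have "h (sym_diff X Y) = sym_diff W {v}"
        unfolding h_add'[OF X(1) Y(1)] X(2) Y(2) ..
      also have "\<dots> = insert v W" using insert.hyps by blast
      finally have "h (sym_diff X Y) = insert v W" .
      moreover have "sym_diff X Y \<subseteq> arcs D" using X Y by auto
      ultimately show ?case by (intro exI conjI)
    qed
    then show "W \<in> h ` Pow (arcs D)" by blast
  qed (use hX in blast)
  have "card (Pow (arcs D)) = card {X\<in>Pow (arcs D). h X = {}} * card (h ` Pow (arcs D))"
    by (rule card_eq_card_kernel_times_card_image)
      (use fin_arcs h_add' in auto)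
  moreover have "cycles_mod2 \<subseteq> {X\<in>Pow (arcs D). h X = {}}"
    by (auto simp: cycles_mod2_def h)
  then have "card cycles_mod2 \<le> card {X\<in>Pow (arcs D). h X = {}}"
    by (rule card_mono[rotated]) (use fin_arcs in simp)
  ultimately have 1: "card cycles_mod2 * 2 ^ card V \<le> 2 ^ card (arcs D)"
    using onto fin_arcs fin_V by (simp add: card_Pow)
  have V': "card V + card (components D) = card vertices"
  proof -
    have "root ` components D \<subseteq> vertices" using root by blast
    then show ?thesis unfolding V card_image[OF root_inj, symmetric]
      using fin_vert by (metis card_Diff_subset card_mono finite_subset le_add_diff_inverse2)
  qed
  from 1 have "card cycles_mod2 * 2 ^ card V * 2 ^ card (components D) \<le> 2 ^ card (arcs D) * 2 ^ card (components D)"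
    by (rule mult_right_mono) simp
  then show ?thesis unfolding V'[symmetric] by (simp add: power_add mult.assoc)
qed

text \<open>
  The arcs whose two half-edges are separated by \<open>U\<close>. If \<open>U\<close> is a union of faces this is its
  boundary mod 2.
\<close>

definition jump :: "'d set \<Rightarrow> 'd set set" where
  "jump U = {a\<in>arcs D. odd (card (a \<inter> U))}"

definition face_unions :: "'d set set" where
  "face_unions = Union ` Pow (faces D)"

lemma face_union_closed:
  assumes "U \<in> face_unions" and a: "{x, y} \<in> arcs D" "x \<noteq> y" and r: "(x, z) \<in> rotation D"
  shows "y \<in> U \<longleftrightarrow> z \<in> U"
proof -
  let ?r = "{(x, y). x \<noteq> y \<and> {x, y} \<in> arcs D} O rotation D"
  have "(y, z) \<in> conn ?r"
    using a r by (intro r_into_rtrancl) (auto simp: insert_commute)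
  moreover have "y \<in> darts D" using arc_in_darts[OF a(1)] by simp
  ultimately have "joined (faces D) y z" by (simp only: faces_def joined_eqv_classes)
  then obtain F where F: "F \<in> faces D" "y \<in> F" "z \<in> F" by (auto simp: joined_def)
  obtain \<S> where S: "\<S> \<subseteq> faces D" "U = \<Union>\<S>" using assms(1) by (auto simp: face_unions_def)
  have "x \<in> U \<longleftrightarrow> F \<in> \<S>" if "x \<in> F" for x
    using that F S partition_block_unique[OF faces_partition] by (metis UnionE UnionI subsetD)
  then show ?thesis using F by metis
qed

lemma jump_iff: "{x, y} \<in> arcs D \<Longrightarrow> x \<noteq> y \<Longrightarrow> {x, y} \<in> jump U \<longleftrightarrow> (x \<in> U) \<noteq> (y \<in> U)"
  unfolding jump_def using odd_card_two[of "{x, y}" x y U] by (simp add: Int_commute)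

lemma obtain_arc:
  assumes "x \<in> darts D"
  obtains y where "x \<noteq> y" "{x, y} \<in> arcs D"
proof -
  obtain a where a: "a \<in> arcs D" "x \<in> a" using assms partition_onD1[OF arcs] by blast
  obtain u w where "a = {u, w}" "u \<noteq> w" using arc2[OF a(1)] by (metis card_2_iff)
  then show thesis using a that[of u] that[of w] by (auto simp: insert_commute)
qed

text \<open>
  The half-edge opposite to \<open>x\<close> along its arc belongs to the same face as \<open>z\<close>, the next one after
  \<open>x\<close> at the vertex.
\<close>

lemma jump_rotation:
  assumes U: "U \<in> face_unions" and r: "(x, z) \<in> rotation D"
  shows "x \<in> \<Union>(jump U) \<longleftrightarrow> (x \<in> U) \<noteq> (z \<in> U)"
proof -
  have "x \<in> darts D" using r rotation_in_darts by blast
  then obtain y where y: "x \<noteq> y" "{x, y} \<in> arcs D" by (rule obtain_arc)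
  have "a = {x, y}" if "a \<in> jump U" "x \<in> a" for a
    using that y partition_block_unique[OF arcs, of a "{x, y}" x] by (simp add: jump_def)
  then have "x \<in> \<Union>(jump U) \<longleftrightarrow> {x, y} \<in> jump U" by (metis UnionE UnionI insertI1)
  also have "\<dots> \<longleftrightarrow> (x \<in> U) \<noteq> (y \<in> U)" using jump_iff[OF y(2,1)] .
  also have "y \<in> U \<longleftrightarrow> z \<in> U" using face_union_closed[OF U y(2,1) r] .
  finally show ?thesis .
qed

lemma rotation_ends:
  assumes "c \<in> crossings D"
  shows "(ends D c 0, ends D c 1) \<in> rotation D" "(ends D c 1, ends D c 2) \<in> rotation D"
    "(ends D c 2, ends D c 3) \<in> rotation D" "(ends D c 3, ends D c 0) \<in> rotation D"
proof -
  have r: "(ends D c k, ends D c (Suc k mod 4)) \<in> rotation D" if "k < 4" for k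
    using assms that unfolding rotation_def by blast
  have m: "Suc 0 mod 4 = 1" "Suc 1 mod 4 = 2" "Suc 2 mod 4 = 3" "Suc 3 mod 4 = 0" by simp_all
  show "(ends D c 0, ends D c 1) \<in> rotation D" "(ends D c 1, ends D c 2) \<in> rotation D"
    "(ends D c 2, ends D c 3) \<in> rotation D" "(ends D c 3, ends D c 0) \<in> rotation D"
    using r[of 0, unfolded m] r[of 1, unfolded m] r[of 2, unfolded m] r[of 3, unfolded m]
    by simp_all
qed

text \<open>
  Going once around a vertex, membership in \<open>U\<close> changes an even number of times.
\<close>

lemma jump_in_cycles_mod2:
  assumes U: "U \<in> face_unions"
  shows "jump U \<in> cycles_mod2"
proof -
  have "even (card (v \<inter> W))" if v: "v \<in> vertices" and W: "W = \<Union>(jump U)" for v W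
  proof -
    from v consider (point) "v \<in> points D" | (crossing) c where "c \<in> crossings D" "v = ends_at D c" by auto
    then show ?thesis
    proof cases
      case point
      then obtain x y where v: "v = {x, y}" "x \<noteq> y" using point2 by (metis card_2_iff)
      then have "(x, y) \<in> rotation D" "(y, x) \<in> rotation D"
        using point by (auto simp: rotation_def insert_commute)
      then have "x \<in> W \<longleftrightarrow> y \<in> W" unfolding W using jump_rotation[OF U] by blast
      then show ?thesis using odd_card_two[OF v, of W] by (simp add: Int_commute)
    next
      case crossing
      let ?e = "ends D c"
      let ?i = "\<lambda>k. if ?e k \<in> W then {?e k} else {}"
      have "v \<inter> W = ?i 0 \<union> (?i 1 \<union> (?i 2 \<union> ?i 3))"
        unfolding crossing ends_at_eq by auto
      then have "card (v \<inter> W) = card (?i 0) + (card (?i 1) + (card (?i 2) + card (?i 3)))"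
        using ends_distinct[OF crossing(1)] by (auto simp: card_insert_if)
      moreover note rot = rotation_ends[OF crossing(1)]
      have "?e 0 \<in> W \<longleftrightarrow> (?e 0 \<in> U) \<noteq> (?e 1 \<in> U)" "?e 1 \<in> W \<longleftrightarrow> (?e 1 \<in> U) \<noteq> (?e 2 \<in> U)"
        "?e 2 \<in> W \<longleftrightarrow> (?e 2 \<in> U) \<noteq> (?e 3 \<in> U)" "?e 3 \<in> W \<longleftrightarrow> (?e 3 \<in> U) \<noteq> (?e 0 \<in> U)"
        unfolding W by (rule jump_rotation[OF U rot(1)] jump_rotation[OF U rot(2)]
          jump_rotation[OF U rot(3)] jump_rotation[OF U rot(4)])+
      ultimately show ?thesis
        by (cases "?e 0 \<in> U"; cases "?e 1 \<in> U"; cases "?e 2 \<in> U"; cases "?e 3 \<in> U"; simp)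
    qed
  qed
  then show ?thesis by (auto simp: cycles_mod2_def jump_def)
qed

lemma card_face_unions: "card face_unions = 2 ^ card (faces D)"
proof -
  have "inj_on Union (Pow (faces D))"
  proof (rule inj_onI)
    fix S T assume ST: "S \<in> Pow (faces D)" "T \<in> Pow (faces D)" "\<Union>S = \<Union>T"
    have sub: "S \<subseteq> T" if "S \<subseteq> faces D" "T \<subseteq> faces D" "\<Union>S = \<Union>T" for S T
    proof
      fix F assume F: "F \<in> S"
      have FD: "F \<in> faces D" using F that(1) by (rule subsetD[rotated])
      then have "F \<noteq> {}" using partition_onD3[OF faces_partition] by metis
      then obtain x where x: "x \<in> F" by (metis ex_in_conv)
      have "x \<in> \<Union>T" using F x unfolding that(3)[symmetric] by (rule UnionI)
      then obtain F' where F': "F' \<in> T" "x \<in> F'" by (rule UnionE)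
      have "F = F'"
        by (rule partition_block_unique[OF faces_partition FD _ x F'(2)]) (rule subsetD[OF that(2) F'(1)])
      then show "F \<in> T" using F' by simp
    qed
    show "S = T" by (rule subset_antisym; rule sub) (use ST in simp_all)
  qed
  moreover have "finite (faces D)" using faces_partition fin by (metis finite_UnionD partition_onD1)
  ultimately show ?thesis by (simp add: face_unions_def card_image card_Pow)
qed

text \<open>
  A union of faces without boundary is closed under passing along arcs and around vertices, so it is a
  union of components.
\<close>

lemma card_jump_kernel: "card {U\<in>face_unions. jump U = {}} \<le> 2 ^ card (components D)"
proof -
  have fin_comp: "finite (components D)" using components_partition fin by (metis finite_UnionD partition_onD1)
  have "U \<in> Union ` Pow (components D)" if U: "U \<in> face_unions" "jump U = {}" for U
  proof -
    have arc: "x \<in> U \<longleftrightarrow> y \<in> U" if "{x, y} \<in> arcs D" "x \<noteq> y" for x y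
      using jump_iff[OF that, of U] U(2) by simp
    have rot: "x \<in> U \<longleftrightarrow> z \<in> U" if "(x, z) \<in> rotation D" for x z
      using jump_rotation[OF U(1) that] U(2) by simp
    have "x \<in> U \<longleftrightarrow> y \<in> U" if "(x, y) \<in> together (arcs D \<union> points D \<union> ends_at D ` crossings D)" for x y
    proof -
      obtain a where a: "a \<in> arcs D \<or> a \<in> points D \<or> (\<exists>c\<in>crossings D. a = ends_at D c)" "x \<in> a" "y \<in> a"
        using \<open>(x, y) \<in> together _\<close> by (auto simp: together_def)
      show ?thesis
      proof (cases "x = y")
        case False
        consider "a \<in> arcs D" | "a \<in> points D" | c where "c \<in> crossings D" "a = ends_at D c"
          using a(1) by blast
        then show ?thesis
        proof cases
          case 1
          then have "a = {x, y}" using arc2 a False by (metis card_2_iff doubleton_eq_iff insertE singletonD)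
          then show ?thesis using arc 1 False by blast
        next
          case 2
          then have "a = {x, y}" using point2 a False by (metis card_2_iff doubleton_eq_iff insertE singletonD)
          then have "(x, y) \<in> rotation D" using 2 False by (auto simp: rotation_def)
          then show ?thesis by (rule rot)
        next
          case (3 c)
          then show ?thesis using a(2,3) rotation_ends[OF 3(1), THEN rot] by (auto simp: ends_at_eq)
        qed
      qed simp
    qed
    then have cl: "x \<in> U \<longleftrightarrow> y \<in> U" if "(x, y) \<in> conn (together (arcs D \<union> points D \<union> ends_at D ` crossings D))" for x y
      using conn_closed[OF that] by blast
    have UD: "U \<subseteq> darts D" using U(1) partition_onD1[OF faces_partition] by (auto simp: face_unions_def)
    have "U = \<Union>{K\<in>components D. K \<subseteq> U}"
    proof (intro subset_antisym subsetI)
      fix x assume x: "x \<in> U"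
      then obtain K where K: "K \<in> components D" "x \<in> K"
        using UD partition_onD1[OF components_partition] by blast
      have "y \<in> U" if "y \<in> K" for y
      proof -
        have "joined (components D) x y" using K that by (auto simp: joined_def)
        moreover have "x \<in> darts D" using x UD by blast
        ultimately show ?thesis using x cl by (simp only: components_def joined_eqv_classes)
      qed
      then show "x \<in> \<Union>{K\<in>components D. K \<subseteq> U}" using K by blast
    qed blast
    then show ?thesis by blast
  qed
  then have "{U\<in>face_unions. jump U = {}} \<subseteq> Union ` Pow (components D)" by blast
  then have "card {U\<in>face_unions. jump U = {}} \<le> card (Union ` Pow (components D))"
    by (rule card_mono[rotated]) (use fin_comp in simp)
  also have "\<dots> \<le> card (Pow (components D))" by (rule card_image_le) (use fin_comp in simp)
  finally show ?thesis using fin_comp by (simp add: card_Pow)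
qed

text \<open>
  The kernel of the boundary map on unions of faces is small and the space of cycles is small; by
  Euler's formula, every cycle is the boundary of a union of faces. All vertices have
  valency 2 or 4, so this applies to the set of all arcs.
\<close>

theorem colouring:
  assumes "planar D"
  obtains U where "\<And>x y. {x, y} \<in> arcs D \<Longrightarrow> x \<noteq> y \<Longrightarrow> x \<in> U \<longleftrightarrow> y \<notin> U"
    "\<And>x y. (x, y) \<in> rotation D \<Longrightarrow> x \<in> U \<longleftrightarrow> y \<notin> U"
proof -
  have fin_faces: "finite (faces D)" using faces_partition fin by (metis finite_UnionD partition_onD1)
  have euler: "card vertices + card (faces D) = card (arcs D) + 2 * card (components D)"
    using assms card_vertices by (simp add: planar_def)
  let ?Z = "card cycles_mod2" and ?I = "card (jump ` face_unions)"
  let ?C = "card (components D)" and ?V = "card vertices" and ?F = "card (faces D)"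
  have sd: "\<Union>(sym_diff S T) = sym_diff (\<Union>S) (\<Union>T)" if "S \<subseteq> faces D" "T \<subseteq> faces D" for S T
    using Union_sym_diff[OF faces_partition that] .
  have "sym_diff X Y \<in> face_unions" if XY: "X \<in> face_unions" "Y \<in> face_unions" for X Y
  proof -
    obtain S T where "S \<subseteq> faces D" "T \<subseteq> faces D" "X = \<Union>S" "Y = \<Union>T"
      using XY by (auto simp: face_unions_def)
    then have "sym_diff X Y = \<Union>(sym_diff S T)" "sym_diff S T \<subseteq> faces D" using sd by blast+
    then show ?thesis unfolding face_unions_def by blast
  qed
  moreover have "jump (sym_diff X Y) = sym_diff (jump X) (jump Y)" for X Y
  proof -
    have "finite a" if "a \<in> arcs D" for a using arc_in_darts[OF that] fin(1) finite_subset by metis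
    then show ?thesis unfolding jump_def using odd_card_Int_sym_diff[of _ X Y] by auto
  qed
  moreover have "finite face_unions" using fin_faces by (simp add: face_unions_def)
  ultimately have "card face_unions = card {U\<in>face_unions. jump U = {}} * ?I"
    by (intro card_eq_card_kernel_times_card_image) auto
  \<comment> \<open>In terms of binary logarithms: \<open>log ?I \<ge> F - C = E - V + C \<ge> log ?Z\<close>, where \<open>E\<close> is the number of arcs.\<close>
  then have "2 ^ ?F \<le> 2 ^ ?C * ?I"
    using card_face_unions mult_right_mono[OF card_jump_kernel, of ?I] by simp
  then have "2 ^ ?F * 2 ^ ?V \<le> 2 ^ ?C * ?I * 2 ^ ?V" by (rule mult_right_mono) simp
  moreover have "?Z * 2 ^ ?V * 2 ^ ?C \<le> 2 ^ (card (arcs D) + ?C) * 2 ^ ?C"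
    using card_cycles_mod2 by (rule mult_right_mono) simp
  moreover have "(2::nat) ^ (card (arcs D) + ?C) * 2 ^ ?C = 2 ^ ?F * 2 ^ ?V"
    using euler by (simp add: power_add[symmetric] mult_2)
  ultimately have "?Z * 2 ^ ?V * 2 ^ ?C \<le> 2 ^ ?C * ?I * 2 ^ ?V" by linarith
  then have le: "?Z \<le> ?I" by (simp add: mult_ac)
  have "finite cycles_mod2" using fin_arcs by (simp add: cycles_mod2_def)
  then have "jump ` face_unions = cycles_mod2"
    using le jump_in_cycles_mod2 by (intro card_seteq) auto
  moreover have "arcs D \<in> cycles_mod2"
  proof -
    have "even (card v)" if "v \<in> vertices" for v using that point2 card_ends_at by auto
    moreover have "v \<inter> \<Union>(arcs D) = v" if "v \<in> vertices" for v
      using vertex_in_darts[OF that] partition_onD1[OF arcs] by blast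
    ultimately show ?thesis by (auto simp: cycles_mod2_def)
  qed
  ultimately obtain U where U: "U \<in> face_unions" "jump U = arcs D" by (metis imageE)
  show thesis
  proof (rule that)
    show "x \<in> U \<longleftrightarrow> y \<notin> U" if "{x, y} \<in> arcs D" "x \<noteq> y" for x y
      using jump_iff[OF that, of U] U(2) that by simp
    show "x \<in> U \<longleftrightarrow> y \<notin> U" if "(x, y) \<in> rotation D" for x y
    proof -
      have "x \<in> darts D" using that rotation_in_darts by blast
      then have "x \<in> \<Union>(jump U)" unfolding U(2) using partition_onD1[OF arcs] by blast
      then show ?thesis using jump_rotation[OF U(1) that] by simp
    qed
  qed
qed

end

section \<open>The two smoothings of a crossing\<close>

lemma card_Union_pairs:
  assumes "finite G" "\<And>p q. p \<in> G \<Longrightarrow> q \<in> G \<Longrightarrow> p \<noteq> q \<Longrightarrow> p \<inter> q = {}"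
    "\<And>p. p \<in> G \<Longrightarrow> finite p" "\<And>p. p \<in> G \<Longrightarrow> card (p \<inter> U) = n"
  shows "card (\<Union>G \<inter> U) = n * card G"
proof -
  have "\<Union>G \<inter> U = (\<Union>p\<in>G. p \<inter> U)" by auto
  also have "card \<dots> = (\<Sum>p\<in>G. card (p \<inter> U))"
    by (rule card_UN_disjoint) (use assms in blast)+
  finally show ?thesis using assms(4) by simp
qed

locale planar_diagram = linkgraph D for D :: "('c, 'd) diagram" +
  assumes planar: "planar D"
begin

text \<open>
  How a state \<open>s\<close> connects the half-edges at the vertices other than \<open>c\<close>.
\<close>

definition other_pairs :: "('c \<Rightarrow> sign) \<Rightarrow> 'c \<Rightarrow> 'd set set" where
  "other_pairs s c = points D \<union> (\<Union>c'\<in>crossings D - {c}. smoothed_ends (s c') (ends D c'))"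

lemma smoothed_pair:
  assumes c: "c \<in> crossings D" and p: "p \<in> smoothed_ends m (ends D c)"
  shows "p \<subseteq> ends_at D c" "card p = 2"
    and "q \<in> smoothed_ends m (ends D c) \<Longrightarrow> p \<noteq> q \<Longrightarrow> p \<inter> q = {}"
  using ends_distinct[OF c] p by (cases m; auto simp: ends_at_eq)+

lemma Union_smoothed: "\<Union>(smoothed_ends m (ends D c)) = ends_at D c"
  by (cases m) (auto simp: ends_at_eq)

lemma other_pairs_host:
  assumes "p \<in> other_pairs s c"
  obtains v where "v \<in> vertices" "p \<subseteq> v" "v = p \<and> p \<in> points D \<or>
    (\<exists>c'\<in>crossings D - {c}. v = ends_at D c' \<and> p \<in> smoothed_ends (s c') (ends D c'))"
proof -
  from assms consider "p \<in> points D" | c' where "c' \<in> crossings D" "c' \<noteq> c" "p \<in> smoothed_ends (s c') (ends D c')"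
    by (auto simp: other_pairs_def)
  then show thesis
  proof cases
    case 1
    then show ?thesis using that[of p] by blast
  next
    case 2
    then show ?thesis using that[of "ends_at D c'"] smoothed_pair(1)[OF 2(1,3)] by blast
  qed
qed

lemma other_pairs_card: "p \<in> other_pairs s c \<Longrightarrow> card p = 2"
  using point2 smoothed_pair(2) by (auto simp: other_pairs_def)

lemma points_not_ends: "p \<in> points D \<Longrightarrow> c \<in> crossings D \<Longrightarrow> p \<noteq> ends_at D c"
  using point2 card_ends_at by fastforce

lemma other_pairs_disjoint:
  assumes p: "p \<in> other_pairs s c" and q: "q \<in> other_pairs s c" and "p \<noteq> q"
  shows "p \<inter> q = {}"
proof (rule ccontr)
  assume "p \<inter> q \<noteq> {}"
  then obtain x where x: "x \<in> p" "x \<in> q" by blast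
  obtain v where v: "v \<in> vertices" "p \<subseteq> v" "v = p \<and> p \<in> points D \<or>
    (\<exists>c'\<in>crossings D - {c}. v = ends_at D c' \<and> p \<in> smoothed_ends (s c') (ends D c'))"
    using p by (rule other_pairs_host)
  obtain w where w: "w \<in> vertices" "q \<subseteq> w" "w = q \<and> q \<in> points D \<or>
    (\<exists>c'\<in>crossings D - {c}. w = ends_at D c' \<and> q \<in> smoothed_ends (s c') (ends D c'))"
    using q by (rule other_pairs_host)
  have "v = w"
    by (rule partition_block_unique[OF vert v(1) w(1), of x]) (use x v(2) w(2) in \<open>simp_all add: subset_iff\<close>)
  from v(3) show False
  proof
    assume vp: "v = p \<and> p \<in> points D"
    then have "w \<in> points D" using \<open>v = w\<close> by simp
    then have "w = q" using w(3) points_not_ends by blast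
    then show False using vp \<open>v = w\<close> \<open>p \<noteq> q\<close> by simp
  next
    assume "\<exists>c'\<in>crossings D - {c}. v = ends_at D c' \<and> p \<in> smoothed_ends (s c') (ends D c')"
    then obtain c' where c': "c' \<in> crossings D" "v = ends_at D c'" "p \<in> smoothed_ends (s c') (ends D c')" by blast
    then have "w \<notin> points D" using \<open>v = w\<close> points_not_ends by blast
    then obtain c'' where c'': "c'' \<in> crossings D" "w = ends_at D c''" "q \<in> smoothed_ends (s c'') (ends D c'')"
      using w(3) by blast
    have "c' = c''" by (rule inj_onD[OF ends_at_inj]) (use c' c'' \<open>v = w\<close> in simp_all)
    then have "p \<inter> q = {}" using smoothed_pair(3)[OF c'(1,3)] c''(3) \<open>p \<noteq> q\<close> by blast
    then show False using x by blast
  qed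
qed

lemma Union_other_pairs:
  assumes "c \<in> crossings D"
  shows "\<Union>(other_pairs s c) = darts D - ends_at D c"
proof -
  have "\<Union>(other_pairs s c) = \<Union>(points D \<union> ends_at D ` (crossings D - {c}))"
  proof -
    have "\<Union>(\<Union>c'\<in>C. smoothed_ends (s c') (ends D c')) =
        (\<Union>c'\<in>C. \<Union>(smoothed_ends (s c') (ends D c')))" for C by blast
    then show ?thesis unfolding other_pairs_def Union_Un_distrib by (simp add: Union_smoothed)
  qed
  also have "points D \<union> ends_at D ` (crossings D - {c}) = vertices - {ends_at D c}"
    using assms points_not_ends inj_on_image_set_diff[OF ends_at_inj, of "crossings D" "{c}"] by auto
  also have "\<Union>\<dots> = \<Union>vertices - ends_at D c"
  proof -
    have "x \<notin> ends_at D c" if "v \<in> vertices - {ends_at D c}" "x \<in> v" for v x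
    proof
      assume "x \<in> ends_at D c"
      then have "v = ends_at D c"
        by (intro partition_block_unique[OF vert, of v "ends_at D c" x]) (use that assms in simp_all)
      then show False using that by simp
    qed
    then show ?thesis by blast
  qed
  finally show ?thesis using partition_onD1[OF vert] by simp
qed

lemma card_Int_ends_at:
  assumes "c \<in> crossings D"
  shows "card (W \<inter> ends_at D c) = of_bool (ends D c 0 \<in> W) + of_bool (ends D c 1 \<in> W) +
    of_bool (ends D c 2 \<in> W) + of_bool (ends D c 3 \<in> W)"
proof -
  let ?i = "\<lambda>k. if ends D c k \<in> W then {ends D c k} else {}"
  have "W \<inter> ends_at D c = ?i 0 \<union> (?i 1 \<union> (?i 2 \<union> ?i 3))"
    unfolding ends_at_eq by auto
  then show ?thesis using ends_distinct[OF assms] by (auto simp: card_insert_if)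
qed

abbreviation rest :: "('c \<Rightarrow> sign) \<Rightarrow> 'c \<Rightarrow> 'd set set" where
  "rest s c \<equiv> arcs D \<union> other_pairs s c"

lemma Union_rest: "c \<in> crossings D \<Longrightarrow> \<Union>(rest s c) = darts D"
  using Union_other_pairs partition_onD1[OF arcs] by auto

lemma rest_card: "p \<in> rest s c \<Longrightarrow> card p = 2"
  using arc2 other_pairs_card by auto

text \<open>
  A union of classes \<open>K\<close> is matched completely by arcs, and away from the crossing also by the other
  pairs. Comparing the two counts leaves the ends of \<open>c\<close> in \<open>K\<close>.
\<close>

lemma closed_class_count:
  assumes c: "c \<in> crossings D" and K: "K \<subseteq> darts D" "\<And>p. p \<in> rest s c \<Longrightarrow> p \<subseteq> K \<or> p \<inter> K = {}"
    and n: "\<And>p. p \<in> rest s c \<Longrightarrow> card (p \<inter> U) = n"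
  shows "card (K \<inter> U) = n * card {p\<in>arcs D. p \<subseteq> K}"
    and "card (K \<inter> U) = card (K \<inter> ends_at D c \<inter> U) + n * card {p\<in>other_pairs s c. p \<subseteq> K}"
proof -
  have fin_p: "finite p" if "p \<in> rest s c" for p
    using rest_card[OF that] by (metis card.infinite zero_neq_numeral)
  have UK: "\<Union>{p\<in>F. p \<subseteq> K} = \<Union>F \<inter> K" if "F \<subseteq> rest s c" for F
    using K(2) that by blast
  have fin_F: "finite {p\<in>F. p \<subseteq> K}" for F :: "'d set set"
    by (rule finite_subset[of _ "Pow K"]) (use finite_subset[OF K(1) fin(1)] in auto)
  have "card (\<Union>{p\<in>arcs D. p \<subseteq> K} \<inter> U) = n * card {p\<in>arcs D. p \<subseteq> K}"
  proof (rule card_Union_pairs[OF fin_F])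
    show "p \<inter> q = {}" if "p \<in> {p \<in> arcs D. p \<subseteq> K}" "q \<in> {p \<in> arcs D. p \<subseteq> K}" "p \<noteq> q" for p q
      using that partition_onD2[OF arcs] by (auto dest: disjointD)
  qed (use fin_p n in auto)
  moreover have "\<Union>(arcs D) \<inter> K = K" using K(1) partition_onD1[OF arcs] by blast
  ultimately show "card (K \<inter> U) = n * card {p\<in>arcs D. p \<subseteq> K}" using UK[of "arcs D"] by simp
  have "card (\<Union>{p\<in>other_pairs s c. p \<subseteq> K} \<inter> U) = n * card {p\<in>other_pairs s c. p \<subseteq> K}"
  proof (rule card_Union_pairs[OF fin_F])
    show "p \<inter> q = {}" if "p \<in> {p \<in> other_pairs s c. p \<subseteq> K}" "q \<in> {p \<in> other_pairs s c. p \<subseteq> K}" "p \<noteq> q" for p q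
      by (rule other_pairs_disjoint[of _ s c]) (use that in simp_all)
  qed (use fin_p n in auto)
  moreover have "\<Union>(other_pairs s c) \<inter> K = K - ends_at D c"
    unfolding Union_other_pairs[OF c] using K(1) by blast
  ultimately have "card ((K - ends_at D c) \<inter> U) = n * card {p\<in>other_pairs s c. p \<subseteq> K}"
    using UK[of "other_pairs s c"] by simp
  moreover have "K \<inter> U = K \<inter> ends_at D c \<inter> U \<union> (K - ends_at D c) \<inter> U" by blast
  then have "card (K \<inter> U) = card (K \<inter> ends_at D c \<inter> U) + card ((K - ends_at D c) \<inter> U)"
    using finite_subset[OF K(1) fin(1)] by (metis card_Un_disjoint finite_Int finite_Diff Int_Diff_disjoint
      Diff_Int_distrib2 Diff_disjoint inf_assoc inf_commute inf_bot_right)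
  ultimately show "card (K \<inter> U) = card (K \<inter> ends_at D c \<inter> U) + n * card {p\<in>other_pairs s c. p \<subseteq> K}"
    by simp
qed

text \<open>
  All pairs consist of two half-edges of different colours, so the ends of \<open>c\<close> in \<open>K\<close> are equally
  many of both colours; opposite ends have the same colour.
\<close>

lemma class_balanced:
  assumes c: "c \<in> crossings D" and K: "K \<subseteq> darts D" "\<And>p. p \<in> rest s c \<Longrightarrow> p \<subseteq> K \<or> p \<inter> K = {}"
  shows "of_bool (ends D c 0 \<in> K) + of_bool (ends D c 2 \<in> K) =
    (of_bool (ends D c 1 \<in> K) + of_bool (ends D c 3 \<in> K) :: nat)"
proof -
  obtain U where U: "\<And>x y. {x, y} \<in> arcs D \<Longrightarrow> x \<noteq> y \<Longrightarrow> x \<in> U \<longleftrightarrow> y \<notin> U"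
    "\<And>x y. (x, y) \<in> rotation D \<Longrightarrow> x \<in> U \<longleftrightarrow> y \<notin> U"
    using colouring[OF planar] by blast
  have one: "card ({x, y} \<inter> U) = 1" if "x \<in> U \<longleftrightarrow> y \<notin> U" for x y
    using that by (cases "x \<in> U") auto
  have "card (p \<inter> U) = 1" if p: "p \<in> rest s c" for p
  proof -
    from p consider (arc) "p \<in> arcs D" | (point) "p \<in> points D"
      | (pair) c' where "c' \<in> crossings D" "p \<in> smoothed_ends (s c') (ends D c')"
      by (auto simp: other_pairs_def)
    then show ?thesis
    proof cases
      case arc
      then obtain x y where "p = {x, y}" "x \<noteq> y" using arc2 by (metis card_2_iff)
      then show ?thesis using one U(1) arc by blast
    next
      case point
      then obtain x y where xy: "p = {x, y}" "x \<noteq> y" using point2 by (metis card_2_iff)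
      then have "(x, y) \<in> rotation D" using point by (auto simp: rotation_def)
      then show ?thesis unfolding xy(1) by (intro one U(2))
    next
      case (pair c')
      note r = rotation_ends[OF pair(1), THEN U(2), THEN one]
      show ?thesis using pair(2) r by (cases "s c'") auto
    qed
  qed
  note cU = closed_class_count[where s = s, OF c K this]
  note cUNIV = closed_class_count[where s = s and U = UNIV and n = 2, OF c K]
  have "card (K \<inter> ends_at D c) = 2 * card (K \<inter> ends_at D c \<inter> U)"
    using cU cUNIV rest_card by simp
  moreover have "K \<inter> ends_at D c \<inter> U = (K \<inter> U) \<inter> ends_at D c" by blast
  moreover note rotation_ends[OF c, THEN U(2)]
  ultimately show ?thesis
    by (cases "ends D c 0 \<in> U") (simp_all add: card_Int_ends_at[OF c])
qed

text \<open>
  With \<open>2 n\<close> half-edges, a class which contains all four ends has \<open>n\<close> arcs and \<open>n - 2\<close> other pairs,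
  one edge less than a connected graph needs.
\<close>

lemma class_not_all_ends:
  assumes c: "c \<in> crossings D" and x: "x \<in> darts D"
    and K: "K = {y. (x, y) \<in> conn (together (rest s c))}"
  shows "\<not> ends_at D c \<subseteq> K"
proof
  assume all: "ends_at D c \<subseteq> K"
  have r: "together (rest s c) \<subseteq> darts D \<times> darts D"
    using Union_rest[OF c, of s] unfolding together_def by blast
  have KD: "K \<subseteq> darts D" using conn_within[OF _ r] x unfolding K by blast
  have closed: "p \<subseteq> K \<or> p \<inter> K = {}" if p: "p \<in> rest s c" for p
  proof -
    have "(y, z) \<in> conn (together (rest s c))" if "y \<in> p" "z \<in> p" for y z
      using p that by (intro r_into_rtrancl) (auto simp: together_def)
    then show ?thesis unfolding K by (blast intro: conn_trans)
  qed
  define G1 G2 where G: "G1 = {p\<in>arcs D. p \<subseteq> K}" "G2 = {p\<in>other_pairs s c. p \<subseteq> K}"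
  note count = closed_class_count[where s = s and U = UNIV and n = 2, OF c KD closed, folded G]
  have "K \<inter> ends_at D c = ends_at D c" using all by blast
  then have "card K = 2 * card G1" "card K = 4 + 2 * card G2"
    using count rest_card card_ends_at[OF c] by simp_all
  moreover have finK: "finite K" using KD fin(1) by (rule finite_subset)
  have finG: "finite (G1 \<union> G2)"
    by (rule finite_subset[of _ "Pow K"]) (use finK in \<open>auto simp: G\<close>)
  have "card K \<le> card (eqv_classes K (together (G1 \<union> G2))) + card (G1 \<union> G2)"
    by (rule card_le_classes_plus_edges[OF finG finK]) (use rest_card in \<open>auto simp: G\<close>)
  moreover have "card (G1 \<union> G2) \<le> card G1 + card G2" by (rule card_Un_le)
  \<comment> \<open>A path in \<open>rest s c\<close> starting in \<open>K\<close> only uses pairs inside \<open>K\<close>.\<close>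
  moreover have "card (eqv_classes K (together (G1 \<union> G2))) \<le> 1"
  proof -
    have P: "partition_on K (eqv_classes K (together (G1 \<union> G2)))" (is "partition_on K ?P")
      by (rule partition_on_eqv_classes) (auto simp: together_def G)
    have "(x, y) \<in> conn (together (G1 \<union> G2))" if "(x, y) \<in> conn (together (rest s c))" for y
      using that
    proof (induction rule: rtrancl_induct)
      case (step y z)
      obtain p where p: "p \<in> rest s c" "y \<in> p" "z \<in> p"
        using step(2) unfolding together_def by blast
      have "y \<in> K" using step(1) by (simp add: K)
      then have "p \<subseteq> K" using closed[OF p(1)] p(2) by blast
      then have "p \<in> G1 \<union> G2" using p(1) by (auto simp: G)
      then have "(y, z) \<in> conn (together (G1 \<union> G2))"
        using p(2,3) by (intro r_into_rtrancl) (auto simp: together_def)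
      then show ?case by (rule conn_trans[OF step.IH])
    qed simp
    moreover have xK: "x \<in> K" by (simp add: K)
    ultimately have all_joined: "joined ?P x y" if "y \<in> K" for y
      using that by (simp add: joined_eqv_classes K)
    obtain X where X: "X \<in> ?P" "x \<in> X" using xK partition_onD1[OF P] by blast
    have "Y = X" if Y: "Y \<in> ?P" for Y
    proof -
      obtain y where y: "y \<in> Y" using Y partition_onD3[OF P] by (metis ex_in_conv)
      then have "y \<in> K" using Y partition_onD1[OF P] by blast
      then obtain Z where Z: "Z \<in> ?P" "x \<in> Z" "y \<in> Z" using all_joined unfolding joined_def by blast
      have "Z = X" by (rule partition_block_unique[OF P Z(1) X(1) Z(2) X(2)])
      moreover have "Z = Y" by (rule partition_block_unique[OF P Z(1) Y Z(3) y])
      ultimately show ?thesis by simp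
    qed
    then have "?P \<subseteq> {X}" by blast
    then have "card ?P \<le> card {X}" by (rule card_mono[rotated]) simp
    then show ?thesis by simp
  qed
  ultimately show False by linarith
qed

text \<open>
  Cutting out the crossing leaves two strands, each joining two neighbouring ends: four
  ends on one strand are impossible, and by the colouring opposite ends cannot be paired.
\<close>

lemma strands_at_crossing:
  assumes c: "c \<in> crossings D" and B: "B = eqv_classes (darts D) (together (rest s c))"
  shows "\<not> joined B (ends D c 0) (ends D c 2)"
    and "joined B (ends D c 0) (ends D c 1) \<and> joined B (ends D c 2) (ends D c 3) \<or>
         joined B (ends D c 0) (ends D c 3) \<and> joined B (ends D c 2) (ends D c 1)"
proof -
  let ?e = "ends D c" and ?r = "together (rest s c)"
  have e: "?e k \<in> darts D" if "k < 4" for k using ends_in_darts[OF c that] .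
  have r: "?r \<subseteq> darts D \<times> darts D"
    using Union_rest[OF c, of s] unfolding together_def by blast
  define K where "K k = {y. (?e k, y) \<in> conn ?r}" for k
  have j: "joined B (?e k) y \<longleftrightarrow> y \<in> K k" if "k < 4" for k y
    using e[OF that] by (simp add: B K_def joined_eqv_classes)
  have bal: "of_bool (?e 0 \<in> K k) + of_bool (?e 2 \<in> K k) =
    (of_bool (?e 1 \<in> K k) + of_bool (?e 3 \<in> K k) :: nat)" if "k < 4" for k
  proof (rule class_balanced[OF c])
    show "K k \<subseteq> darts D" using conn_within[OF _ r] e[OF that] unfolding K_def by blast
    show "p \<subseteq> K k \<or> p \<inter> K k = {}" if p: "p \<in> rest s c" for p
    proof -
      have "(y, z) \<in> conn (together (rest s c))" if "y \<in> p" "z \<in> p" for y z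
        using p that by (intro r_into_rtrancl) (auto simp: together_def)
      then show ?thesis unfolding K_def by (blast intro: conn_trans)
    qed
  qed
  have nall: "\<not> (?e 0 \<in> K k \<and> ?e 1 \<in> K k \<and> ?e 2 \<in> K k \<and> ?e 3 \<in> K k)" if "k < 4" for k
    using class_not_all_ends[OF c e[OF that], of "K k" s] by (simp add: K_def ends_at_eq)
  have refl: "?e k \<in> K k" for k by (simp add: K_def)
  have sym: "?e k \<in> K l \<longleftrightarrow> ?e l \<in> K k" for k l unfolding K_def by (auto intro: conn_sym)
  have trans: "?e m \<in> K k" if "?e l \<in> K k" "?e m \<in> K l" for k l m
    using that unfolding K_def by (auto intro: conn_trans)
  have n02: "?e 2 \<notin> K 0" using bal[of 0] nall[of 0] refl[of 0]
    by (cases "?e 1 \<in> K 0"; cases "?e 2 \<in> K 0"; cases "?e 3 \<in> K 0"; simp)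
  then show "\<not> joined B (ends D c 0) (ends D c 2)" by (simp add: j)
  have n20: "?e 0 \<notin> K 2" using n02 sym by blast
  have 0: "(?e 1 \<in> K 0) \<noteq> (?e 3 \<in> K 0)" using bal[of 0] refl[of 0] n02
    by (cases "?e 1 \<in> K 0"; cases "?e 3 \<in> K 0"; simp)
  have 2: "(?e 1 \<in> K 2) \<noteq> (?e 3 \<in> K 2)" using bal[of 2] refl[of 2] n20
    by (cases "?e 1 \<in> K 2"; cases "?e 3 \<in> K 2"; simp)
  have 1: "\<not> (?e 1 \<in> K 0 \<and> ?e 1 \<in> K 2)" "\<not> (?e 3 \<in> K 0 \<and> ?e 3 \<in> K 2)"
    using n02 trans[of _ 0 2] sym by blast+
  show "joined B (ends D c 0) (ends D c 1) \<and> joined B (ends D c 2) (ends D c 3) \<or>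
     joined B (ends D c 0) (ends D c 3) \<and> joined B (ends D c 2) (ends D c 1)"
    using 0 1 2 by (simp add: j) blast
qed

lemma circles_fuse:
  assumes c: "c \<in> crossings D" and B: "B = eqv_classes (darts D) (together (rest s c))"
  shows "s c = Pos \<Longrightarrow> circles D s = fuse (fuse B (ends D c 2) (ends D c 3)) (ends D c 0) (ends D c 1)"
    and "s c = Neg \<Longrightarrow> circles D s = fuse (fuse B (ends D c 3) (ends D c 0)) (ends D c 1) (ends D c 2)"
proof -
  let ?e = "ends D c"
  have e: "?e k \<in> darts D" if "k < 4" for k using ends_in_darts[OF c that] .
  have F: "arcs D \<union> points D \<union> (\<Union>c\<in>crossings D. smoothed_ends (s c) (ends D c)) =
      smoothed_ends (s c) ?e \<union> rest s c"
  proof -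
    have "(\<Union>c\<in>crossings D. smoothed_ends (s c) (ends D c)) =
        smoothed_ends (s c) ?e \<union> (\<Union>c\<in>crossings D - {c}. smoothed_ends (s c) (ends D c))"
      by (subst insert_Diff[OF c, symmetric], rule UN_insert)
    then show ?thesis unfolding other_pairs_def by (simp only: Un_ac)
  qed
  note U = Union_rest[OF c, of s]
  have two: "eqv_classes (darts D) (together ({{?e a, ?e b}, {?e a', ?e b'}} \<union> rest s c)) =
      fuse (fuse B (?e a') (?e b')) (?e a) (?e b)" if "a < 4" "b < 4" "a' < 4" "b' < 4" for a b a' b'
  proof -
    have "\<Union>(insert {?e a', ?e b'} (rest s c)) \<subseteq> darts D" using U e that by auto
    then have "eqv_classes (darts D) (together (insert {?e a, ?e b} (insert {?e a', ?e b'} (rest s c)))) =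
      fuse (eqv_classes (darts D) (together (insert {?e a', ?e b'} (rest s c)))) (?e a) (?e b)"
      by (rule eqv_classes_together_insert) (use e that in simp_all)
    also have "eqv_classes (darts D) (together (insert {?e a', ?e b'} (rest s c))) = fuse B (?e a') (?e b')"
      unfolding B by (rule eqv_classes_together_insert) (use e that U in simp_all)
    finally show ?thesis by simp
  qed
  show "s c = Pos \<Longrightarrow> circles D s = fuse (fuse B (?e 2) (?e 3)) (?e 0) (?e 1)"
    using two[of 0 1 2 3] by (simp only: circles_def F smoothed_ends.simps)
  show "s c = Neg \<Longrightarrow> circles D s = fuse (fuse B (?e 3) (?e 0)) (?e 1) (?e 2)"
    using two[of 1 2 3 0] by (simp only: circles_def F smoothed_ends.simps)
qed

lemma circles_partition: "partition_on (darts D) (circles D s)"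
proof -
  have "\<Union>(arcs D \<union> points D \<union> (\<Union>c\<in>crossings D. smoothed_ends (s c) (ends D c))) \<subseteq> darts D"
    using arc_in_darts vertex_in_darts smoothed_pair(1) by blast
  then show ?thesis unfolding circles_def
    by (intro partition_on_eqv_classes) (unfold together_def, blast)
qed

lemma finite_circles: "finite (circles D s)"
  using circles_partition fin(1) by (metis finite_UnionD partition_onD1)

text \<open>
  If the strands join the ends 0 with 1 and 2 with 3, they close up to two circles for the positive
  marker and form one circle for the negative marker. If they join 0 with 3 and 1 with 2, it is
  the other way around.
\<close>

lemma saddle_at_crossing:
  assumes c: "c \<in> crossings D" and s: "s c = Pos" "s' = s(c := Neg)"
  shows "saddle (ends D c 0) (ends D c 2) (circles D s) (circles D s')"
proof -
  let ?e = "ends D c"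
  define B where B: "B = eqv_classes (darts D) (together (rest s c))"
  have "rest s' c = rest s c" by (auto simp: other_pairs_def s(2))
  then have B': "B = eqv_classes (darts D) (together (rest s' c))" by (simp add: B)
  note Pos = circles_fuse(1)[OF c B s(1)]
  have Neg: "circles D s' = fuse (fuse B (?e 3) (?e 0)) (?e 1) (?e 2)"
    by (rule circles_fuse(2)[OF c B']) (simp add: s(2))
  have P: "partition_on (darts D) B" unfolding B
    by (rule partition_on_eqv_classes) (use Union_rest[OF c, of s] in \<open>unfold together_def, blast\<close>)
  have e: "?e k \<in> darts D" if "k < 4" for k using ends_in_darts[OF c that] .
  have e': "?e 0 \<in> darts D" "?e 1 \<in> darts D" "?e 2 \<in> darts D" "?e 3 \<in> darts D" using e by simp_all
  have P02: "partition_on (darts D) (fuse B (?e 0) (?e 2))" using partition_on_fuse[OF P] e' by blast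
  have refl: "joined B (?e 0) (?e 0)" "joined B (?e 2) (?e 2)"
    using e' partition_onD1[OF P] by (auto simp: joined_def)
  note nj = strands_at_crossing(1)[OF c B]
  from strands_at_crossing(2)[OF c B] show ?thesis
  proof
    assume "joined B (?e 0) (?e 1) \<and> joined B (?e 2) (?e 3)"
    then have j: "joined B (?e 0) (?e 1)" "joined B (?e 2) (?e 3)" "joined B (?e 1) (?e 0)" "joined B (?e 3) (?e 2)"
      by (simp_all add: joined_sym)
    have "circles D s = B" using j by (simp add: Pos fuse_joined[OF P])
    moreover have "fuse B (?e 3) (?e 0) = fuse B (?e 0) (?e 2)"
      using fuse_cong[OF P j(4), of "?e 0"] fuse_commute[of B "?e 2" "?e 0"] by simp
    moreover have "joined (fuse B (?e 0) (?e 2)) (?e 1) (?e 2)"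
      using j refl unfolding joined_fuse[OF P e'(1,3)] by simp
    ultimately show ?thesis using nj by (simp add: saddle_def Neg fuse_joined[OF P02])
  next
    assume "joined B (?e 0) (?e 3) \<and> joined B (?e 2) (?e 1)"
    then have j: "joined B (?e 0) (?e 3)" "joined B (?e 2) (?e 1)" "joined B (?e 3) (?e 0)" "joined B (?e 1) (?e 2)"
      by (simp_all add: joined_sym)
    have "circles D s' = B" using j by (simp add: Neg fuse_joined[OF P])
    moreover have "fuse B (?e 2) (?e 3) = fuse B (?e 0) (?e 2)"
      using fuse_cong[OF P j(3), of "?e 2"] fuse_commute[of B "?e 2" "?e 3"] by simp
    moreover have "joined (fuse B (?e 0) (?e 2)) (?e 0) (?e 1)"
      using j refl unfolding joined_fuse[OF P e'(1,3)] by simp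
    ultimately show ?thesis using nj by (simp add: saddle_def Pos fuse_joined[OF P02])
  qed
qed

lemma joined_smoothed:
  assumes "c \<in> crossings D" "p \<in> smoothed_ends (s c) (ends D c)" "x \<in> p" "y \<in> p"
  shows "joined (circles D s) x y"
proof -
  have "x \<in> darts D" using smoothed_pair(1)[OF assms(1,2)] assms(1,3) vertex_in_darts by blast
  moreover have "(x, y) \<in> conn (together (arcs D \<union> points D \<union> (\<Union>c\<in>crossings D. smoothed_ends (s c) (ends D c))))"
    using assms by (intro r_into_rtrancl) (auto simp: together_def)
  ultimately show ?thesis by (simp only: circles_def joined_eqv_classes)
qed

lemma end_joined:
  assumes c: "c \<in> crossings D" and e: "e \<in> ends_at D c"
  shows "joined (circles D s) (ends D c 0) e \<or> joined (circles D s) (ends D c 2) e"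
proof -
  let ?e = "ends D c"
  note j = joined_smoothed[OF c, of _ s]
  from e consider "e = ?e 0" | "e = ?e 1" | "e = ?e 2" | "e = ?e 3" by (auto simp: ends_at_eq)
  then show ?thesis
    using j[of "{?e 0, ?e 1}"] j[of "{?e 2, ?e 3}"] j[of "{?e 1, ?e 2}"] j[of "{?e 3, ?e 0}"]
    by cases (cases "s c"; simp)+
qed

text \<open>
  So the incidence numbers can be read off from the two sets of circles alone.
\<close>

lemma untouched_circles:
  assumes c: "c \<in> crossings D" and s: "s c = Pos" "s' = s(c := Neg)"
    and C: "C \<in> circles D s \<union> circles D s'"
  shows "C \<inter> ends_at D c = {} \<longleftrightarrow> C \<in> circles D s \<inter> circles D s'"
proof (rule unchanged_by_saddle[OF circles_partition circles_partition _ _ saddle_at_crossing[OF c s] _ _ _ _ C])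
  show "ends D c 0 \<in> darts D" "ends D c 2 \<in> darts D" using ends_in_darts[OF c] by simp_all
  show "ends D c 0 \<in> ends_at D c" "ends D c 2 \<in> ends_at D c" by (simp_all add: ends_at_eq)
qed (erule end_joined[OF c])+

end

section \<open>Homology in terms of the matrix of the boundary map\<close>

text \<open>
  The matrix entries of the boundary map.
\<close>

definition coefficient ::
    "('c::linorder, 'd) diagram \<Rightarrow> ('c, 'd) enhanced_state \<Rightarrow> ('c, 'd) enhanced_state \<Rightarrow> int" where
  "coefficient D S S' = (- 1) ^ neg_above D S S' * incidence D S S'"

text \<open>
  Every cycle is a boundary, with chains as coefficient functions; values
  outside of the generators in question are irrelevant. This form avoids carriers and cosets.
\<close>

definition exact_at :: "('c::linorder, 'd) diagram \<Rightarrow> int \<Rightarrow> int \<Rightarrow> bool" where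
  "exact_at D i j \<longleftrightarrow> (\<forall>x.
     (\<forall>S'\<in>generators D (i - 2) j. (\<Sum>S\<in>generators D i j. x S * coefficient D S S') = 0) \<longrightarrow>
     (\<exists>y. \<forall>S\<in>generators D i j. x S = (\<Sum>T\<in>generators D (i + 2) j. y T * coefficient D T S)))"

lemma lookup_sum_frag:
  "Poly_Mapping.lookup (\<Sum>i\<in>I. f i) k = (\<Sum>i\<in>I. Poly_Mapping.lookup (f i) k)"
  by (induction I rule: infinite_finite_induct) (auto simp: lookup_add)

lemma lookup_boundary:
  assumes fin: "\<And>i j. finite (generators D i j)" and x: "Poly_Mapping.keys x \<subseteq> generators D i j"
  shows "Poly_Mapping.lookup (boundary D i j x) S' = (if S' \<in> generators D (i - 2) j
    then \<Sum>S\<in>generators D i j. Poly_Mapping.lookup x S * coefficient D S S' else 0)"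
proof -
  have inner: "Poly_Mapping.lookup (\<Sum>S'\<in>generators D (i - 2) j.
       frag_cmul ((- 1) ^ neg_above D S S' * incidence D S S') (frag_of S')) S' =
      (if S' \<in> generators D (i - 2) j then coefficient D S S' else 0)" for S
  proof -
    have "Poly_Mapping.lookup (\<Sum>S'\<in>generators D (i - 2) j.
       frag_cmul ((- 1) ^ neg_above D S S' * incidence D S S') (frag_of S')) S' =
      (\<Sum>T\<in>generators D (i - 2) j. if T = S' then coefficient D S S' else 0)"
      unfolding lookup_sum_frag by (rule sum.cong) (auto simp: coefficient_def lookup_frag_of)
    then show ?thesis using fin by (simp add: sum.delta)
  qed
  have "Poly_Mapping.lookup (boundary D i j x) S' = (\<Sum>S\<in>Poly_Mapping.keys x.
     Poly_Mapping.lookup x S * (if S' \<in> generators D (i - 2) j then coefficient D S S' else 0))"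
    unfolding boundary_def frag_extend_def lookup_sum_frag by (simp add: inner)
  also have "\<dots> = (\<Sum>S\<in>generators D i j.
     Poly_Mapping.lookup x S * (if S' \<in> generators D (i - 2) j then coefficient D S S' else 0))"
    by (rule sum.mono_neutral_left) (use fin x in \<open>auto simp: in_keys_iff\<close>)
  finally show ?thesis by simp
qed

lemma keys_boundary:
  assumes fin: "\<And>i j. finite (generators D i j)" and x: "Poly_Mapping.keys x \<subseteq> generators D i j"
  shows "Poly_Mapping.keys (boundary D i j x) \<subseteq> generators D (i - 2) j"
  using lookup_boundary[OF assms] by (auto simp: in_keys_iff split: if_splits)

definition chain_of :: "'a set \<Rightarrow> ('a \<Rightarrow> int) \<Rightarrow> 'a \<Rightarrow>\<^sub>0 int" where
  "chain_of A x = (\<Sum>S\<in>A. frag_cmul (x S) (frag_of S))"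

lemma lookup_chain_of:
  assumes "finite A"
  shows "Poly_Mapping.lookup (chain_of A x) S = (if S \<in> A then x S else 0)"
proof -
  have "Poly_Mapping.lookup (chain_of A x) S = (\<Sum>T\<in>A. if T = S then x S else 0)"
    unfolding chain_of_def lookup_sum_frag by (rule sum.cong) (auto simp: lookup_frag_of)
  then show ?thesis using assms by (simp add: sum.delta)
qed

lemma keys_chain_of: "finite A \<Longrightarrow> Poly_Mapping.keys (chain_of A x) \<subseteq> A"
  by (metis in_keys_iff lookup_chain_of subsetI)

lemma exact_at_iff_kernel_in_image:
  assumes fin: "\<And>i j. finite (generators D i j)"
  shows "exact_at D i j \<longleftrightarrow> kernel (chain_group D i j) (chain_group D (i - 2) j) (boundary D i j)
    \<subseteq> boundary D (i + 2) j ` carrier (chain_group D (i + 2) j)" (is "_ \<longleftrightarrow> ?K \<subseteq> ?B")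
proof
  assume ex: "exact_at D i j"
  show "?K \<subseteq> ?B"
  proof
    fix x assume "x \<in> ?K"
    then have x: "Poly_Mapping.keys x \<subseteq> generators D i j" "boundary D i j x = 0"
      by (auto simp: kernel_def chain_group_def)
    have "(\<Sum>S\<in>generators D i j. Poly_Mapping.lookup x S * coefficient D S S') = 0"
      if "S' \<in> generators D (i - 2) j" for S'
      using lookup_boundary[OF fin x(1), of S'] x(2) that by simp
    then obtain y where y: "\<And>S. S \<in> generators D i j \<Longrightarrow> Poly_Mapping.lookup x S =
        (\<Sum>T\<in>generators D (i + 2) j. y T * coefficient D T S)"
      using ex unfolding exact_at_def by blast
    let ?y = "chain_of (generators D (i + 2) j) y"
    have ky: "Poly_Mapping.keys ?y \<subseteq> generators D (i + 2) j" using keys_chain_of[OF fin] .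
    have "x = boundary D (i + 2) j ?y"
    proof (rule poly_mapping_eqI)
      fix S
      have "(\<Sum>T\<in>generators D (i + 2) j. Poly_Mapping.lookup ?y T * coefficient D T S) =
          (\<Sum>T\<in>generators D (i + 2) j. y T * coefficient D T S)"
        by (rule sum.cong) (simp_all add: lookup_chain_of[OF fin])
      moreover have "Poly_Mapping.lookup x S = 0" if "S \<notin> generators D i j"
        using that x(1) by (metis in_keys_iff subsetD)
      ultimately show "Poly_Mapping.lookup x S = Poly_Mapping.lookup (boundary D (i + 2) j ?y) S"
        using y[of S] by (simp add: lookup_boundary[OF fin ky])
    qed
    then show "x \<in> ?B" using ky by (auto simp: chain_group_def)
  qed
next
  assume KB: "?K \<subseteq> ?B"
  show "exact_at D i j"
    unfolding exact_at_def
  proof (intro allI impI)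
    fix x assume x: "\<forall>S'\<in>generators D (i - 2) j. (\<Sum>S\<in>generators D i j. x S * coefficient D S S') = 0"
    let ?x = "chain_of (generators D i j) x"
    have kx: "Poly_Mapping.keys ?x \<subseteq> generators D i j" using keys_chain_of[OF fin] .
    have "boundary D i j ?x = 0"
    proof (rule poly_mapping_eqI)
      fix S'
      have "(\<Sum>S\<in>generators D i j. Poly_Mapping.lookup ?x S * coefficient D S S') =
          (\<Sum>S\<in>generators D i j. x S * coefficient D S S')"
        by (rule sum.cong) (simp_all add: lookup_chain_of[OF fin])
      then show "Poly_Mapping.lookup (boundary D i j ?x) S' = Poly_Mapping.lookup 0 S'"
        using x by (simp add: lookup_boundary[OF fin kx])
    qed
    then have "?x \<in> ?K" using kx by (auto simp: kernel_def chain_group_def)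
    then obtain y where y: "Poly_Mapping.keys y \<subseteq> generators D (i + 2) j" "?x = boundary D (i + 2) j y"
      using KB by (auto simp: chain_group_def)
    have "x S = (\<Sum>T\<in>generators D (i + 2) j. Poly_Mapping.lookup y T * coefficient D T S)"
      if "S \<in> generators D i j" for S
      using arg_cong[OF y(2), of "\<lambda>z. Poly_Mapping.lookup z S"] that
      by (simp add: lookup_boundary[OF fin y(1)] lookup_chain_of[OF fin])
    then show "\<exists>y. \<forall>S\<in>generators D i j. x S = (\<Sum>T\<in>generators D (i + 2) j. y T * coefficient D T S)"
      by blast
  qed
qed

text \<open>
  In this form, with \<open>B\<close> and \<open>K\<close> two subgroups of an ambient group, it fits the definition of
  homology before the boundary map is known to square to zero.
\<close>

lemma trivial_quotient_iff:
  assumes G: "group G" and K: "subgroup K G" and B: "subgroup B G"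
  shows "trivial_group (subgroup_generated G K Mod B) \<longleftrightarrow> K \<subseteq> B"
proof -
  interpret group G by (rule G)
  have carr: "carrier (subgroup_generated G K) = K"
    using K by (rule subgroup.carrier_subgroup_generated_subgroup)
  have coset: "B #>\<^bsub>subgroup_generated G K\<^esub> x = B #>\<^bsub>G\<^esub> x" for x
    by (simp add: r_coset_def)
  have car: "carrier (subgroup_generated G K Mod B) = (\<lambda>x. B #>\<^bsub>G\<^esub> x) ` K"
    by (simp add: carrier_FactGroup carr coset)
  show ?thesis
  proof
    assume "trivial_group (subgroup_generated G K Mod B)"
    then have "(\<lambda>x. B #>\<^bsub>G\<^esub> x) ` K = {B}" by (simp add: trivial_group_def car)
    then have "B #>\<^bsub>G\<^esub> x = B" if "x \<in> K" for x using that by blast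
    then show "K \<subseteq> B"
      using rcos_self[OF _ B] subgroup.subset[OF K] by blast
  next
    assume KB: "K \<subseteq> B"
    then have "B #>\<^bsub>G\<^esub> x = B" if "x \<in> K" for x
      using that coset_join2[OF _ B] subgroup.subset[OF K] by blast
    moreover have "K \<noteq> {}" using subgroup.one_closed[OF K] by blast
    ultimately have car': "carrier (subgroup_generated G K Mod B) = {B}"
      unfolding car by auto
    have BB: "B <#>\<^bsub>subgroup_generated G K\<^esub> B = B"
      using subgroup_mult_id[OF B] by (simp add: set_mult_def)
    have "group (subgroup_generated G K Mod B)"
      by (rule groupI) (simp_all add: car' BB)
    then show "trivial_group (subgroup_generated G K Mod B)"
      by (simp add: trivial_group_def car')
  qed
qed

lemma boundary_hom:
  assumes fin: "\<And>i j. finite (generators D i j)"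
  shows "group_hom (chain_group D i j) (chain_group D (i - 2) j) (boundary D i j)"
proof -
  have "boundary D i j (x + y) = boundary D i j x + boundary D i j y" for x y
    by (simp add: boundary_def frag_extend_add)
  then show ?thesis
    using keys_boundary[OF fin]
    by (intro group_hom.intro group_hom_axioms.intro) (auto simp: chain_group_def hom_def)
qed

lemma trivial_homology_iff_exact:
  assumes fin: "\<And>i j. finite (generators D i j)"
  shows "trivial_group (khovanov_homology D i j) \<longleftrightarrow> exact_at D i j"
proof -
  have K: "subgroup (kernel (chain_group D i j) (chain_group D (i - 2) j) (boundary D i j)) (chain_group D i j)"
    by (rule group_hom.subgroup_kernel[OF boundary_hom[OF fin]])
  have "group_hom (chain_group D (i + 2) j) (chain_group D i j) (boundary D (i + 2) j)"
    using boundary_hom[OF fin, of "i + 2" j] by simp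
  then have B: "subgroup (boundary D (i + 2) j ` carrier (chain_group D (i + 2) j)) (chain_group D i j)"
    by (rule group_hom.img_is_subgroup)
  have "group (chain_group D i j)" by (simp add: chain_group_def)
  then show ?thesis
    unfolding khovanov_homology_def cycle_group_def exact_at_iff_kernel_in_image[OF fin]
    using trivial_quotient_iff K B by blast
qed

section \<open>The boundary map squares to zero\<close>

lemma finite_sign: "finite (UNIV :: sign set)"
proof -
  have "(UNIV :: sign set) = {Pos, Neg}" using sign.exhaust by auto
  then show ?thesis by (metis finite.emptyI finite.insertI)
qed

lemma finite_generators:
  assumes "finite (darts D)" "finite (crossings D)"
  shows "finite (generators D i j)"
proof -
  have "finite (states D)" unfolding states_def by (rule finite_PiE) (use assms finite_sign in auto)
  moreover have "finite (circles D s)" for s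
    unfolding circles_def eqv_classes_def quotient_def using assms by auto
  then have "finite (circles D s \<rightarrow>\<^sub>E (UNIV :: sign set))" for s
    by (intro finite_PiE finite_sign)
  ultimately have "finite (enhanced_states D)" unfolding enhanced_states_def by (rule finite_SigmaI)
  then show ?thesis by (rule finite_subset[rotated]) (auto simp: generators_def)
qed

lemma tau_eq_excess: "tau D (s, f) = excess (circles D s) f"
  by (simp add: tau_def excess_def)

definition negs_above :: "('c::linorder, 'd) diagram \<Rightarrow> ('c \<Rightarrow> sign) \<Rightarrow> 'c \<Rightarrow> nat" where
  "negs_above D s c = card {c'\<in>crossings D. c < c' \<and> s c' = Neg}"

lemma generators_iff:
  "(s, f) \<in> generators D i j \<longleftrightarrow> s \<in> states D \<and> f \<in> circles D s \<rightarrow>\<^sub>E UNIV \<and>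
     signature D (s, f) = i \<and> i + 2 * excess (circles D s) f = j"
  by (auto simp: generators_def enhanced_states_def tau_eq_excess)

lemma signature_lower:
  assumes "finite (crossings D)" "c \<in> crossings D" "s c = Pos"
  shows "signature D (s(c := Neg), h) = signature D (s, f) - 2"
proof -
  have p: "{c' \<in> crossings D. s c' = Pos} = insert c {c' \<in> crossings D. (s(c := Neg)) c' = Pos}"
    and n: "{c' \<in> crossings D. (s(c := Neg)) c' = Neg} = insert c {c' \<in> crossings D. s c' = Neg}"
    using assms(2,3) by auto
  show ?thesis
    unfolding signature_def fst_conv p n using assms by simp
qed

lemma states_lower: "s \<in> states D \<Longrightarrow> c \<in> crossings D \<Longrightarrow> s(c := m) \<in> states D"
  by (auto simp: states_def PiE_def extensional_def)

locale ordered_planar_diagram = planar_diagram D for D :: "('c::linorder, 'd) diagram"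
begin

lemma fin_gen: "finite (generators D i j)"
  by (rule finite_generators[OF fin])

lemma changed_lower:
  assumes "c \<in> crossings D" "s c = Pos"
  shows "changed D (s, f) (s(c := Neg), h) = {c}"
  using assms by (auto simp: changed_def)

lemma coefficient_lower:
  assumes c: "c \<in> crossings D" "s c = Pos"
  shows "coefficient D (s, f) (s(c := Neg), h) = (- 1) ^ negs_above D s c *
    of_bool (\<forall>C\<in>circles D s \<inter> circles D (s(c := Neg)). f C = h C)"
proof -
  let ?s = "s(c := Neg)"
  have "(\<forall>C\<in>circles D s \<union> circles D ?s. C \<inter> ends_at D c = {} \<longrightarrow> f C = h C) \<longleftrightarrow>
      (\<forall>C\<in>circles D s \<inter> circles D ?s. f C = h C)"
    using untouched_circles[where s = s, OF c refl] by blast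
  then have "incidence D (s, f) (?s, h) = of_bool (\<forall>C\<in>circles D s \<inter> circles D ?s. f C = h C)"
    unfolding incidence_def changed_lower[where s = s, OF c] by simp
  then show ?thesis
    by (simp add: coefficient_def neg_above_def changed_lower[where s = s, OF c] negs_above_def)
qed

text \<open>
  The states differ at one crossing, and since the signature drops, the marker there changes from positive
  to negative.
\<close>

lemma coefficient_nonzero:
  assumes S: "S \<in> generators D i j" and S': "S' \<in> generators D (i - 2) j" and nz: "coefficient D S S' \<noteq> 0"
  shows "\<exists>c\<in>crossings D. fst S c = Pos \<and> fst S' = (fst S)(c := Neg)"
proof -
  obtain s f s' f' where SS: "S = (s, f)" "S' = (s', f')" by fastforce
  have "incidence D S S' \<noteq> 0" using nz by (simp add: coefficient_def)
  then obtain c where c: "changed D S S' = {c}" unfolding incidence_def by (metis (mono_tags))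
  then have cD: "c \<in> crossings D" "s c \<noteq> s' c" by (auto simp: changed_def SS)
  have st: "s \<in> states D" "s' \<in> states D" using S S' by (auto simp: SS generators_iff)
  have eq: "s c' = s' c'" if "c' \<noteq> c" for c'
    using c that st by (cases "c' \<in> crossings D") (auto simp: changed_def SS states_def PiE_def extensional_def)
  have "s c = Pos"
  proof (rule ccontr)
    assume "s c \<noteq> Pos"
    then have "s c = Neg" "s' c = Pos" using cD(2) by (cases "s c"; cases "s' c"; simp)+
    then have "s = s'(c := Neg)" using eq by auto
    then have "signature D (s, f) = signature D (s', f') - 2"
      using signature_lower[of D c s' f f'] fin(2) cD(1) \<open>s' c = Pos\<close> by simp
    then show False using S S' by (simp add: SS generators_iff)
  qed
  moreover from this have "s' c = Neg" using cD(2) by (cases "s' c") auto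
  then have "s' = s(c := Neg)" using eq by auto
  ultimately show ?thesis using cD(1) by (auto simp: SS)
qed

lemma generators_lower:
  assumes S: "(s, f) \<in> generators D i j" and c: "c \<in> crossings D" "s c = Pos"
  shows "(s(c := Neg), h) \<in> generators D (i - 2) j \<longleftrightarrow>
    h \<in> circles D (s(c := Neg)) \<rightarrow>\<^sub>E UNIV \<and> excess (circles D (s(c := Neg))) h = excess (circles D s) f + 1"
  using S signature_lower[where s = s and h = h and f = f, OF fin(2) c] states_lower[of s D c Neg] c(1)
  by (auto simp: generators_iff)

lemma linked_lower:
  assumes S: "(s, f) \<in> generators D i j" and c: "c \<in> crossings D" "s c = Pos"
    and T: "(s(c := Neg), h) \<in> generators D (i - 2) j"
  shows "coefficient D (s, f) (s(c := Neg), h) = (- 1) ^ negs_above D s c *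
    of_bool (linked (circles D s) f (circles D (s(c := Neg))) h)"
  using T generators_lower[OF S c] by (simp add: coefficient_lower[where s = s, OF c] linked_def)

text \<open>
  The part of the composition of two boundary maps that changes the marker at \<open>a\<close> first and at \<open>b\<close> second.
\<close>

lemma sum_through_state:
  assumes S: "(s, f) \<in> generators D i j" and a: "a \<in> crossings D" "s a = Pos"
    and b: "b \<in> crossings D" "s b = Pos" "a \<noteq> b"
    and R: "(s(a := Neg, b := Neg), g) \<in> generators D (i - 2 - 2) j"
  shows "(\<Sum>T | T \<in> generators D (i - 2) j \<and> fst T = s(a := Neg).
      coefficient D (s, f) T * coefficient D T (s(a := Neg, b := Neg), g)) =
    (- 1) ^ (negs_above D s a + negs_above D (s(a := Neg)) b) *
      int (routes (circles D s) (circles D (s(a := Neg))) (circles D (s(a := Neg, b := Neg))) f g)"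
proof -
  let ?s = "s(a := Neg)" and ?t = "s(a := Neg, b := Neg)"
  let ?H = "{h \<in> circles D ?s \<rightarrow>\<^sub>E UNIV. excess (circles D ?s) h = excess (circles D s) f + 1}"
  let ?n = "negs_above D s a + negs_above D ?s b"
  let ?L = "\<lambda>h. linked (circles D s) f (circles D ?s) h \<and> linked (circles D ?s) h (circles D ?t) g"
  have sb: "?s b = Pos" using b by simp
  have set: "{T. T \<in> generators D (i - 2) j \<and> fst T = ?s} = Pair ?s ` ?H"
    using generators_lower[OF S a] by (auto simp: image_iff)
  have fin_all: "finite (circles D ?s \<rightarrow>\<^sub>E (UNIV :: sign set))"
    by (intro finite_PiE finite_sign finite_circles)
  have "(\<Sum>T | T \<in> generators D (i - 2) j \<and> fst T = ?s.
      coefficient D (s, f) T * coefficient D T (?t, g)) =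
    (\<Sum>h\<in>?H. coefficient D (s, f) (?s, h) * coefficient D (?s, h) (?t, g))"
    unfolding set by (subst sum.reindex) (auto simp: inj_on_def)
  also have "\<dots> = (\<Sum>h\<in>?H. (- 1) ^ ?n * of_bool (?L h))"
  proof (rule sum.cong[OF refl])
    fix h assume "h \<in> ?H"
    then have T: "(?s, h) \<in> generators D (i - 2) j" using generators_lower[OF S a] by simp
    show "coefficient D (s, f) (?s, h) * coefficient D (?s, h) (?t, g) = (- 1) ^ ?n * of_bool (?L h)"
      unfolding linked_lower[OF S a T] linked_lower[OF T b(1) sb R]
      by (simp add: power_add of_bool_conj)
  qed
  also have "\<dots> = (- 1) ^ ?n * int (card {h\<in>?H. ?L h})"
    using fin_all by (simp add: sum_distrib_left[symmetric] sum_of_bool_eq Int_def conj_ac)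
  also have "{h\<in>?H. ?L h} = {h \<in> circles D ?s \<rightarrow>\<^sub>E UNIV. ?L h}"
    by (auto simp: linked_def)
  finally show ?thesis unfolding routes_def .
qed

text \<open>
  A nonzero contribution lowers two markers, at \<open>a < b\<close>, in either order. Both orders have
  the same number of signings in between by \<open>saddle_square\<close>. The signs are opposite: with \<open>b\<close> lowered
  first, there is one more negative marker above \<open>a\<close>.
\<close>

theorem coefficient_square_zero:
  assumes S: "S \<in> generators D i j" and R: "R \<in> generators D (i - 2 - 2) j"
  shows "(\<Sum>T\<in>generators D (i - 2) j. coefficient D S T * coefficient D T R) = 0"
proof (cases "\<exists>T\<in>generators D (i - 2) j. coefficient D S T * coefficient D T R \<noteq> 0")
  case False
  then show ?thesis by (intro sum.neutral) blast
next
  case True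
  obtain s f r g where SR: "S = (s, f)" "R = (r, g)" by fastforce
  have two: "\<exists>c c'. c \<in> crossings D \<and> c' \<in> crossings D \<and> c \<noteq> c' \<and> s c = Pos \<and> s c' = Pos \<and>
      fst T = s(c := Neg) \<and> r = s(c := Neg, c' := Neg)"
    if T: "T \<in> generators D (i - 2) j" "coefficient D S T * coefficient D T R \<noteq> 0" for T
  proof -
    have nz: "coefficient D S T \<noteq> 0" "coefficient D T R \<noteq> 0" using T(2) by auto
    obtain c where c: "c \<in> crossings D" "s c = Pos" "fst T = s(c := Neg)"
      using coefficient_nonzero[OF S T(1) nz(1)] by (auto simp: SR)
    obtain c' where c': "c' \<in> crossings D" "fst T c' = Pos" "r = (fst T)(c' := Neg)"
      using coefficient_nonzero[OF T(1) R nz(2)] by (auto simp: SR)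
    have "c \<noteq> c'" using c c' by auto
    then have "s c' = Pos" using c c' by simp
    then show ?thesis using c c' \<open>c \<noteq> c'\<close> by (intro exI[of _ c] exI[of _ c']) simp
  qed
  obtain c1 c2 where c12: "c1 \<in> crossings D" "c2 \<in> crossings D" "c1 \<noteq> c2" "s c1 = Pos" "s c2 = Pos"
    "r = s(c1 := Neg, c2 := Neg)" using True two by blast
  obtain a b where ab: "a \<in> crossings D" "b \<in> crossings D" "a < b" "s a = Pos" "s b = Pos"
    "r = s(a := Neg, b := Neg)"
  proof (cases "c1 < c2")
    case True
    then show thesis using that[of c1 c2] c12 by simp
  next
    case False
    then have "c2 < c1" using c12(3) by simp
    then show thesis using that[of c2 c1] c12 fun_upd_twist[of c1 c2 s Neg Neg] by simp
  qed
  then have "a \<noteq> b" by simp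
  have r': "r = s(b := Neg, a := Neg)" using ab(6) fun_upd_twist[OF \<open>a \<noteq> b\<close>] by simp
  let ?G = "generators D (i - 2) j" and ?t = "\<lambda>T. coefficient D S T * coefficient D T R"
  let ?P = "circles D s" and ?A = "circles D (s(a := Neg))" and ?B = "circles D (s(b := Neg))"
  let ?R = "circles D r"
  have mid: "fst T = s(a := Neg) \<or> fst T = s(b := Neg)" if T: "T \<in> ?G" "?t T \<noteq> 0" for T
  proof -
    obtain c c' where c: "c \<noteq> c'" "s c = Pos" "fst T = s(c := Neg)" "r = s(c := Neg, c' := Neg)"
      using two[OF T] by blast
    have "r c = Neg" using c(1,4) by simp
    then have "c = a \<or> c = b" using c(2) unfolding ab(6) by (auto split: if_splits)
    then show ?thesis using c(3) by auto
  qed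
  have ne: "s(a := Neg) \<noteq> s(b := Neg)"
  proof
    assume "s(a := Neg) = s(b := Neg)"
    then have "(s(a := Neg)) a = (s(b := Neg)) a" by simp
    then show False using \<open>a \<noteq> b\<close> ab(4) by simp
  qed
  have "(\<Sum>T\<in>?G. ?t T) = (\<Sum>T | T \<in> ?G \<and> (fst T = s(a := Neg) \<or> fst T = s(b := Neg)). ?t T)"
    by (rule sum.mono_neutral_right) (use fin_gen mid in auto)
  also have "{T. T \<in> ?G \<and> (fst T = s(a := Neg) \<or> fst T = s(b := Neg))} =
      {T. T \<in> ?G \<and> fst T = s(a := Neg)} \<union> {T. T \<in> ?G \<and> fst T = s(b := Neg)}" by auto
  also have "(\<Sum>T\<in>\<dots>. ?t T) = (\<Sum>T | T \<in> ?G \<and> fst T = s(a := Neg). ?t T) +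
      (\<Sum>T | T \<in> ?G \<and> fst T = s(b := Neg). ?t T)"
    by (rule sum.union_disjoint) (use fin_gen ne in auto)
  also have "(\<Sum>T | T \<in> ?G \<and> fst T = s(a := Neg). ?t T) =
      (- 1) ^ (negs_above D s a + negs_above D (s(a := Neg)) b) * int (routes ?P ?A ?R f g)"
    using sum_through_state[OF S[unfolded SR] ab(1,4,2,5) \<open>a \<noteq> b\<close>] R by (simp add: SR ab(6))
  also have "(\<Sum>T | T \<in> ?G \<and> fst T = s(b := Neg). ?t T) =
      (- 1) ^ (negs_above D s b + negs_above D (s(b := Neg)) a) * int (routes ?P ?B ?R f g)"
    using sum_through_state[OF S[unfolded SR] ab(2,5,1,4) \<open>a \<noteq> b\<close>[symmetric]] R by (simp add: SR r')
  also have "routes ?P ?B ?R f g = routes ?P ?A ?R f g"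
  proof (rule saddle_square[symmetric])
    show "saddle (ends D a 0) (ends D a 2) ?P ?A" "saddle (ends D b 0) (ends D b 2) ?P ?B"
      using saddle_at_crossing[where s = s, OF ab(1,4) refl] saddle_at_crossing[where s = s, OF ab(2,5) refl] .
    show "saddle (ends D b 0) (ends D b 2) ?A ?R"
      by (rule saddle_at_crossing[where s = "s(a := Neg)", OF ab(2)]) (use ab \<open>a \<noteq> b\<close> in simp_all)
    show "saddle (ends D a 0) (ends D a 2) ?B ?R"
      by (rule saddle_at_crossing[where s = "s(b := Neg)", OF ab(1)]) (use ab(4) r' \<open>a \<noteq> b\<close> in simp_all)
    show "ends D a 0 \<in> darts D" "ends D a 2 \<in> darts D" "ends D b 0 \<in> darts D" "ends D b 2 \<in> darts D"
      using ends_in_darts[OF ab(1)] ends_in_darts[OF ab(2)] by simp_all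
  qed (rule circles_partition finite_circles)+
  also have "negs_above D (s(a := Neg)) b = negs_above D s b"
    unfolding negs_above_def using ab(3) by (intro arg_cong[of _ _ card]) auto
  also have "negs_above D (s(b := Neg)) a = Suc (negs_above D s a)"
  proof -
    have "{c' \<in> crossings D. a < c' \<and> (s(b := Neg)) c' = Neg} = insert b {c' \<in> crossings D. a < c' \<and> s c' = Neg}"
      using ab(2,3) by auto
    then show ?thesis using fin(2) ab(5) by (simp add: negs_above_def)
  qed
  finally show ?thesis by (simp add: power_add)
qed

end

section \<open>Smoothed diagrams as a subcomplex and its quotient\<close>

lemma smoothing_simps [simp]:
  "crossings (smoothing D c m) = crossings D - {c}" "ends (smoothing D c m) = ends D"
  "darts (smoothing D c m) = darts D" "ends_at (smoothing D c m) = ends_at D"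
  by (simp_all add: smoothing_def darts_def ends_at_def fun_eq_iff)

lemma circles_smoothing:
  assumes c: "c \<in> crossings D" and s: "s c = m" "\<And>c'. c' \<in> crossings D - {c} \<Longrightarrow> s' c' = s c'"
  shows "circles (smoothing D c m) s' = circles D s"
proof -
  have "(\<Union>c\<in>crossings D. smoothed_ends (s c) (ends D c)) =
      smoothed_ends (s c) (ends D c) \<union> (\<Union>c\<in>crossings D - {c}. smoothed_ends (s c) (ends D c))"
    by (subst insert_Diff[OF c, symmetric], rule UN_insert)
  moreover have "(\<Union>c\<in>crossings D - {c}. smoothed_ends (s' c) (ends D c)) =
      (\<Union>c\<in>crossings D - {c}. smoothed_ends (s c) (ends D c))"
    using s(2) by (intro SUP_cong refl) simp
  moreover have "arcs (smoothing D c m) = arcs D"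
    "points (smoothing D c m) = points D \<union> smoothed_ends (s c) (ends D c)"
    by (simp_all add: smoothing_def s(1))
  ultimately show ?thesis
    unfolding circles_def smoothing_simps by (simp only: Un_assoc)
qed

text \<open>
  Regards an enhanced state of the smoothed diagram as one of the diagram itself.
\<close>

definition set_marker :: "'c \<Rightarrow> sign \<Rightarrow> ('c, 'd) enhanced_state \<Rightarrow> ('c, 'd) enhanced_state" where
  "set_marker c m S = ((fst S)(c := m), snd S)"

definition marked_generators ::
    "('c, 'd) diagram \<Rightarrow> 'c \<Rightarrow> sign \<Rightarrow> int \<Rightarrow> int \<Rightarrow> ('c, 'd) enhanced_state set" where
  "marked_generators D c m i j = {S\<in>generators D i j. fst S c = m}"

fun marker_value :: "sign \<Rightarrow> int" where "marker_value Pos = 1" | "marker_value Neg = -1"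

lemma signature_set_marker:
  assumes "finite (crossings D)" "c \<in> crossings D"
  shows "signature D (set_marker c m S) = signature (smoothing D c m) S + marker_value m"
proof -
  have "{c' \<in> crossings D. fst (set_marker c m S) c' = m'} = {c' \<in> crossings (smoothing D c m). fst S c' = m'} \<union>
      (if m' = m then {c} else {})" for m'
    using assms(2) by (auto simp: set_marker_def)
  then show ?thesis
    unfolding signature_def using assms(1) by (cases m) (simp_all)
qed

lemma set_marker_bij:
  assumes fin: "finite (crossings D)" and c: "c \<in> crossings D"
  shows "bij_betw (set_marker c m) (generators (smoothing D c m) (i - marker_value m) (j - marker_value m))
    (marked_generators D c m i j)"
proof (rule bij_betw_byWitness[where f' = "\<lambda>S. (restrict (fst S) (crossings D - {c}), snd S)"])
  let ?D = "smoothing D c m" and ?u = "\<lambda>S. (restrict (fst S) (crossings D - {c}), snd S)"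
  let ?G = "generators ?D (i - marker_value m) (j - marker_value m)"
  have sig: "signature D (s(c := m), f) = signature ?D (s, f) + marker_value m" for s f
    using signature_set_marker[OF fin c, of m "(s, f)"] by (simp add: set_marker_def)
  have circ: "circles ?D s = circles D (s(c := m))" for s
    by (rule circles_smoothing[OF c]) auto
  have st: "s(c := m) \<in> states D" if "s \<in> states ?D" for s
    using that c by (auto simp: states_def PiE_def extensional_def)
  show "\<forall>S\<in>?G. ?u (set_marker c m S) = S"
  proof
    fix S assume "S \<in> ?G"
    then have "fst S \<in> states ?D" by (cases S) (simp add: generators_iff)
    then have "restrict ((fst S)(c := m)) (crossings D - {c}) = fst S"
      by (auto simp: states_def PiE_def extensional_def fun_eq_iff)
    then show "?u (set_marker c m S) = S" by (simp add: set_marker_def)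
  qed
  have restore: "(restrict s (crossings D - {c}))(c := m) = s" if "s \<in> states D" "s c = m" for s
    using that by (auto simp: states_def PiE_def extensional_def fun_eq_iff)
  show "\<forall>S\<in>marked_generators D c m i j. set_marker c m (?u S) = S"
  proof
    fix S assume "S \<in> marked_generators D c m i j"
    then have "fst S \<in> states D" "fst S c = m"
      by (cases S, simp add: marked_generators_def generators_iff)+
    then show "set_marker c m (?u S) = S" using restore by (simp add: set_marker_def)
  qed
  show "set_marker c m ` ?G \<subseteq> marked_generators D c m i j"
  proof
    fix T assume "T \<in> set_marker c m ` ?G"
    then obtain s f where T: "T = (s(c := m), f)" "(s, f) \<in> ?G" by (auto simp: set_marker_def)
    have "(s(c := m), f) \<in> generators D i j"
      using T(2) st[of s] unfolding generators_iff circ sig by simp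
    then show "T \<in> marked_generators D c m i j" by (simp add: T(1) marked_generators_def)
  qed
  show "?u ` marked_generators D c m i j \<subseteq> ?G"
  proof
    fix T assume "T \<in> ?u ` marked_generators D c m i j"
    then obtain s f where T: "T = (restrict s (crossings D - {c}), f)" "(s, f) \<in> generators D i j" "s c = m"
      by (auto simp: marked_generators_def)
    let ?s = "restrict s (crossings D - {c})"
    have "s \<in> states D" using T(2) by (simp add: generators_iff)
    then have b: "?s(c := m) = s" using restore T(3) by blast
    have "?s \<in> states ?D" by (simp add: states_def)
    then show "T \<in> ?G" using T(2) sig[of ?s f] unfolding T(1) generators_iff circ b by simp
  qed
qed

text \<open>
  A negative marker at \<open>c\<close> contributes a sign to the boundary map at all crossings below \<open>c\<close>. Multiplying
  each generator by this sign turns the inclusion of the complex of the smoothed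
  diagram into a map of complexes.
\<close>

definition marker_sign ::
    "('c::linorder, 'd) diagram \<Rightarrow> 'c \<Rightarrow> sign \<Rightarrow> ('c, 'd) enhanced_state \<Rightarrow> int" where
  "marker_sign D c m S = (if m = Neg then (- 1) ^ card {c'\<in>crossings D. c' < c \<and> fst S c' = Neg} else 1)"

lemma marker_sign_square [simp]: "marker_sign D c m S * marker_sign D c m S = 1"
  by (simp add: marker_sign_def power_mult_distrib[symmetric])

lemma coefficient_set_marker:
  fixes D :: "('c::linorder, 'd) diagram"
  assumes fin: "finite (crossings D)" and c: "c \<in> crossings D"
  shows "coefficient D (set_marker c m S) (set_marker c m S') =
    marker_sign D c m S * marker_sign D c m S' * coefficient (smoothing D c m) S S'"
proof -
  let ?D = "smoothing D c m"
  obtain s f s' f' where SS: "S = (s, f)" "S' = (s', f')" by fastforce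
  have circ: "circles ?D s = circles D (s(c := m))" for s
    by (rule circles_smoothing[OF c]) auto
  have ch: "changed D (set_marker c m S) (set_marker c m S') = changed ?D S S'"
    by (auto simp: changed_def set_marker_def)
  have inc: "incidence D (set_marker c m S) (set_marker c m S') = incidence ?D S S'"
    unfolding incidence_def ch by (simp add: SS set_marker_def circ)
  show ?thesis
  proof (cases "\<exists>e. changed ?D S S' = {e}")
    case False
    then have "incidence ?D S S' = 0" by (auto simp: incidence_def)
    then show ?thesis by (simp add: coefficient_def inc)
  next
    case True
    then obtain e where e: "changed ?D S S' = {e}" by blast
    then have eD: "e \<in> crossings D" "e \<noteq> c" "s e \<noteq> s' e" by (auto simp: changed_def SS)
    have same: "s x = s' x" if "x \<in> crossings D" "x \<noteq> c" "x \<noteq> e" for x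
      using that e by (auto simp: changed_def SS)
    have "{c' \<in> crossings D. e < c' \<and> (s(c := m)) c' = Neg} =
        {c' \<in> crossings D - {c}. e < c' \<and> s c' = Neg} \<union> (if m = Neg \<and> e < c then {c} else {})"
      using c by auto
    then have above: "neg_above D (set_marker c m S) (set_marker c m S') =
        neg_above ?D S S' + (if m = Neg \<and> e < c then 1 else 0)"
      unfolding neg_above_def ch e using fin by (simp add: SS set_marker_def)
    let ?N = "\<lambda>s. {c' \<in> crossings D. c' < c \<and> s c' = Neg}"
    have toggle: "(- 1 :: int) ^ card (?N s) * (- 1) ^ card (?N s') = (if e < c then - 1 else 1)"
    proof (cases "e < c")
      case False
      have "?N s = ?N s'" using same False by auto
      then show ?thesis using False by (simp add: power_mult_distrib[symmetric])
    next
      case True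
      have step: "card (?N t) = Suc (card (?N t'))"
        if t: "t e = Neg" "t' e = Pos" "\<And>x. x \<in> crossings D \<Longrightarrow> x \<noteq> c \<Longrightarrow> x \<noteq> e \<Longrightarrow> t x = t' x" for t t'
      proof -
        have "x \<in> ?N t \<longleftrightarrow> x \<in> insert e (?N t')" for x
          using t(1,2) t(3)[of x] True eD(1) by (cases "x = e") auto
        then have "?N t = insert e (?N t')" by blast
        moreover have "e \<notin> ?N t'" using t(2) by simp
        ultimately show ?thesis using fin by simp
      qed
      consider "s e = Neg" "s' e = Pos" | "s e = Pos" "s' e = Neg"
        using eD(3) by (cases "s e"; cases "s' e") auto
      then show ?thesis
      proof cases
        case 1
        then have "card (?N s) = Suc (card (?N s'))" using same by (intro step) auto
        then show ?thesis using True by (simp add: power_mult_distrib[symmetric])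
      next
        case 2
        then have "card (?N s') = Suc (card (?N s))" using same by (intro step) auto
        then show ?thesis using True by (simp add: power_mult_distrib[symmetric])
      qed
    qed
    have "marker_sign D c m S * marker_sign D c m S' = (if m = Neg \<and> e < c then - 1 else 1)"
      using toggle by (simp add: marker_sign_def SS)
    then show ?thesis by (simp add: coefficient_def inc above)
  qed
qed

text \<open>
  Exactness for a smoothed diagram, transported to the generators of \<open>D\<close> with the corresponding marker.
\<close>

lemma exact_marked:
  fixes D :: "('c::linorder, 'd) diagram"
  assumes fin: "finite (crossings D)" and c: "c \<in> crossings D"
    and ex: "exact_at (smoothing D c m) (i - marker_value m) (j - marker_value m)"
    and x: "\<And>S'. S' \<in> marked_generators D c m (i - 2) j \<Longrightarrow>
      (\<Sum>S\<in>marked_generators D c m i j. x S * coefficient D S S') = 0"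
  shows "\<exists>y. \<forall>S\<in>marked_generators D c m i j.
    x S = (\<Sum>T\<in>marked_generators D c m (i + 2) j. y T * coefficient D T S)"
proof -
  let ?D = "smoothing D c m" and ?e = "marker_sign D c m" and ?l = "set_marker c m"
  let ?G = "\<lambda>i. generators ?D (i - marker_value m) (j - marker_value m)"
  let ?M = "\<lambda>i. marked_generators D c m i j"
  note bij = set_marker_bij[OF fin c, of m _ j]
  note coeff = coefficient_set_marker[OF fin c, of m]
  have sum_M: "(\<Sum>S\<in>?M i. h S) = (\<Sum>S\<in>?G i. h (?l S))" for h :: "_ \<Rightarrow> int" and i
    using sum.reindex_bij_betw[OF bij, of h i] by simp
  \<comment> \<open>Signs square to one, so they can be moved to the chain.\<close>
  have "(\<Sum>S\<in>?G i. (?e S * x (?l S)) * coefficient ?D S S') = 0" if S': "S' \<in> ?G (i - 2)" for S'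
  proof -
    have "?l S' \<in> ?M (i - 2)" using bij_betw_apply[OF bij S'] .
    from x[OF this] have "(\<Sum>S\<in>?G i. x (?l S) * coefficient D (?l S) (?l S')) = 0" unfolding sum_M .
    then have "?e S' * (\<Sum>S\<in>?G i. (?e S * x (?l S)) * coefficient ?D S S') = 0"
      by (simp add: coeff sum_distrib_left mult_ac)
    then have "?e S' * ?e S' * (\<Sum>S\<in>?G i. (?e S * x (?l S)) * coefficient ?D S S') = 0"
      by (simp only: mult.assoc mult_zero_right)
    then show ?thesis by simp
  qed
  moreover have shift: "i - marker_value m - 2 = i - 2 - marker_value m" "i - marker_value m + 2 = i + 2 - marker_value m"
    by simp_all
  ultimately obtain y where y: "\<And>S. S \<in> ?G i \<Longrightarrow>
      ?e S * x (?l S) = (\<Sum>T\<in>?G (i + 2). y T * coefficient ?D T S)"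
    using ex[unfolded exact_at_def shift, THEN spec, of "\<lambda>S. ?e S * x (?l S)"] by blast
  let ?u = "inv_into (?G (i + 2)) ?l"
  have u: "?u (?l T) = T" if "T \<in> ?G (i + 2)" for T
    using bij_betw_imp_inj_on[OF bij] that by (rule inv_into_f_f)
  show ?thesis
  proof (intro exI ballI)
    fix S assume "S \<in> ?M i"
    then obtain S0 where S0: "S0 \<in> ?G i" "S = ?l S0"
      using bij_betw_imp_surj_on[OF bij, of i] by blast
    have "x S = ?e S0 * (?e S0 * x (?l S0))" by (simp add: S0 mult.assoc[symmetric])
    also have "\<dots> = (\<Sum>T\<in>?G (i + 2). y T * (?e S0 * coefficient ?D T S0))"
      unfolding y[OF S0(1)] by (simp add: sum_distrib_left mult_ac)
    also have "\<dots> = (\<Sum>T\<in>?G (i + 2). (?e (?u (?l T)) * y (?u (?l T))) * coefficient D (?l T) S)"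
    proof (rule sum.cong[OF refl])
      fix T assume T: "T \<in> ?G (i + 2)"
      have "(?e T * y T) * coefficient D (?l T) S = (?e T * ?e T) * (y T * (?e S0 * coefficient ?D T S0))"
        unfolding S0(2) coeff by (simp only: mult_ac)
      then show "y T * (?e S0 * coefficient ?D T S0) =
        (?e (?u (?l T)) * y (?u (?l T))) * coefficient D (?l T) S"
        unfolding u[OF T] by (simp only: marker_sign_square mult_1_left)
    qed
    also have "\<dots> = (\<Sum>T\<in>?M (i + 2). (?e (?u T) * y (?u T)) * coefficient D T S)"
      unfolding sum_M ..
    finally show "x S = (\<Sum>T\<in>?M (i + 2). (\<lambda>T. ?e (?u T) * y (?u T)) T * coefficient D T S)" .
  qed
qed

context ordered_planar_diagram
begin

lemma generators_split:
  "(\<Sum>S\<in>generators D i j. h S) = (\<Sum>S\<in>marked_generators D c Pos i j. h S) +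
     (\<Sum>S\<in>marked_generators D c Neg i j. h S)" for h :: "_ \<Rightarrow> int"
proof -
  have "generators D i j = marked_generators D c Pos i j \<union> marked_generators D c Neg i j"
    using sign.exhaust by (auto simp: marked_generators_def)
  moreover have "marked_generators D c Pos i j \<inter> marked_generators D c Neg i j = {}"
    by (auto simp: marked_generators_def)
  moreover have "finite (marked_generators D c m i j)" for m
    using fin_gen by (simp add: marked_generators_def)
  ultimately show ?thesis by (metis sum.union_disjoint)
qed

lemma coefficient_Neg_Pos:
  assumes "S \<in> marked_generators D c Neg i j" "S' \<in> marked_generators D c Pos (i - 2) j"
  shows "coefficient D S S' = 0"
proof (rule ccontr)
  assume "coefficient D S S' \<noteq> 0"
  then obtain c' where "fst S c' = Pos" "fst S' = (fst S)(c' := Neg)"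
    using coefficient_nonzero[of S i j S'] assms by (auto simp: marked_generators_def)
  then show False using assms by (auto simp: marked_generators_def split: if_splits)
qed

text \<open>
  The usual chase. The positive part of a cycle \<open>x\<close> is a cycle of the quotient complex, so it is the boundary
  of some \<open>y\<close> there. In the whole complex, \<open>x\<close> minus the boundary of \<open>y\<close> has no positive
  part and is again a cycle because the boundary map squares to zero, so it is the boundary of some \<open>u\<close> in the
  subcomplex.
\<close>

theorem exact_from_smoothings:
  assumes c: "c \<in> crossings D"
    and inf: "exact_at (smoothing D c Neg) (i + 1) (j + 1)"
    and zero: "exact_at (smoothing D c Pos) (i - 1) (j - 1)"
  shows "exact_at D i j"
  unfolding exact_at_def
proof (intro allI impI)
  fix x
  let ?P = "\<lambda>i. marked_generators D c Pos i j" and ?N = "\<lambda>i. marked_generators D c Neg i j"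
  let ?w = "coefficient D"
  assume "\<forall>S'\<in>generators D (i - 2) j. (\<Sum>S\<in>generators D i j. x S * ?w S S') = 0"
  then have x: "(\<Sum>S\<in>?P i. x S * ?w S S') + (\<Sum>S\<in>?N i. x S * ?w S S') = 0"
    if "S' \<in> generators D (i - 2) j" for S'
    using that unfolding generators_split[where c = c] by blast
  have "(\<Sum>S\<in>?P i. x S * ?w S S') = 0" if S': "S' \<in> ?P (i - 2)" for S'
  proof -
    have "(\<Sum>S\<in>?N i. x S * ?w S S') = 0"
      by (rule sum.neutral) (use coefficient_Neg_Pos S' in auto)
    moreover have "S' \<in> generators D (i - 2) j" using S' by (simp add: marked_generators_def)
    ultimately show ?thesis using x[of S'] by simp
  qed
  then obtain y where y: "\<And>S. S \<in> ?P i \<Longrightarrow> x S = (\<Sum>T\<in>?P (i + 2). y T * ?w T S)"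
    using exact_marked[OF fin(2) c, of Pos i j x] zero by auto
  define z where "z S = x S - (\<Sum>T\<in>?P (i + 2). y T * ?w T S)" for S
  have "(\<Sum>S\<in>?N i. z S * ?w S S') = 0" if S': "S' \<in> ?N (i - 2)" for S'
  proof -
    have S'g: "S' \<in> generators D (i - 2) j" using S' by (simp add: marked_generators_def)
    have dd: "(\<Sum>S\<in>?P i. ?w T S * ?w S S') + (\<Sum>S\<in>?N i. ?w T S * ?w S S') = 0" if "T \<in> ?P (i + 2)" for T
    proof -
      have "T \<in> generators D (i + 2) j" using that by (simp add: marked_generators_def)
      then show ?thesis
        using coefficient_square_zero[of T "i + 2" j S'] S'g
        by (simp add: generators_split[where c = c])
    qed
    have swap: "(\<Sum>S\<in>M. (\<Sum>T\<in>?P (i + 2). y T * ?w T S) * ?w S S') =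
        (\<Sum>T\<in>?P (i + 2). y T * (\<Sum>S\<in>M. ?w T S * ?w S S'))" for M
      unfolding sum_distrib_right sum_distrib_left by (subst sum.swap) (simp add: mult_ac)
    have "(\<Sum>S\<in>?P i. x S * ?w S S') = (\<Sum>S\<in>?P i. (\<Sum>T\<in>?P (i + 2). y T * ?w T S) * ?w S S')"
      by (rule sum.cong) (simp_all add: y)
    then have "(\<Sum>S\<in>?N i. z S * ?w S S') =
        - (\<Sum>T\<in>?P (i + 2). y T * (\<Sum>S\<in>?P i. ?w T S * ?w S S')) - (\<Sum>T\<in>?P (i + 2). y T * (\<Sum>S\<in>?N i. ?w T S * ?w S S'))"
      using x[OF S'g] by (simp add: z_def left_diff_distrib sum_subtractf swap)
    also have "\<dots> = - (\<Sum>T\<in>?P (i + 2). y T * ((\<Sum>S\<in>?P i. ?w T S * ?w S S') + (\<Sum>S\<in>?N i. ?w T S * ?w S S')))"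
      by (simp add: distrib_left sum.distrib)
    also have "\<dots> = 0" using dd by simp
    finally show ?thesis .
  qed
  then obtain u where u: "\<And>S. S \<in> ?N i \<Longrightarrow> z S = (\<Sum>T\<in>?N (i + 2). u T * ?w T S)"
    using exact_marked[OF fin(2) c, of Neg i j z] inf by auto
  define Y where "Y T = (if fst T c = Pos then y T else u T)" for T
  have Y: "(\<Sum>T\<in>?P k. Y T * ?w T S) = (\<Sum>T\<in>?P k. y T * ?w T S)"
    "(\<Sum>T\<in>?N k. Y T * ?w T S) = (\<Sum>T\<in>?N k. u T * ?w T S)" for k S
    by (rule sum.cong; simp add: Y_def marked_generators_def)+
  show "\<exists>y. \<forall>S\<in>generators D i j. x S = (\<Sum>T\<in>generators D (i + 2) j. y T * ?w T S)"
  proof (intro exI ballI)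
    fix S assume S: "S \<in> generators D i j"
    show "x S = (\<Sum>T\<in>generators D (i + 2) j. Y T * ?w T S)"
      unfolding generators_split[where c = c] Y
    proof (cases "fst S c")
      case Pos
      then have SP: "S \<in> ?P i" using S by (simp add: marked_generators_def)
      moreover have "(\<Sum>T\<in>?N (i + 2). u T * ?w T S) = 0"
        by (rule sum.neutral) (use coefficient_Neg_Pos[of _ c "i + 2" j S] SP in auto)
      ultimately show "x S = (\<Sum>T\<in>?P (i + 2). y T * ?w T S) + (\<Sum>T\<in>?N (i + 2). u T * ?w T S)"
        using y by simp
    next
      case Neg
      then have "S \<in> ?N i" using S by (simp add: marked_generators_def)
      from u[OF this] show "x S = (\<Sum>T\<in>?P (i + 2). y T * ?w T S) + (\<Sum>T\<in>?N (i + 2). u T * ?w T S)"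
        by (simp add: z_def)
    qed
  qed
qed

text \<open>
  If the ends 0 and 2 are on different circles in one of the two states, the other has merged them.
\<close>

lemma num_circles_lower:
  assumes c: "c \<in> crossings D" and s: "s c = Pos"
  shows "\<not> joined (circles D s) (ends D c 0) (ends D c 2) \<Longrightarrow>
      num_circles D s = Suc (num_circles D (s(c := Neg)))"
    and "\<not> joined (circles D (s(c := Neg))) (ends D c 0) (ends D c 2) \<Longrightarrow>
      num_circles D (s(c := Neg)) = Suc (num_circles D s)"
proof -
  have e: "ends D c 0 \<in> darts D" "ends D c 2 \<in> darts D" using ends_in_darts[OF c] by simp_all
  note * = card_saddle[OF circles_partition circles_partition finite_circles finite_circles e
      saddle_at_crossing[where s = s, OF c s refl]]
  show "\<not> joined (circles D s) (ends D c 0) (ends D c 2) \<Longrightarrow>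
      num_circles D s = Suc (num_circles D (s(c := Neg)))"
    and "\<not> joined (circles D (s(c := Neg))) (ends D c 0) (ends D c 2) \<Longrightarrow>
      num_circles D (s(c := Neg)) = Suc (num_circles D s)"
    using * by (simp_all add: num_circles_def)
qed

lemma adequate_not_joined:
  assumes "adequate_state D s" and c: "c \<in> crossings D"
  shows "\<not> joined (circles D s) (ends D c 0) (ends D c 2)"
proof -
  obtain C C' where C: "C \<in> circles D s" "C' \<in> circles D s" "ends D c 0 \<in> C" "ends D c 2 \<in> C'" "C \<noteq> C'"
    using assms unfolding adequate_state_def by blast
  show ?thesis
  proof
    assume "joined (circles D s) (ends D c 0) (ends D c 2)"
    then obtain X where X: "X \<in> circles D s" "ends D c 0 \<in> X" "ends D c 2 \<in> X" by (auto simp: joined_def)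
    have "X = C" by (rule partition_block_unique[OF circles_partition X(1) C(1) X(2) C(3)])
    moreover have "X = C'" by (rule partition_block_unique[OF circles_partition X(1) C(2) X(3) C(4)])
    ultimately show False using C(5) by simp
  qed
qed

end

section \<open>Thickness\<close>

theorem theorem5p3:
  fixes D :: "('c::linorder, 'd) diagram" and c :: 'c
    and k1_inf k2_inf k1_0 k2_0 :: real
  assumes "link_diagram D" and "c \<in> crossings D"
    and "H_thick (smoothing D c Neg) k1_inf k2_inf"
    and "H_thick (smoothing D c Pos) k1_0 k2_0"
  shows "let D_0 = smoothing D c Pos;
             D_inf = smoothing D c Neg;
             sp = real (num_circles D (s_plus D));
             sp_inf = real (num_circles D_inf (s_plus D_inf));
             sm = real (num_circles D (s_minus D));
             sm_0 = real (num_circles D_0 (s_minus D_0));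
             k1 = max (k1_inf + (sp_inf - sp + 1) / 2) k1_0;
             k2 = max k2_inf (k2_0 + (sm_0 - sm + 1) / 2)
         in H_thick D k1 k2 \<and>
            (sp - sp_inf = 1 \<longrightarrow> k1 = max k1_inf k1_0) \<and>
            (plus_adequate D \<longrightarrow> sp - sp_inf = 1) \<and>
            (sm - sm_0 = 1 \<longrightarrow> k2 = max k2_inf k2_0) \<and>
            (minus_adequate D \<longrightarrow> sm - sm_0 = 1)"
proof -
  interpret ordered_planar_diagram D
    by unfold_locales (use assms(1) in \<open>simp_all add: link_diagram_def\<close>)
  note c = assms(2)
  let ?D0 = "smoothing D c Pos" and ?Dinf = "smoothing D c Neg"
  let ?s = "(s_minus D)(c := Pos)"
  define sp where "sp = real (num_circles D (s_plus D))"
  define sm where "sm = real (num_circles D (s_minus D))"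
  define sp_inf where "sp_inf = real (num_circles ?Dinf (s_plus ?Dinf))"
  define sm_0 where "sm_0 = real (num_circles ?D0 (s_minus ?D0))"
  define k1 where "k1 = max (k1_inf + (sp_inf - sp + 1) / 2) k1_0"
  define k2 where "k2 = max k2_inf (k2_0 + (sm_0 - sm + 1) / 2)"
  have "circles ?Dinf (s_plus ?Dinf) = circles D ((s_plus D)(c := Neg))"
    by (rule circles_smoothing[OF c]) (auto simp: s_plus_def)
  then have sp_inf: "sp_inf = real (num_circles D ((s_plus D)(c := Neg)))"
    by (simp add: sp_inf_def num_circles_def)
  have "circles ?D0 (s_minus ?D0) = circles D ?s"
    by (rule circles_smoothing[OF c]) (auto simp: s_minus_def)
  then have sm_0: "sm_0 = real (num_circles D ?s)"
    by (simp add: sm_0_def num_circles_def)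
  have "circles ?Dinf (s_minus ?Dinf) = circles D (s_minus D)"
    by (rule circles_smoothing[OF c]) (use c in \<open>auto simp: s_minus_def\<close>)
  then have sm_inf: "real (num_circles ?Dinf (s_minus ?Dinf)) = sm"
    by (simp add: sm_def num_circles_def)
  have "circles ?D0 (s_plus ?D0) = circles D (s_plus D)"
    by (rule circles_smoothing[OF c]) (use c in \<open>auto simp: s_plus_def\<close>)
  then have sp_0: "real (num_circles ?D0 (s_plus ?D0)) = sp"
    by (simp add: sp_def num_circles_def)
  have "card (crossings D) \<ge> 1" using c fin(2) by (metis card_0_eq empty_iff less_one linorder_not_le)
  then have N: "real (card (crossings D - {c})) = real (card (crossings D)) - 1"
    using c fin(2) by (simp add: card_Diff_singleton of_nat_diff)
  have gen: "finite (generators (smoothing D c m) i j)" for m i j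
    by (rule finite_generators) (use fin in simp_all)
  have thick: "H_thick D k1 k2"
    unfolding H_thick_def
  proof (intro allI impI)
    fix i j
    assume out: "\<not> (real (card (crossings D)) - 2 * real (num_circles D (s_minus D)) - 4 * k2
        \<le> real_of_int (j - 2 * i) \<and>
      real_of_int (j - 2 * i) \<le> 2 * real (num_circles D (s_plus D)) - real (card (crossings D)) + 4 * k1)"
    define d where "d = real_of_int (j - 2 * i)"
    define n where "n = real (card (crossings D))"
    have out: "\<not> (n - 2 * sm - 4 * k2 \<le> d \<and> d \<le> 2 * sp - n + 4 * k1)"
      using out by (simp only: d_def n_def sp_def sm_def not_False_eq_True)
    have k: "k1_inf + (sp_inf - sp + 1) / 2 \<le> k1" "k1_0 \<le> k1" "k2_inf \<le> k2"
      "k2_0 + (sm_0 - sm + 1) / 2 \<le> k2"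
      by (simp_all add: k1_def k2_def)
    have "trivial_group (khovanov_homology ?Dinf (i + 1) (j + 1))"
    proof (rule assms(3)[unfolded H_thick_def, rule_format])
      have d: "real_of_int (j + 1 - 2 * (i + 1)) = d - 1" by (simp add: d_def)
      have "\<not> (n - 1 - 2 * sm - 4 * k2_inf \<le> d - 1 \<and> d - 1 \<le> 2 * sp_inf - (n - 1) + 4 * k1_inf)"
      proof
        assume "n - 1 - 2 * sm - 4 * k2_inf \<le> d - 1 \<and> d - 1 \<le> 2 * sp_inf - (n - 1) + 4 * k1_inf"
        then have "n - 2 * sm - 4 * k2 \<le> d" "d \<le> 2 * sp - n + 4 * k1" using k by (simp_all add: field_simps)
        then show False using out by blast
      qed
      then show "\<not> (real (card (crossings ?Dinf)) - 2 * real (num_circles ?Dinf (s_minus ?Dinf)) - 4 * k2_inf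
          \<le> real_of_int (j + 1 - 2 * (i + 1)) \<and> real_of_int (j + 1 - 2 * (i + 1))
          \<le> 2 * real (num_circles ?Dinf (s_plus ?Dinf)) - real (card (crossings ?Dinf)) + 4 * k1_inf)"
        unfolding sm_inf sp_inf_def[symmetric] smoothing_simps N n_def[symmetric] d .
    qed
    moreover have "trivial_group (khovanov_homology ?D0 (i - 1) (j - 1))"
    proof (rule assms(4)[unfolded H_thick_def, rule_format])
      have d: "real_of_int (j - 1 - 2 * (i - 1)) = d + 1" by (simp add: d_def)
      have "\<not> (n - 1 - 2 * sm_0 - 4 * k2_0 \<le> d + 1 \<and> d + 1 \<le> 2 * sp - (n - 1) + 4 * k1_0)"
      proof
        assume "n - 1 - 2 * sm_0 - 4 * k2_0 \<le> d + 1 \<and> d + 1 \<le> 2 * sp - (n - 1) + 4 * k1_0"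
        then have "n - 2 * sm - 4 * k2 \<le> d" "d \<le> 2 * sp - n + 4 * k1" using k by (simp_all add: field_simps)
        then show False using out by blast
      qed
      then show "\<not> (real (card (crossings ?D0)) - 2 * real (num_circles ?D0 (s_minus ?D0)) - 4 * k2_0
          \<le> real_of_int (j - 1 - 2 * (i - 1)) \<and> real_of_int (j - 1 - 2 * (i - 1))
          \<le> 2 * real (num_circles ?D0 (s_plus ?D0)) - real (card (crossings ?D0)) + 4 * k1_0)"
        unfolding sp_0 sm_0_def[symmetric] smoothing_simps N n_def[symmetric] d .
    qed
    ultimately show "trivial_group (khovanov_homology D i j)"
      unfolding trivial_homology_iff_exact[OF gen] trivial_homology_iff_exact[OF fin_gen]
      using exact_from_smoothings[OF c] by blast
  qed
  have plus: "sp - sp_inf = 1" if "plus_adequate D"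
  proof -
    have "num_circles D (s_plus D) = Suc (num_circles D ((s_plus D)(c := Neg)))"
      by (rule num_circles_lower(1)[OF c _ adequate_not_joined[OF _ c]])
        (use that c in \<open>simp_all add: plus_adequate_def s_plus_def\<close>)
    then show ?thesis by (simp add: sp_def sp_inf)
  qed
  have minus: "sm - sm_0 = 1" if "minus_adequate D"
  proof -
    have s: "?s(c := Neg) = s_minus D" using c by (auto simp: s_minus_def fun_eq_iff)
    have "\<not> joined (circles D (s_minus D)) (ends D c 0) (ends D c 2)"
      using that adequate_not_joined[OF _ c] by (simp add: minus_adequate_def)
    then have "\<not> joined (circles D (?s(c := Neg))) (ends D c 0) (ends D c 2)" unfolding s .
    then have "num_circles D (?s(c := Neg)) = Suc (num_circles D ?s)"
      by (intro num_circles_lower(2)[OF c]) simp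
    then have "num_circles D (s_minus D) = Suc (num_circles D ?s)" unfolding s .
    then show ?thesis by (simp add: sm_def sm_0)
  qed
  have k1: "k1 = max k1_inf k1_0" if "sp - sp_inf = 1"
  proof -
    have "sp_inf - sp + 1 = 0" using that by simp
    then show ?thesis by (simp add: k1_def)
  qed
  have k2: "k2 = max k2_inf k2_0" if "sm - sm_0 = 1"
  proof -
    have "sm_0 - sm + 1 = 0" using that by simp
    then show ?thesis by (simp add: k2_def)
  qed
  show ?thesis
    unfolding Let_def sp_def[symmetric] sm_def[symmetric] sp_inf_def[symmetric] sm_0_def[symmetric]
      k1_def[symmetric] k2_def[symmetric]
    using thick plus minus k1 k2 by blast
qed

end
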